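(* Let $\mathcal{D}_H$ be a left $H$-category and let $M$ be a right-left SAYD module over $H$. Suppose that there are an $H$-linear semifunctor $\upsilon:\mathcal{D}_H\to\mathcal{D}_H$ and an $\eta \in \mathbb U_H\left(\mathcal{D}_H \otimes M_2(k)\right)$ such that (1) $\upsilon(X)=X$ for all $X \in Ob(\mathcal{D}_H)$; (2) $\Phi_\eta(f \otimes E_{11}+\upsilon(f) \otimes E_{22})=\upsilon(f) \otimes E_{22}$ for all $f \in Hom_{\mathcal{D}_H}(X,Y)$ and $X,Y \in Ob(\mathcal{D}_H)$. Then $HC^\bullet_H(\mathcal{D}_H,M)=0$.
   Context: $H$ is a Hopf algebra over $k=\mathbb C$ with comultiplication $\Delta(h)=h_1\otimes h_2$ (Sweedler notation), counit $\varepsilon$ and bijective antipode $S$. A left $H$-category is a small $k$-linear category $\mathcal D_H$ whose Hom spaces are left $H$-modules with $h(\mathrm{id}_X)=\varepsilon(h)\mathrm{id}_X$ and $h(gf)=(h_1g)(h_2f)$. A semifunctor preserves composition but not necessarily identities; an $H$-linear semifunctor is $k$-linear and $H$-linear on Hom spaces. A right-left SAYD module is a right $H$-module and left $H$-comodule $M$, $m\mapsto m_{(-1)}\otimes m_{(0)}$, with $(mh)_{(-1)}\otimes (mh)_{(0)}=S(h_3)m_{(-1)}h_1\otimes m_{(0)}h_2$ and $m_{(0)}m_{(-1)}=m$. $\mathcal D_H\otimes M_2(k)$ is the left $H$-category with the same objects, $Hom(X,Y)=Hom_{\mathcal D_H}(X,Y)\otimes M_2(k)$, composition $(g\otimes B')(f\otimes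 B)=gf\otimes B'B$, and action $h(f\otimes B)=hf\otimes B$. $E_{ij}$ are the elementary matrices. For a left $H$-category $\mathcal E_H$, $\mathbb U_H(\mathcal E_H)$ is the group of families $\eta=\{\eta(X)\in Aut_{\mathcal E_H}(X)\}_X$ with $h(\eta(X))=\varepsilon(h)\eta(X)$ for all $h\in H$ and all $X$, and $\Phi_\eta:\mathcal E_H\to\mathcal E_H$ is the automorphism with $\Phi_\eta(X)=X$, $\Phi_\eta(f)=\eta(Y)\circ f\circ\eta(X)^{-1}$ for $f\in Hom_{\mathcal E_H}(X,Y)$. $CN_n(\mathcal D_H)=\bigoplus_{(X_0,\dots,X_n)} Hom(X_1,X_0)\otimes Hom(X_2,X_1)\otimes\cdots\otimes Hom(X_0,X_n)$, with diagonal $H$-action. $C^n_H(\mathcal D_H,M)$ is the space of $k$-linear maps $\phi:M\otimes CN_n(\mathcal D_H)\to k$ with $\phi(mh_1\otimes S(h_2)(f^0\otimes\cdots\otimes f^n))=\varepsilon(h)\phi(m\otimes f^0\otimes\cdots\otimes f^n)$. On $C^n_H$: $b=\sum_{i=0}^{n+1}(-1)^i\delta_i$, where $(\delta_i\phi)(m\otimes f^0\otimes\cdots\otimes f^{n+1})=\phi(m\otimes\cdots\otimes f^if^{i+1}\otimes\cdots\otimes f^{n+1})$ for $0\le i\le n$ and $(\delta_{n+1}\phi)(m\otimes f^0\otimes\cdots\otimes f^{n+1})=\phi(m_{(0)}\otimes (S^{-1}(m_{(-1)})f^{n+1})f^0\otimes f^1\otimes\cdots\otimes f^n)$; and $\lambda=(-1)^n\tau_n$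 with $(\tau_n\phi)(m\otimes f^0\otimes\cdots\otimes f^n)=\phi(m_{(0)}\otimes S^{-1}(m_{(-1)})f^n\otimes f^0\otimes\cdots\otimes f^{n-1})$. $HC^\bullet_H(\mathcal D_H,M)$ is the cohomology of the complex $(\ker(1-\lambda),b)$. *)

theory Defs
  imports "HOL-Analysis.Analysis" "HOL-Library.Poly_Mapping"
begin

section \<open>Complex vector spaces and algebras\<close>

class complex_vector = ab_group_add +
  fixes scaleC :: "complex \<Rightarrow> 'a \<Rightarrow> 'a"  (infixr "*\<^sub>C" 75)
  assumes scaleC_add_right: "c *\<^sub>C (x + y) = c *\<^sub>C x + c *\<^sub>C y"
    and scaleC_add_left: "(c + d) *\<^sub>C x = c *\<^sub>C x + d *\<^sub>C x"
    and scaleC_scaleC: "c *\<^sub>C d *\<^sub>C x = (c * d) *\<^sub>C x"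
    and scaleC_one: "1 *\<^sub>C x = x"

class complex_algebra_1 = complex_vector + ring_1 +
  assumes mult_scaleC_left: "c *\<^sub>C x * y = c *\<^sub>C (x * y)"
    and mult_scaleC_right: "x * c *\<^sub>C y = c *\<^sub>C (x * y)"

global_interpretation cvec: vector_space "scaleC :: complex \<Rightarrow> 'a \<Rightarrow> 'a::complex_vector"
  by unfold_locales (rule scaleC_add_right scaleC_add_left scaleC_scaleC scaleC_one)+

abbreviation clinear :: "('a::complex_vector \<Rightarrow> 'b::complex_vector) \<Rightarrow> bool" where
  "clinear \<equiv> Vector_Spaces.linear scaleC scaleC"

instantiation complex :: complex_vector
begin
definition "scaleC_complex (c::complex) (x::complex) = c * x"
instance by standard (auto simp: scaleC_complex_def algebra_simps)
end

instantiation vec :: (complex_vector, finite) complex_vector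
begin
definition "scaleC_vec c (x :: 'a ^ 'b) = (\<chi> i. c *\<^sub>C (x $ i))"
instance
  by standard (auto simp: scaleC_vec_def vec_eq_iff scaleC_add_right scaleC_add_left
      scaleC_scaleC scaleC_one)
end

instantiation poly_mapping :: (type, complex_vector) complex_vector
begin
lift_definition scaleC_poly_mapping :: "complex \<Rightarrow> ('a \<Rightarrow>\<^sub>0 'b) \<Rightarrow> ('a \<Rightarrow>\<^sub>0 'b)"
  is "\<lambda>c f x. c *\<^sub>C f x"
  by (erule rev_finite_subset) auto
instance
  by standard (transfer; auto simp: scaleC_add_right scaleC_add_left scaleC_scaleC scaleC_one)+
end

definition linear_on :: "'a::complex_vector set \<Rightarrow> ('a \<Rightarrow> 'b::complex_vector) \<Rightarrow> bool" where
  "linear_on V f \<longleftrightarrow>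
     (\<forall>x\<in>V. \<forall>y\<in>V. f (x + y) = f x + f y) \<and> (\<forall>c. \<forall>x\<in>V. f (c *\<^sub>C x) = c *\<^sub>C f x)"

text \<open>\<^term>\<open>lin_ext g I F\<close> is the linear map on the span of the vectors \<open>g i\<close>, \<open>i \<in> I\<close>, that sends
  \<open>g i\<close> to \<open>F i\<close>. It renders definitions given by a formula on generators, such as pure
  tensors, and is meaningful whenever \<open>F\<close> respects the linear relations among the \<open>g i\<close>. A linear
  map on a subspace is represented by a function that is 0 outside of it.\<close>

definition lin_ext :: "('i \<Rightarrow> 'a::complex_vector) \<Rightarrow> 'i set \<Rightarrow> ('i \<Rightarrow> 'b::complex_vector) \<Rightarrow> 'a \<Rightarrow> 'b" where
  "lin_ext g I F = (THE L. linear_on (cvec.span (g ` I)) L \<and>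
     (\<forall>x. x \<notin> cvec.span (g ` I) \<longrightarrow> L x = 0) \<and> (\<forall>i\<in>I. L (g i) = F i))"


section \<open>Tensor products\<close>

lemma equivp_diff_in_span: "equivp (\<lambda>x y. x - y \<in> cvec.span R)"
proof (rule equivpI)
  show "reflp (\<lambda>x y. x - y \<in> cvec.span R)"
    by (simp add: reflp_def cvec.span_zero)
  show "symp (\<lambda>x y. x - y \<in> cvec.span R)"
  proof (rule sympI)
    fix x y assume "x - y \<in> cvec.span R"
    from cvec.span_neg[OF this] show "y - x \<in> cvec.span R" by simp
  qed
  show "transp (\<lambda>x y. x - y \<in> cvec.span R)"
  proof (rule transpI)
    fix x y z assume "x - y \<in> cvec.span R" "y - z \<in> cvec.span R"
    from cvec.span_add[OF this] show "x - z \<in> cvec.span R" by simp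
  qed
qed

lemma diff_in_span:
  assumes "x - x' \<in> cvec.span R"
  shows diff_in_span_minus: "- x - (- x') \<in> cvec.span R"
    and diff_in_span_scale: "c *\<^sub>C x - c *\<^sub>C x' \<in> cvec.span R"
    and diff_in_span_add: "y - y' \<in> cvec.span R \<Longrightarrow> x + y - (x' + y') \<in> cvec.span R"
    and diff_in_span_diff: "y - y' \<in> cvec.span R \<Longrightarrow> x - y - (x' - y') \<in> cvec.span R"
proof -
  show "- x - (- x') \<in> cvec.span R"
    using cvec.span_neg[OF assms] by simp
  show "c *\<^sub>C x - c *\<^sub>C x' \<in> cvec.span R"
    using cvec.span_scale[OF assms, of c] by (simp add: cvec.scale_right_diff_distrib)
  show "x + y - (x' + y') \<in> cvec.span R" if "y - y' \<in> cvec.span R"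
    using cvec.span_add[OF assms that] by (simp add: add_diff_add)
  show "x - y - (x' - y') \<in> cvec.span R" if "y - y' \<in> cvec.span R"
    using cvec.span_diff[OF assms that] by (simp add: algebra_simps)
qed

definition free_gen :: "'x \<Rightarrow> 'x \<Rightarrow>\<^sub>0 complex" where
  "free_gen x = Poly_Mapping.single x 1"

definition tensor_null :: "('a::complex_vector \<times> 'b::complex_vector \<Rightarrow>\<^sub>0 complex) set" where
  "tensor_null = cvec.span
    ({free_gen (a + a', b) - (free_gen (a, b) + free_gen (a', b)) | a a' b. True} \<union>
     {free_gen (a, b + b') - (free_gen (a, b) + free_gen (a, b')) | a b b'. True} \<union>
     {free_gen (c *\<^sub>C a, b) - c *\<^sub>C free_gen (a, b) | c a b. True} \<union>
     {free_gen (a, c *\<^sub>C b) - c *\<^sub>C free_gen (a, b) | c a b. True})"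

quotient_type (overloaded) ('a, 'b) tensor (infixr "\<otimes>" 21) =
    "'a::complex_vector \<times> 'b::complex_vector \<Rightarrow>\<^sub>0 complex" /
    "\<lambda>x y. x - y \<in> tensor_null"
  unfolding tensor_null_def by (rule equivp_diff_in_span)

instantiation tensor :: (complex_vector, complex_vector) complex_vector
begin
lift_definition zero_tensor :: "'a \<otimes> 'b" is 0 .
lift_definition plus_tensor :: "'a \<otimes> 'b \<Rightarrow> 'a \<otimes> 'b \<Rightarrow> 'a \<otimes> 'b" is "(+)"
  unfolding tensor_null_def by (rule diff_in_span_add)
lift_definition uminus_tensor :: "'a \<otimes> 'b \<Rightarrow> 'a \<otimes> 'b" is uminus
  unfolding tensor_null_def by (rule diff_in_span_minus)
lift_definition minus_tensor :: "'a \<otimes> 'b \<Rightarrow> 'a \<otimes> 'b \<Rightarrow> 'a \<otimes> 'b" is "(-)"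
  unfolding tensor_null_def by (rule diff_in_span_diff)
lift_definition scaleC_tensor :: "complex \<Rightarrow> 'a \<otimes> 'b \<Rightarrow> 'a \<otimes> 'b" is scaleC
  unfolding tensor_null_def by (rule diff_in_span_scale)
instance
  by standard
    (transfer; simp add: tensor_null_def cvec.span_zero scaleC_add_right scaleC_add_left
      scaleC_scaleC scaleC_one add_ac)+
end

lift_definition tensor :: "'a::complex_vector \<Rightarrow> 'b::complex_vector \<Rightarrow> 'a \<otimes> 'b" (infixr "\<otimes>" 72)
  is "\<lambda>a b. free_gen (a, b)" .

text \<open>If \<open>V\<close> and \<open>W\<close> are subspaces, then \<^term>\<open>subspace_tensor V W\<close> is (the image of) their
  tensor product, which embeds into the tensor product of the ambient spaces.\<close>

definition subspace_tensor :: "'a::complex_vector set \<Rightarrow> 'b::complex_vector set \<Rightarrow> ('a \<otimes> 'b) set" where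
  "subspace_tensor V W = cvec.span {v \<otimes> w | v w. v \<in> V \<and> w \<in> W}"

text \<open>Sweedler sums: if \<open>t = \<Sum>\<^sub>i a\<^sub>i \<otimes> b\<^sub>i\<close>, then \<open>sweedler t \<beta> = \<Sum>\<^sub>i \<beta> a\<^sub>i b\<^sub>i\<close>,
  for bilinear \<open>\<beta>\<close>.\<close>

definition sweedler :: "'a::complex_vector \<otimes> 'b::complex_vector \<Rightarrow> ('a \<Rightarrow> 'b \<Rightarrow> 'c::complex_vector) \<Rightarrow> 'c" where
  "sweedler t \<beta> = lin_ext (\<lambda>(a, b). a \<otimes> b) UNIV (\<lambda>(a, b). \<beta> a b) t"

syntax "_sweedler" :: "pttrn \<Rightarrow> pttrn \<Rightarrow> 'a \<otimes> 'b \<Rightarrow> 'c \<Rightarrow> 'c"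
  ("(3\<Sum>\<langle>_ \<otimes> _ \<leftarrow> _\<rangle>./ _)" [73, 72, 51, 61] 61)
translations "\<Sum>\<langle>a \<otimes> b \<leftarrow> t\<rangle>. e" \<rightleftharpoons> "CONST sweedler t (\<lambda>a b. e)"


section \<open>Hopf algebras and SAYD modules\<close>

record (overloaded) 'h hopf =
  comul :: "'h::complex_algebra_1 \<Rightarrow> 'h \<otimes> 'h"
  counit :: "'h \<Rightarrow> complex"
  antipode :: "'h \<Rightarrow> 'h"

locale hopf_algebra =
  fixes H :: "'h::complex_algebra_1 hopf"
  assumes linear_comul: "clinear (comul H)"
    and linear_counit: "clinear (counit H)"
    and linear_antipode: "clinear (antipode H)"
    and coassoc:
      "(\<Sum>\<langle>a \<otimes> b \<leftarrow> comul H h\<rangle>. \<Sum>\<langle>c \<otimes> d \<leftarrow> comul H a\<rangle>. c \<otimes> d \<otimes> b) =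
       (\<Sum>\<langle>a \<otimes> b \<leftarrow> comul H h\<rangle>. a \<otimes> comul H b)"
    and counit_left: "(\<Sum>\<langle>a \<otimes> b \<leftarrow> comul H h\<rangle>. counit H a *\<^sub>C b) = h"
    and counit_right: "(\<Sum>\<langle>a \<otimes> b \<leftarrow> comul H h\<rangle>. counit H b *\<^sub>C a) = h"
    and comul_mult: "comul H (g * h) =
       (\<Sum>\<langle>a \<otimes> b \<leftarrow> comul H g\<rangle>. \<Sum>\<langle>c \<otimes> d \<leftarrow> comul H h\<rangle>. (a * c) \<otimes> (b * d))"
    and comul_one: "comul H 1 = 1 \<otimes> 1"
    and counit_mult: "counit H (g * h) = counit H g * counit H h"
    and counit_one: "counit H 1 = 1"
    and antipode_left: "(\<Sum>\<langle>a \<otimes> b \<leftarrow> comul H h\<rangle>. antipode H a * b) = counit H h *\<^sub>C 1"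
    and antipode_right: "(\<Sum>\<langle>a \<otimes> b \<leftarrow> comul H h\<rangle>. a * antipode H b) = counit H h *\<^sub>C 1"
    and bij_antipode: "bij (antipode H)"

record (overloaded) ('m, 'h) hopf_mod =
  ract :: "'m::complex_vector \<Rightarrow> 'h::complex_algebra_1 \<Rightarrow> 'm"
  coact :: "'m \<Rightarrow> 'h \<otimes> 'm"

locale sayd_module =
  fixes H :: "'h::complex_algebra_1 hopf" and M :: "('m::complex_vector, 'h) hopf_mod"
  assumes ract_linear_left: "clinear (\<lambda>m. ract M m h)"
    and ract_linear_right: "clinear (\<lambda>h. ract M m h)"
    and ract_mult: "ract M m (g * h) = ract M (ract M m g) h"
    and ract_one: "ract M m 1 = m"
    and coact_linear: "clinear (coact M)"
    and coact_coassoc: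
      "(\<Sum>\<langle>a \<otimes> n \<leftarrow> coact M m\<rangle>. \<Sum>\<langle>c \<otimes> d \<leftarrow> comul H a\<rangle>. c \<otimes> d \<otimes> n) =
       (\<Sum>\<langle>a \<otimes> n \<leftarrow> coact M m\<rangle>. a \<otimes> coact M n)"
    and coact_counit: "(\<Sum>\<langle>a \<otimes> n \<leftarrow> coact M m\<rangle>. counit H a *\<^sub>C n) = m"
    and anti_yetter_drinfeld: "coact M (ract M m h) =
      (\<Sum>\<langle>h1 \<otimes> h' \<leftarrow> comul H h\<rangle>. \<Sum>\<langle>h2 \<otimes> h3 \<leftarrow> comul H h'\<rangle>. \<Sum>\<langle>a \<otimes> n \<leftarrow> coact M m\<rangle>.
         (antipode H h3 * a * h1) \<otimes> ract M n h2)"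
    and stable: "(\<Sum>\<langle>a \<otimes> n \<leftarrow> coact M m\<rangle>. ract M n a) = m"


section \<open>Left H-categories\<close>

text \<open>The Hom spaces are subspaces of one ambient vector space; this is no restriction, the
  direct sum of all Hom spaces being a possible choice. They need not be disjoint, so the structure
  maps carry their objects as arguments: \<open>Comp D X Y Z g f\<close> is the composite of \<open>f : X \<rightarrow> Y\<close> with
  \<open>g : Y \<rightarrow> Z\<close>, and \<open>Act D X Y h f\<close> is the action of \<open>h\<close> on \<open>f : X \<rightarrow> Y\<close>.
  Values of the structure maps outside the objects and Hom spaces are irrelevant.\<close>

record (overloaded) ('o, 'f, 'h) hcat =
  Ob :: "'o set"
  Hom :: "'o \<Rightarrow> 'o \<Rightarrow> 'f::complex_vector set"
  Comp :: "'o \<Rightarrow> 'o \<Rightarrow> 'o \<Rightarrow> 'f \<Rightarrow> 'f \<Rightarrow> 'f"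
  Ident :: "'o \<Rightarrow> 'f"
  Act :: "'o \<Rightarrow> 'o \<Rightarrow> 'h::complex_algebra_1 \<Rightarrow> 'f \<Rightarrow> 'f"

locale left_hcategory =
  fixes H :: "'h::complex_algebra_1 hopf" and D :: "('o, 'f::complex_vector, 'h) hcat"
  assumes Hom_subspace: "\<lbrakk>X \<in> Ob D; Y \<in> Ob D\<rbrakk> \<Longrightarrow> cvec.subspace (Hom D X Y)"
    and Comp_closed: "\<lbrakk>X \<in> Ob D; Y \<in> Ob D; Z \<in> Ob D; f \<in> Hom D X Y; g \<in> Hom D Y Z\<rbrakk>
      \<Longrightarrow> Comp D X Y Z g f \<in> Hom D X Z"
    and Comp_linear_right: "\<lbrakk>X \<in> Ob D; Y \<in> Ob D; Z \<in> Ob D; g \<in> Hom D Y Z\<rbrakk>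
      \<Longrightarrow> linear_on (Hom D X Y) (\<lambda>f. Comp D X Y Z g f)"
    and Comp_linear_left: "\<lbrakk>X \<in> Ob D; Y \<in> Ob D; Z \<in> Ob D; f \<in> Hom D X Y\<rbrakk>
      \<Longrightarrow> linear_on (Hom D Y Z) (\<lambda>g. Comp D X Y Z g f)"
    and Comp_assoc: "\<lbrakk>W \<in> Ob D; X \<in> Ob D; Y \<in> Ob D; Z \<in> Ob D;
      e \<in> Hom D W X; f \<in> Hom D X Y; g \<in> Hom D Y Z\<rbrakk>
      \<Longrightarrow> Comp D W X Z (Comp D X Y Z g f) e = Comp D W Y Z g (Comp D W X Y f e)"
    and Id_closed: "X \<in> Ob D \<Longrightarrow> Ident D X \<in> Hom D X X"
    and Comp_Id_right: "\<lbrakk>X \<in> Ob D; Y \<in> Ob D; f \<in> Hom D X Y\<rbrakk> \<Longrightarrow> Comp D X X Y f (Ident D X) = f"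
    and Comp_Id_left: "\<lbrakk>X \<in> Ob D; Y \<in> Ob D; f \<in> Hom D X Y\<rbrakk> \<Longrightarrow> Comp D X Y Y (Ident D Y) f = f"
    and Act_closed: "\<lbrakk>X \<in> Ob D; Y \<in> Ob D; f \<in> Hom D X Y\<rbrakk> \<Longrightarrow> Act D X Y h f \<in> Hom D X Y"
    and Act_linear_right: "\<lbrakk>X \<in> Ob D; Y \<in> Ob D\<rbrakk> \<Longrightarrow> linear_on (Hom D X Y) (\<lambda>f. Act D X Y h f)"
    and Act_linear_left: "\<lbrakk>X \<in> Ob D; Y \<in> Ob D; f \<in> Hom D X Y\<rbrakk> \<Longrightarrow> clinear (\<lambda>h. Act D X Y h f)"
    and Act_mult: "\<lbrakk>X \<in> Ob D; Y \<in> Ob D; f \<in> Hom D X Y\<rbrakk>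
      \<Longrightarrow> Act D X Y (k * h) f = Act D X Y k (Act D X Y h f)"
    and Act_one: "\<lbrakk>X \<in> Ob D; Y \<in> Ob D; f \<in> Hom D X Y\<rbrakk> \<Longrightarrow> Act D X Y 1 f = f"
    and Act_Id: "X \<in> Ob D \<Longrightarrow> Act D X X h (Ident D X) = counit H h *\<^sub>C Ident D X"
    and Act_Comp: "\<lbrakk>X \<in> Ob D; Y \<in> Ob D; Z \<in> Ob D; f \<in> Hom D X Y; g \<in> Hom D Y Z\<rbrakk>
      \<Longrightarrow> Act D X Z h (Comp D X Y Z g f) =
        (\<Sum>\<langle>h1 \<otimes> h2 \<leftarrow> comul H h\<rangle>. Comp D X Y Z (Act D Y Z h1 g) (Act D X Y h2 f))"

text \<open>A semifunctor is given by its object map \<open>F\<^sub>0\<close> and its maps \<open>F X Y\<close> on Hom spaces.\<close>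

locale hlinear_semifunctor =
  fixes C :: "('o, 'f::complex_vector, 'h::complex_algebra_1) hcat"
    and D :: "('p, 'g::complex_vector, 'h) hcat"
    and F\<^sub>0 :: "'o \<Rightarrow> 'p" and F :: "'o \<Rightarrow> 'o \<Rightarrow> 'f \<Rightarrow> 'g"
  assumes ob_closed: "X \<in> Ob C \<Longrightarrow> F\<^sub>0 X \<in> Ob D"
    and hom_closed: "\<lbrakk>X \<in> Ob C; Y \<in> Ob C; f \<in> Hom C X Y\<rbrakk> \<Longrightarrow> F X Y f \<in> Hom D (F\<^sub>0 X) (F\<^sub>0 Y)"
    and hom_linear: "\<lbrakk>X \<in> Ob C; Y \<in> Ob C\<rbrakk> \<Longrightarrow> linear_on (Hom C X Y) (F X Y)"
    and hom_Act: "\<lbrakk>X \<in> Ob C; Y \<in> Ob C; f \<in> Hom C X Y\<rbrakk>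
      \<Longrightarrow> F X Y (Act C X Y h f) = Act D (F\<^sub>0 X) (F\<^sub>0 Y) h (F X Y f)"
    and hom_Comp: "\<lbrakk>X \<in> Ob C; Y \<in> Ob C; Z \<in> Ob C; f \<in> Hom C X Y; g \<in> Hom C Y Z\<rbrakk>
      \<Longrightarrow> F X Z (Comp C X Y Z g f) = Comp D (F\<^sub>0 X) (F\<^sub>0 Y) (F\<^sub>0 Z) (F Y Z g) (F X Y f)"

definition elem_mat :: "2 \<Rightarrow> 2 \<Rightarrow> complex^2^2" where
  "elem_mat i j = (\<chi> r s. if r = i \<and> s = j then 1 else 0)"

definition tensor_M2 :: "('o, 'f::complex_vector, 'h::complex_algebra_1) hcat
    \<Rightarrow> ('o, 'f \<otimes> (complex^2^2), 'h) hcat" where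
  "tensor_M2 D = \<lparr>
     Ob = Ob D,
     Hom = (\<lambda>X Y. subspace_tensor (Hom D X Y) UNIV),
     Comp = (\<lambda>X Y Z t s.
       lin_ext (\<lambda>(g, B'). g \<otimes> B') (Hom D Y Z \<times> UNIV) (\<lambda>(g, B').
         lin_ext (\<lambda>(f, B). f \<otimes> B) (Hom D X Y \<times> UNIV) (\<lambda>(f, B).
           Comp D X Y Z g f \<otimes> (B' ** B)) s) t),
     Ident = (\<lambda>X. Ident D X \<otimes> mat 1),
     Act = (\<lambda>X Y h.
       lin_ext (\<lambda>(f, B). f \<otimes> B) (Hom D X Y \<times> UNIV) (\<lambda>(f, B). Act D X Y h f \<otimes> B)) \<rparr>"

definition is_inverse :: "('o, 'f::complex_vector, 'h::complex_algebra_1) hcat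
    \<Rightarrow> 'o \<Rightarrow> 'o \<Rightarrow> 'f \<Rightarrow> 'f \<Rightarrow> bool" where
  "is_inverse E X Y f g \<longleftrightarrow> f \<in> Hom E X Y \<and> g \<in> Hom E Y X \<and>
     Comp E X Y X g f = Ident E X \<and> Comp E Y X Y f g = Ident E Y"

definition Aut :: "('o, 'f::complex_vector, 'h::complex_algebra_1) hcat \<Rightarrow> 'o \<Rightarrow> 'f set" where
  "Aut E X = {f. \<exists>g. is_inverse E X X f g}"

definition aut_inv :: "('o, 'f::complex_vector, 'h::complex_algebra_1) hcat \<Rightarrow> 'o \<Rightarrow> 'f \<Rightarrow> 'f" where
  "aut_inv E X f = (THE g. is_inverse E X X f g)"

definition U_H :: "'h::complex_algebra_1 hopf \<Rightarrow> ('o, 'f::complex_vector, 'h) hcat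
    \<Rightarrow> ('o \<Rightarrow> 'f) set" where
  "U_H H E = {\<eta>. \<forall>X\<in>Ob E. \<eta> X \<in> Aut E X \<and> (\<forall>h. Act E X X h (\<eta> X) = counit H h *\<^sub>C \<eta> X)}"

definition inner_aut :: "('o, 'f::complex_vector, 'h::complex_algebra_1) hcat
    \<Rightarrow> ('o \<Rightarrow> 'f) \<Rightarrow> 'o \<Rightarrow> 'o \<Rightarrow> 'f \<Rightarrow> 'f" where
  "inner_aut E \<eta> X Y f = Comp E X X Y (Comp E X Y Y (\<eta> Y) f) (aut_inv E X (\<eta> X))"


section \<open>Cyclic chains\<close>

text \<open>An arrow \<open>f : X \<rightarrow> Y\<close> is recorded as \<open>(X, Y, f)\<close>. The type of chains is the free vector space
  on finite lists of such triples, modulo multilinearity in the third components. It is the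
  direct sum, over all lists of pairs of objects, of tensor powers of the ambient space of the
  Hom spaces.\<close>

type_synonym ('o, 'f) arrow = "'o \<times> 'o \<times> 'f"

definition chain_null :: "(('o, 'f::complex_vector) arrow list \<Rightarrow>\<^sub>0 complex) set" where
  "chain_null = cvec.span
    ({free_gen (as @ (X, Y, f + g) # bs)
        - (free_gen (as @ (X, Y, f) # bs) + free_gen (as @ (X, Y, g) # bs)) | as bs X Y f g. True} \<union>
     {free_gen (as @ (X, Y, c *\<^sub>C f) # bs) - c *\<^sub>C free_gen (as @ (X, Y, f) # bs)
        | as bs X Y c f. True})"

quotient_type (overloaded) ('o, 'f) chain =
    "('o, 'f::complex_vector) arrow list \<Rightarrow>\<^sub>0 complex" / "\<lambda>x y. x - y \<in> chain_null"
  unfolding chain_null_def by (rule equivp_diff_in_span)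

instantiation chain :: (type, complex_vector) complex_vector
begin
lift_definition zero_chain :: "('a, 'b) chain" is 0 .
lift_definition plus_chain :: "('a, 'b) chain \<Rightarrow> ('a, 'b) chain \<Rightarrow> ('a, 'b) chain" is "(+)"
  unfolding chain_null_def by (rule diff_in_span_add)
lift_definition uminus_chain :: "('a, 'b) chain \<Rightarrow> ('a, 'b) chain" is uminus
  unfolding chain_null_def by (rule diff_in_span_minus)
lift_definition minus_chain :: "('a, 'b) chain \<Rightarrow> ('a, 'b) chain \<Rightarrow> ('a, 'b) chain" is "(-)"
  unfolding chain_null_def by (rule diff_in_span_diff)
lift_definition scaleC_chain :: "complex \<Rightarrow> ('a, 'b) chain \<Rightarrow> ('a, 'b) chain" is scaleC
  unfolding chain_null_def by (rule diff_in_span_scale)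
instance
  by standard
    (transfer; simp add: chain_null_def cvec.span_zero scaleC_add_right scaleC_add_left
      scaleC_scaleC scaleC_one add_ac)+
end

lift_definition pure :: "('o, 'f::complex_vector) arrow list \<Rightarrow> ('o, 'f) chain" is free_gen .

text \<open>The lists \<open>[f\<^sup>0, \<dots>, f\<^sup>n]\<close> with \<open>f\<^sup>i : X\<^bsub>i+1\<^esub> \<rightarrow> X\<^sub>i\<close> and \<open>X\<^bsub>n+1\<^esub> = X\<^sub>0\<close>.\<close>

definition cyclic_strings :: "('o, 'f::complex_vector, 'h::complex_algebra_1) hcat \<Rightarrow> nat
    \<Rightarrow> ('o, 'f) arrow list set" where
  "cyclic_strings D n = {map (\<lambda>i. (X (Suc i), X i, f i)) [0..<Suc n] | X f.
     X (Suc n) = X 0 \<and> (\<forall>i\<le>n. X i \<in> Ob D \<and> f i \<in> Hom D (X (Suc i)) (X i))}"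

definition CN :: "('o, 'f::complex_vector, 'h::complex_algebra_1) hcat \<Rightarrow> nat
    \<Rightarrow> ('o, 'f) chain set" where
  "CN D n = cvec.span (pure ` cyclic_strings D n)"

definition chain_cons :: "('o, 'f::complex_vector) arrow \<Rightarrow> ('o, 'f) chain \<Rightarrow> ('o, 'f) chain" where
  "chain_cons a = lin_ext pure UNIV (\<lambda>as. pure (a # as))"

fun act_arrow :: "('o, 'f::complex_vector, 'h::complex_algebra_1) hcat \<Rightarrow> 'h
    \<Rightarrow> ('o, 'f) arrow \<Rightarrow> ('o, 'f) arrow" where
  "act_arrow D h (X, Y, f) = (X, Y, Act D X Y h f)"

fun comp_arrow :: "('o, 'f::complex_vector, 'h::complex_algebra_1) hcat
    \<Rightarrow> ('o, 'f) arrow \<Rightarrow> ('o, 'f) arrow \<Rightarrow> ('o, 'f) arrow" where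
  "comp_arrow D (Y, Z, g) (X, Y', f) = (X, Z, Comp D X Y Z g f)"

text \<open>The diagonal action \<open>h (f\<^sup>0 \<otimes> \<dots> \<otimes> f\<^sup>n) = h\<^sub>1 f\<^sup>0 \<otimes> \<dots> \<otimes> h\<^bsub>n+1\<^esub> f\<^sup>n\<close>.\<close>

fun diag_act :: "'h::complex_algebra_1 hopf \<Rightarrow> ('o, 'f::complex_vector, 'h) hcat \<Rightarrow> 'h
    \<Rightarrow> ('o, 'f) arrow list \<Rightarrow> ('o, 'f) chain" where
  "diag_act H D h [] = counit H h *\<^sub>C pure []"
| "diag_act H D h (a # as) =
     (\<Sum>\<langle>h1 \<otimes> h2 \<leftarrow> comul H h\<rangle>. chain_cons (act_arrow D h1 a) (diag_act H D h2 as))"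


section \<open>Cyclic cohomology\<close>

definition cochains :: "'h::complex_algebra_1 hopf \<Rightarrow> ('o, 'f::complex_vector, 'h) hcat
    \<Rightarrow> ('m::complex_vector, 'h) hopf_mod \<Rightarrow> nat \<Rightarrow> ('m \<otimes> ('o, 'f) chain \<Rightarrow> complex) set" where
  "cochains H D M n = {\<phi>.
     linear_on (subspace_tensor UNIV (CN D n)) \<phi> \<and>
     (\<forall>x. x \<notin> subspace_tensor UNIV (CN D n) \<longrightarrow> \<phi> x = 0) \<and>
     (\<forall>m h. \<forall>as\<in>cyclic_strings D n.
        \<phi> (\<Sum>\<langle>h1 \<otimes> h2 \<leftarrow> comul H h\<rangle>. ract M m h1 \<otimes> diag_act H D (antipode H h2) as) =
        counit H h * \<phi> (m \<otimes> pure as))}"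

text \<open>The linear functional on \<open>M \<otimes> CN\<^sub>n\<close> with given values on \<open>m \<otimes> f\<^sup>0 \<otimes> \<dots> \<otimes> f\<^sup>n\<close>.\<close>

definition functional :: "('o, 'f::complex_vector, 'h::complex_algebra_1) hcat \<Rightarrow> nat
    \<Rightarrow> ('m::complex_vector \<Rightarrow> ('o, 'f) arrow list \<Rightarrow> complex)
    \<Rightarrow> 'm \<otimes> ('o, 'f) chain \<Rightarrow> complex" where
  "functional D n F =
     lin_ext (\<lambda>(m, as). m \<otimes> pure as) (UNIV \<times> cyclic_strings D n) (\<lambda>(m, as). F m as)"

definition S_inv :: "'h::complex_algebra_1 hopf \<Rightarrow> 'h \<Rightarrow> 'h" where
  "S_inv H = inv (antipode H)"

text \<open>\<^term>\<open>coface H D M n i\<close> is the map \<open>\<delta>\<^sub>i\<close> on \<open>n\<close>-cochains, for \<open>0 \<le> i \<le> n + 1\<close>.\<close>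

definition coface :: "'h::complex_algebra_1 hopf \<Rightarrow> ('o, 'f::complex_vector, 'h) hcat
    \<Rightarrow> ('m::complex_vector, 'h) hopf_mod \<Rightarrow> nat \<Rightarrow> nat
    \<Rightarrow> ('m \<otimes> ('o, 'f) chain \<Rightarrow> complex) \<Rightarrow> 'm \<otimes> ('o, 'f) chain \<Rightarrow> complex" where
  "coface H D M n i \<phi> = functional D (Suc n) (\<lambda>m as.
     if i \<le> n then
       \<phi> (m \<otimes> pure (take i as @ [comp_arrow D (as ! i) (as ! Suc i)] @ drop (i + 2) as))
     else
       \<phi> (\<Sum>\<langle>a \<otimes> m' \<leftarrow> coact M m\<rangle>. m' \<otimes> pure
         (comp_arrow D (act_arrow D (S_inv H a) (as ! Suc n)) (as ! 0) # take n (drop 1 as))))"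

definition coboundary_op :: "'h::complex_algebra_1 hopf \<Rightarrow> ('o, 'f::complex_vector, 'h) hcat
    \<Rightarrow> ('m::complex_vector, 'h) hopf_mod \<Rightarrow> nat
    \<Rightarrow> ('m \<otimes> ('o, 'f) chain \<Rightarrow> complex) \<Rightarrow> 'm \<otimes> ('o, 'f) chain \<Rightarrow> complex" where
  "coboundary_op H D M n \<phi> = (\<lambda>x. \<Sum>i\<le>Suc n. (-1) ^ i * coface H D M n i \<phi> x)"

definition cyclic_op :: "'h::complex_algebra_1 hopf \<Rightarrow> ('o, 'f::complex_vector, 'h) hcat
    \<Rightarrow> ('m::complex_vector, 'h) hopf_mod \<Rightarrow> nat
    \<Rightarrow> ('m \<otimes> ('o, 'f) chain \<Rightarrow> complex) \<Rightarrow> 'm \<otimes> ('o, 'f) chain \<Rightarrow> complex" where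
  "cyclic_op H D M n \<phi> = functional D n (\<lambda>m as.
     \<phi> (\<Sum>\<langle>a \<otimes> m' \<leftarrow> coact M m\<rangle>. m' \<otimes> pure (act_arrow D (S_inv H a) (as ! n) # take n as)))"

definition cyclic_cochains :: "'h::complex_algebra_1 hopf \<Rightarrow> ('o, 'f::complex_vector, 'h) hcat
    \<Rightarrow> ('m::complex_vector, 'h) hopf_mod \<Rightarrow> nat \<Rightarrow> ('m \<otimes> ('o, 'f) chain \<Rightarrow> complex) set" where
  "cyclic_cochains H D M n =
     {\<phi> \<in> cochains H D M n. (\<forall>x. \<phi> x - (-1) ^ n * cyclic_op H D M n \<phi> x = 0)}"

definition cocycles :: "'h::complex_algebra_1 hopf \<Rightarrow> ('o, 'f::complex_vector, 'h) hcat
    \<Rightarrow> ('m::complex_vector, 'h) hopf_mod \<Rightarrow> nat \<Rightarrow> ('m \<otimes> ('o, 'f) chain \<Rightarrow> complex) set" where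
  "cocycles H D M n = {\<phi> \<in> cyclic_cochains H D M n. (\<forall>x. coboundary_op H D M n \<phi> x = 0)}"

fun coboundaries :: "'h::complex_algebra_1 hopf \<Rightarrow> ('o, 'f::complex_vector, 'h) hcat
    \<Rightarrow> ('m::complex_vector, 'h) hopf_mod \<Rightarrow> nat \<Rightarrow> ('m \<otimes> ('o, 'f) chain \<Rightarrow> complex) set" where
  "coboundaries H D M 0 = {\<lambda>x. 0}"
| "coboundaries H D M (Suc n) = coboundary_op H D M n ` cyclic_cochains H D M n"

text \<open>The quotient of cocycles by coboundaries, as a set of cosets. It is the zero space iff its
  only element is the zero class, that is, the set of coboundaries.\<close>

definition HC :: "'h::complex_algebra_1 hopf \<Rightarrow> ('o, 'f::complex_vector, 'h) hcat
    \<Rightarrow> ('m::complex_vector, 'h) hopf_mod \<Rightarrow> nat \<Rightarrow> ('m \<otimes> ('o, 'f) chain \<Rightarrow> complex) set set" where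
  "HC H D M n = cocycles H D M n //
     {(\<phi>, \<psi>). \<phi> \<in> cocycles H D M n \<and> \<psi> \<in> cocycles H D M n \<and>
        (\<lambda>x. \<phi> x - \<psi> x) \<in> coboundaries H D M n}"

end

theory Submission
  imports Defs
begin

text \<open>Write \<open>\<eta>\<close> and its inverse as 2x2 matrices. Condition (2), evaluated at identities,
  forces \<open>\<eta>\<^bsub>11\<^esub> = 0\<close>, and the \<open>H\<close>-invariant endomorphisms \<open>p1 = \<eta>\<^bsub>21\<^esub>\<close>, \<open>p2 = \<eta>\<^bsub>22\<^esub>\<close>,
  \<open>q1 = (\<eta>\<^sup>-\<^sup>1)\<^bsub>12\<^esub>\<close>, \<open>q2 = (\<eta>\<^sup>-\<^sup>1)\<^bsub>22\<^esub>\<close> exhibit \<open>\<upsilon>\<close> as an internal direct sum of the identity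
  and of itself: \<open>\<upsilon> f = p1 f q1 + p2 (\<upsilon> f) q2\<close>. This gives a path \<open>\<rho>\<^sub>t\<close>, \<open>0 \<le> t \<le> 1\<close>, of
  \<open>H\<close>-linear semifunctors from the category to 3x3 matrices over it, quadratic in \<open>t\<close>, whose
  diagonal is \<open>(f, \<upsilon> f, 0)\<close> at \<open>t = 0\<close> and \<open>(0, 0, \<upsilon> f)\<close> at \<open>t = 1\<close>, the remaining entries there
  being strictly triangular. It satisfies \<open>\<rho>\<^sub>t' = [K, \<rho>\<^sub>t]\<close> for an invariant matrix \<open>K\<close>.

  Let \<open>\<phi>\<close> be a cyclic cocycle. Since inner derivations act on cyclic cohomology by 0, with
  contraction by \<open>K\<close> as explicit homotopy, the derivative of \<open>t \<mapsto> (tr \<phi>) \<circ> \<rho>\<^sub>t\<close> is the coboundary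
  of a cyclic cochain. Integrating over \<open>t\<close>, the difference of the two ends
  \<open>(\<phi> + \<phi> \<circ> \<upsilon>) - \<phi> \<circ> \<upsilon> = \<phi>\<close> is a coboundary.\<close>

section \<open>Linear maps and their extensions\<close>

text \<open>Formally \<open>\<rho>\<^sub>t = (1 + t K) \<rho>\<^sub>0 (1 - t K)\<close>: here
  \<open>\<rho>\<^sub>0\<close> has block rows (\<alpha>, 0) and (p \<alpha>, 0) with \<alpha> f =
  diag (f, \<upsilon> f) and p = (p1, p2), and K has as its only block -q, minus the column of q1
  and q2, in the upper right corner. Since K squares to 0, exp (t K) = 1 + t K, whence a path that
  is quadratic in t with derivative [K, _]. The relations used are q p \<alpha> = \<alpha> and p
  \<alpha> q = \<upsilon>.

  The detour over a nilpotent K is taken because \<eta> need not be joined to the identity by a path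
  of units, so that conjugation by \<eta> has no evident generator. The path does not preserve
  identities, which does no harm in a complex that is not normalized.

  A second difficulty is totality: the Hom spaces are subspaces of one type, while operators on
  chains are built from multilinear maps on all of it. Composition and action are therefore extended
  bilinearly along projections. The price is that the unit of H acts as the projection onto a Hom
  space, so \<open>act X Y 1 f\<close> often stands where f is meant.\<close>

lemma clinear_iff:
  "clinear f \<longleftrightarrow> (\<forall>x y. f (x + y) = f x + f y) \<and> (\<forall>c x. f (c *\<^sub>C x) = c *\<^sub>C f x)"
  by (simp add: Vector_Spaces.linear_iff cvec.vector_space_axioms)

lemma clinearI:
  "(\<And>x y. f (x + y) = f x + f y) \<Longrightarrow> (\<And>c x. f (c *\<^sub>C x) = c *\<^sub>C f x) \<Longrightarrow> clinear f"
  by (simp add: clinear_iff)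

lemma clinear_add: "clinear f \<Longrightarrow> f (x + y) = f x + f y"
  and clinear_scale: "clinear f \<Longrightarrow> f (c *\<^sub>C x) = c *\<^sub>C f x"
  by (simp_all add: clinear_iff)

lemma clinear_0: "clinear f \<Longrightarrow> f 0 = 0"
  using clinear_add[of f 0 0] by simp

lemma clinear_minus: "clinear f \<Longrightarrow> f (- x) = - f x"
  using clinear_add[of f x "- x"] clinear_0[of f] by (simp add: eq_neg_iff_add_eq_0 add.commute)

lemma clinear_diff: "clinear f \<Longrightarrow> f (x - y) = f x - f y"
  using clinear_add[of f x "- y"] clinear_minus[of f y] by simp

lemma clinear_sum: "clinear f \<Longrightarrow> f (sum g A) = (\<Sum>x\<in>A. f (g x))"
  by (induction A rule: infinite_finite_induct) (simp_all add: clinear_0 clinear_add)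

lemma clinear_id: "clinear (\<lambda>x. x)"
  and clinear_zero: "clinear (\<lambda>x. 0)"
  and clinear_comp: "clinear f \<Longrightarrow> clinear g \<Longrightarrow> clinear (\<lambda>x. f (g x))"
  and clinear_plus: "clinear g \<Longrightarrow> clinear g' \<Longrightarrow> clinear (\<lambda>x. g x + g' x)"
  and clinear_minus': "clinear g \<Longrightarrow> clinear g' \<Longrightarrow> clinear (\<lambda>x. g x - g' x)"
  and clinear_scaleC: "clinear g \<Longrightarrow> clinear (\<lambda>x. c *\<^sub>C g x)"
  by (auto simp: clinear_iff cvec.scale_right_distrib cvec.scale_right_diff_distrib mult.commute)

lemma clinear_scaleC_left: "clinear g \<Longrightarrow> clinear (\<lambda>x. g x *\<^sub>C v)"
  by (auto simp: clinear_iff scaleC_complex_def cvec.scale_left_distrib)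

lemma clinear_cmult: "clinear g \<Longrightarrow> clinear (\<lambda>x. c * g x)" for g :: "_ \<Rightarrow> complex"
  by (auto simp: clinear_iff scaleC_complex_def algebra_simps)

lemma clinear_sum': "(\<And>i. i \<in> A \<Longrightarrow> clinear (g i)) \<Longrightarrow> clinear (\<lambda>x. \<Sum>i\<in>A. g i x)"
  by (induction A rule: infinite_finite_induct) (auto intro: clinear_zero clinear_plus)

lemma clinear_if: "(P \<Longrightarrow> clinear g) \<Longrightarrow> (\<not> P \<Longrightarrow> clinear g') \<Longrightarrow> clinear (\<lambda>x. if P then g x else g' x)"
  by (cases P) auto

lemma clinear_times_left: "clinear g \<Longrightarrow> clinear (\<lambda>x. g x * y)"
  and clinear_times_right: "clinear g \<Longrightarrow> clinear (\<lambda>x. y * g x)" for y :: "'a::complex_algebra_1"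
  by (auto simp: clinear_iff algebra_simps mult_scaleC_left mult_scaleC_right)

lemma clinear_vec_nth: "clinear g \<Longrightarrow> clinear (\<lambda>x. g x $ i)"
  by (auto simp: clinear_iff scaleC_vec_def)

lemma clinear_vec_lambda: "(\<And>i. clinear (\<lambda>x. g x i)) \<Longrightarrow> clinear (\<lambda>x. \<chi> i. g x i)"
  by (auto simp: clinear_iff scaleC_vec_def vec_eq_iff)

lemmas clin = clinear_id clinear_zero clinear_plus clinear_minus' clinear_scaleC
  clinear_sum' clinear_if clinear_vec_nth clinear_vec_lambda

lemma clinear_eq_on_span:
  assumes "clinear f" "clinear g" "\<And>x. x \<in> S \<Longrightarrow> f x = g x" "x \<in> cvec.span S"
  shows "f x = g x"
  using assms(4)
proof (induction rule: cvec.span_induct_alt)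
  case base
  then show ?case using assms by (simp add: clinear_0)
next
  case (step c x y)
  then show ?case using assms by (simp add: clinear_add clinear_scale)
qed

lemma clinear_span_image:
  assumes "clinear f" "\<And>x. x \<in> S \<Longrightarrow> f x \<in> cvec.span T" "x \<in> cvec.span S"
  shows "f x \<in> cvec.span T"
  using assms(3)
proof (induction rule: cvec.span_induct_alt)
  case base
  then show ?case using assms by (simp add: clinear_0 cvec.span_zero)
next
  case (step c x y)
  then show ?case using assms
    by (simp add: clinear_add clinear_scale cvec.span_add cvec.span_scale)
qed

lemma linear_on_clinear: "clinear f \<Longrightarrow> linear_on V f"
  by (simp add: linear_on_def clinear_add clinear_scale)

lemma linear_on_cong: "(\<And>x. x \<in> cvec.span S \<Longrightarrow> f x = g x) \<Longrightarrow> linear_on (cvec.span S) f \<longleftrightarrow>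
    linear_on (cvec.span S) g"
  by (simp add: linear_on_def cvec.span_add cvec.span_scale)

lemma linear_on_0: "linear_on V f \<Longrightarrow> 0 \<in> V \<Longrightarrow> f 0 = 0"
  unfolding linear_on_def by (metis cvec.scale_zero_left)

lemma linear_on_eq_on_span:
  assumes f: "linear_on (cvec.span S) f" and g: "linear_on (cvec.span S) g"
    and "\<And>x. x \<in> S \<Longrightarrow> f x = g x" "x \<in> cvec.span S"
  shows "f x = g x"
proof -
  have "x \<in> cvec.span S \<and> f x = g x"
    using assms(4)
  proof (induction rule: cvec.span_induct_alt)
    case base
    then show ?case
      using linear_on_0[OF f cvec.span_zero] linear_on_0[OF g cvec.span_zero]
        by (simp add: cvec.span_zero)
  next
    case (step c x y)
    have x: "x \<in> cvec.span S" "c *\<^sub>C x \<in> cvec.span S" and y: "y \<in> cvec.span S"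
      using step by (simp_all add: cvec.span_base cvec.span_scale)
    have "h (c *\<^sub>C x + y) = c *\<^sub>C h x + h y" if "linear_on (cvec.span S) h" for h :: "'a \<Rightarrow> 'b"
      using that x y by (simp add: linear_on_def)
    from this[OF f] this[OF g] show ?case using step x y assms(3) by (simp add: cvec.span_add)
  qed
  then show ?thesis ..
qed

text \<open>A linear map on a span is determined on the generators, and 0 is prescribed elsewhere,
  so the definite description is unique. Exhibiting one linear \<open>L\<close> with the right
  values evaluates it; the relations among the \<open>g i\<close> need not be examined.\<close>

lemma lin_ext_eq:
  assumes "linear_on (cvec.span (g ` I)) L" "\<And>i. i \<in> I \<Longrightarrow> L (g i) = F i"
  shows "lin_ext g I F = (\<lambda>x. if x \<in> cvec.span (g ` I) then L x else 0)" (is "_ = ?L")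
  unfolding lin_ext_def
proof (rule the_equality)
  show "linear_on (cvec.span (g ` I)) ?L \<and> (\<forall>x. x \<notin> cvec.span (g ` I) \<longrightarrow> ?L x = 0)
      \<and> (\<forall>i\<in>I. ?L (g i) = F i)"
    using assms linear_on_cong[of "g ` I" ?L L] by (auto simp: cvec.span_base)
next
  fix L' assume L': "linear_on (cvec.span (g ` I)) L' \<and> (\<forall>x. x \<notin> cvec.span (g ` I) \<longrightarrow> L' x = 0)
      \<and> (\<forall>i\<in>I. L' (g i) = F i)"
  have "L' x = L x" if "x \<in> cvec.span (g ` I)" for x
    by (rule linear_on_eq_on_span[of "g ` I"]) (use L' assms that in auto)
  then show "L' = ?L" using L' by auto
qed

lemma lin_ext_clinear_eq:
  assumes "clinear L" "\<And>i. i \<in> I \<Longrightarrow> L (g i) = F i" "cvec.span (g ` I) = UNIV"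
  shows "lin_ext g I F = L"
proof -
  have "lin_ext g I F = (\<lambda>x. if x \<in> cvec.span (g ` I) then L x else 0)"
    by (rule lin_ext_eq) (use assms linear_on_clinear in auto)
  then show ?thesis by (simp add: assms(3))
qed

section \<open>Linear projections onto subspaces\<close>

lemma ex_subspace_projection:
  fixes V :: "'a::complex_vector set"
  assumes V: "cvec.subspace V"
  shows "\<exists>p. clinear p \<and> (\<forall>x. p x \<in> V) \<and> (\<forall>x\<in>V. p x = x)"
proof -
  interpret vp: vector_space_pair "scaleC :: complex \<Rightarrow> 'a \<Rightarrow> 'a" "scaleC :: complex \<Rightarrow> 'a \<Rightarrow> 'a"
    by unfold_locales
  obtain B where B: "B \<subseteq> V" "cvec.independent B" "V \<subseteq> cvec.span B"
    using cvec.maximal_independent_subset[of V] by metis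
  define p where "p = vp.construct B id"
  have lin: "clinear p" unfolding p_def using vp.linear_construct[OF B(2)] .
  have pB: "p b = b" if "b \<in> B" for b
    unfolding p_def using vp.construct_basis[OF B(2) that, of id] by simp
  have sp: "cvec.span B = V"
    using B cvec.span_minimal[OF B(1) V] by blast
  have "p x \<in> V" for x
    using vp.construct_in_span[OF B(2), of id x] sp by (simp add: p_def)
  moreover have "p x = x" if "x \<in> V" for x
    using clinear_eq_on_span[of p "\<lambda>x. x" B x] lin clinear_id pB that sp by simp
  ultimately have "clinear p \<and> (\<forall>x. p x \<in> V) \<and> (\<forall>x\<in>V. p x = x)"
    using lin by simp
  then show ?thesis by (rule exI[of _ p])
qed

definition subspace_proj :: "'a::complex_vector set \<Rightarrow> 'a \<Rightarrow> 'a" where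
  "subspace_proj V = (SOME p. clinear p \<and> (\<forall>x. p x \<in> V) \<and> (\<forall>x\<in>V. p x = x))"

lemma
  assumes "cvec.subspace V"
  shows clinear_subspace_proj: "clinear (subspace_proj V)"
    and subspace_proj_in: "subspace_proj V x \<in> V"
    and subspace_proj_id: "x \<in> V \<Longrightarrow> subspace_proj V x = x"
proof -
  define P :: "('a \<Rightarrow> 'a) \<Rightarrow> bool"
    where "P p \<longleftrightarrow> clinear p \<and> (\<forall>x. p x \<in> V) \<and> (\<forall>x\<in>V. p x = x)" for p
  have "\<exists>p. P p"
    unfolding P_def by (rule ex_subspace_projection[OF assms])
  then have "P (SOME p. P p)"
    by (rule someI_ex)
  then have "P (subspace_proj V)"
    unfolding subspace_proj_def P_def .
  then show "clinear (subspace_proj V)" and "subspace_proj V x \<in> V"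
    and "x \<in> V \<Longrightarrow> subspace_proj V x = x"
    by (simp_all add: P_def)
qed

text \<open>Composition, action, semifunctor and cochains are given as linear maps on subspaces;
  this makes them linear on the whole type.\<close>

lemma clinear_linear_on_comp:
  assumes "linear_on V f" "clinear p" "\<And>x. p x \<in> V"
  shows "clinear (\<lambda>x. f (p x))"
  using assms by (simp add: clinear_iff linear_on_def)

section \<open>Universal properties of free vector spaces, tensor products and chains\<close>

definition free_ext :: "('x \<Rightarrow> 'b::complex_vector) \<Rightarrow> ('x \<Rightarrow>\<^sub>0 complex) \<Rightarrow> 'b" where
  "free_ext F p = (\<Sum>x\<in>Poly_Mapping.keys p. Poly_Mapping.lookup p x *\<^sub>C F x)"

lemma free_ext_superset:
  assumes "finite A" "Poly_Mapping.keys p \<subseteq> A"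
  shows "free_ext F p = (\<Sum>x\<in>A. Poly_Mapping.lookup p x *\<^sub>C F x)"
  unfolding free_ext_def
  by (rule sum.mono_neutral_left) (use assms in \<open>auto simp: in_keys_iff\<close>)

lemma lookup_scaleC: "Poly_Mapping.lookup (c *\<^sub>C p) x = c *\<^sub>C Poly_Mapping.lookup p x"
  by (simp add: scaleC_poly_mapping.rep_eq)

lemma clinear_free_ext: "clinear (free_ext F)"
proof (rule clinearI)
  fix p q :: "'a \<Rightarrow>\<^sub>0 complex"
  let ?A = "Poly_Mapping.keys p \<union> Poly_Mapping.keys q"
  have "Poly_Mapping.keys (p + q) \<subseteq> ?A" by (rule Poly_Mapping.keys_add)
  then show "free_ext F (p + q) = free_ext F p + free_ext F q"
    by (simp add: free_ext_superset[of ?A] lookup_add cvec.scale_left_distrib sum.distrib)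
next
  fix c and p :: "'a \<Rightarrow>\<^sub>0 complex"
  have "Poly_Mapping.keys (c *\<^sub>C p) \<subseteq> Poly_Mapping.keys p"
    by (auto simp: in_keys_iff lookup_scaleC scaleC_complex_def)
  then show "free_ext F (c *\<^sub>C p) = c *\<^sub>C free_ext F p"
    by (simp add: free_ext_superset[of "Poly_Mapping.keys p"] lookup_scaleC scaleC_complex_def
        cvec.scale_sum_right)
qed

lemma free_ext_free_gen: "free_ext F (free_gen x) = F x"
  by (simp add: free_ext_def free_gen_def)

lemma span_range_free_gen: "cvec.span (range free_gen) = (UNIV :: ('x \<Rightarrow>\<^sub>0 complex) set)"
proof -
  have "p \<in> cvec.span (range free_gen)" for p :: "'x \<Rightarrow>\<^sub>0 complex"
  proof -
    have "free_ext free_gen p = p"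
    proof (rule poly_mapping_eqI)
      fix y
      have ev: "Poly_Mapping.lookup (\<Sum>x\<in>A. h x) y = (\<Sum>x\<in>A. Poly_Mapping.lookup (h x) y)"
        for A :: "'x set" and h :: "'x \<Rightarrow> 'x \<Rightarrow>\<^sub>0 complex"
        by (rule lookup_sum)
      show "Poly_Mapping.lookup (free_ext free_gen p) y = Poly_Mapping.lookup p y"
        unfolding free_ext_def ev lookup_scaleC
        by (simp add: free_gen_def lookup_single when_def scaleC_complex_def in_keys_iff
            if_distrib[where f="\<lambda>z. _ * z"] sum.delta cong: if_cong)
    qed
    moreover have "free_ext free_gen p \<in> cvec.span (range free_gen)"
      unfolding free_ext_def by (intro cvec.span_sum cvec.span_scale cvec.span_base) auto
    ultimately show ?thesis by simp
  qed
  then show ?thesis by auto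
qed

section \<open>Bilinear maps and the universal property of the tensor product\<close>

definition bilin :: "('a::complex_vector \<Rightarrow> 'b::complex_vector \<Rightarrow> 'c::complex_vector) \<Rightarrow> bool" where
  "bilin \<beta> \<longleftrightarrow> (\<forall>b. clinear (\<lambda>a. \<beta> a b)) \<and> (\<forall>a. clinear (\<lambda>b. \<beta> a b))"

lemma bilinI: "(\<And>b. clinear (\<lambda>a. \<beta> a b)) \<Longrightarrow> (\<And>a. clinear (\<lambda>b. \<beta> a b)) \<Longrightarrow> bilin \<beta>"
  by (simp add: bilin_def)

lemma bilin_left: "bilin \<beta> \<Longrightarrow> clinear g \<Longrightarrow> clinear (\<lambda>x. \<beta> (g x) b)"
  using clinear_comp[of "\<lambda>a. \<beta> a b" g] by (simp add: bilin_def)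

lemma bilin_right: "bilin \<beta> \<Longrightarrow> clinear g \<Longrightarrow> clinear (\<lambda>x. \<beta> a (g x))"
  using clinear_comp[of "\<beta> a" g] by (simp add: bilin_def)

lemma abs_tensor_linear: "clinear abs_tensor"
  by (rule clinearI) (simp_all add: plus_tensor.abs_eq scaleC_tensor.abs_eq)

lemma tensor_eq_abs: "a \<otimes> b = abs_tensor (free_gen (a, b))"
  by (simp add: tensor.abs_eq)

lemma abs_tensor_surj: "\<exists>p. t = abs_tensor p"
  using Quotient3_abs_rep[OF Quotient3_tensor] by metis

lemma tensor_add_left: "(a + a') \<otimes> b = a \<otimes> b + a' \<otimes> b"
  by transfer (unfold tensor_null_def, rule cvec.span_base, blast)
lemma tensor_add_right: "a \<otimes> (b + b') = a \<otimes> b + a \<otimes> b'"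
  by transfer (unfold tensor_null_def, rule cvec.span_base, blast)
lemma tensor_scale_left: "(c *\<^sub>C a) \<otimes> b = c *\<^sub>C (a \<otimes> b)"
  by transfer (unfold tensor_null_def, rule cvec.span_base, blast)
lemma tensor_scale_right: "a \<otimes> (c *\<^sub>C b) = c *\<^sub>C (a \<otimes> b)"
  by transfer (unfold tensor_null_def, rule cvec.span_base, blast)

lemma bilin_tensor: "bilin (\<lambda>a b. a \<otimes> b)"
  by (auto intro!: bilinI clinearI simp: tensor_add_left tensor_add_right tensor_scale_left
      tensor_scale_right)

lemmas clin_tensor = bilin_left[OF bilin_tensor] bilin_right[OF bilin_tensor]

lemma span_pure_tensors: "cvec.span (range (\<lambda>(a, b). a \<otimes> b)) = UNIV"
proof -
  have "t \<in> cvec.span (range (\<lambda>(a, b). a \<otimes> b))" for t :: "'a \<otimes> 'b"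
  proof -
    obtain p where "t = abs_tensor p" using abs_tensor_surj by blast
    moreover have "abs_tensor p \<in> cvec.span (range (\<lambda>(a, b). (a::'a) \<otimes> (b::'b)))"
      by (rule clinear_span_image[OF abs_tensor_linear, of "range free_gen"])
        (force simp: span_range_free_gen tensor_eq_abs[symmetric] intro: cvec.span_base)+
    ultimately show ?thesis by simp
  qed
  then show ?thesis by auto
qed

lemma tensor_ext:
  assumes "clinear f" "clinear g" "\<And>a b. f (a \<otimes> b) = g (a \<otimes> b)"
  shows "f t = g t"
  by (rule clinear_eq_on_span[of f g "range (\<lambda>(a, b). a \<otimes> b)"])
    (use assms in \<open>auto simp: span_pure_tensors\<close>)

text \<open>The argument common to tensors and chains: \<open>free_ext F\<close> kills the relations
  \<open>R\<close>, hence depends only on the class \<open>ab p\<close>; evaluated at chosen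
  representatives it is therefore still linear.\<close>

lemma quotient_lift_exists:
  fixes F :: "'x \<Rightarrow> 'b::complex_vector" and ab :: "('x \<Rightarrow>\<^sub>0 complex) \<Rightarrow> 'q::complex_vector"
  assumes lin: "clinear ab" and surj: "\<And>t. \<exists>p. t = ab p"
    and ker: "\<And>p q. ab p = ab q \<Longrightarrow> p - q \<in> cvec.span R"
    and R: "\<And>p. p \<in> R \<Longrightarrow> free_ext F p = 0"
  shows "\<exists>L. clinear L \<and> (\<forall>x. L (ab (free_gen x)) = F x)"
proof -
  have van: "free_ext F p = 0" if "p \<in> cvec.span R" for p
    using clinear_eq_on_span[OF clinear_free_ext clinear_zero R that] .
  have wd: "free_ext F p = free_ext F q" if "ab p = ab q" for p q
    using van[OF ker[OF that]] clinear_diff[OF clinear_free_ext, of F p q] by simp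
  define r where "r t = (SOME p. t = ab p)" for t
  have r: "ab (r t) = t" for t
    unfolding r_def using someI_ex[OF surj[of t]] by simp
  define L where "L t = free_ext F (r t)" for t
  have L: "L (ab p) = free_ext F p" for p
    unfolding L_def using wd r by metis
  have "clinear L"
  proof (rule clinearI)
    fix x y c
    show "L (x + y) = L x + L y"
      using L[of "r x + r y"] clinear_add[OF lin] clinear_add[OF clinear_free_ext] r
      by (metis L)
    show "L (c *\<^sub>C x) = c *\<^sub>C L x"
      using clinear_scale[OF lin] clinear_scale[OF clinear_free_ext] r by (metis L)
  qed
  then show ?thesis using L free_ext_free_gen by metis
qed

lemma tensor_lift_exists:
  assumes "bilin \<beta>"
  shows "\<exists>L. clinear L \<and> (\<forall>a b. L (a \<otimes> b) = \<beta> a b)"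
proof -
  let ?ab = "abs_tensor :: _ \<Rightarrow> 'a \<otimes> 'b"
  have bilin: "\<beta> (a + a') b = \<beta> a b + \<beta> a' b" "\<beta> a (b + b') = \<beta> a b + \<beta> a b'"
    "\<beta> (c *\<^sub>C a) b = c *\<^sub>C \<beta> a b" "\<beta> a (c *\<^sub>C b) = c *\<^sub>C \<beta> a b" for a a' b b' c
    using assms by (simp_all add: bilin_def clinear_iff)
  have "\<exists>L. clinear L \<and> (\<forall>x. L (?ab (free_gen x)) = (\<lambda>(a, b). \<beta> a b) x)"
  proof (rule quotient_lift_exists[OF abs_tensor_linear abs_tensor_surj])
    show "?ab p = ?ab q \<Longrightarrow> p - q \<in> cvec.span ({free_gen (a + a', b) - (free_gen (a, b) +
        free_gen (a', b)) | a a' b. True} \<union>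
     {free_gen (a, b + b') - (free_gen (a, b) + free_gen (a, b')) | a b b'. True} \<union>
     {free_gen (c *\<^sub>C a, b) - c *\<^sub>C free_gen (a, b) | c a b. True} \<union>
     {free_gen (a, c *\<^sub>C b) - c *\<^sub>C free_gen (a, b) | c a b. True})" for p q
      by (simp add: tensor.abs_eq_iff tensor_null_def)
  qed (use bilin in \<open>auto simp: clinear_diff[OF clinear_free_ext] clinear_add[OF clinear_free_ext]
      clinear_scale[OF clinear_free_ext] free_ext_free_gen\<close>)
  then show ?thesis by (auto simp: tensor_eq_abs)
qed

lemma sweedler_lift:
  assumes "bilin \<beta>" "clinear L" "\<And>a b. L (a \<otimes> b) = \<beta> a b"
  shows "sweedler t \<beta> = L t"
proof -
  have "lin_ext (\<lambda>(a, b). a \<otimes> b) UNIV (\<lambda>(a, b). \<beta> a b) = L"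
    by (rule lin_ext_clinear_eq) (use assms in \<open>auto simp: span_pure_tensors\<close>)
  then show ?thesis by (simp add: sweedler_def)
qed

lemma sweedler_tensor: "bilin \<beta> \<Longrightarrow> sweedler (a \<otimes> b) \<beta> = \<beta> a b"
  using tensor_lift_exists[of \<beta>] sweedler_lift[of \<beta>] by metis

lemma sweedler_clinear: "bilin \<beta> \<Longrightarrow> clinear (\<lambda>t. sweedler t \<beta>)"
  using tensor_lift_exists[of \<beta>] sweedler_lift[of \<beta>] by (metis (no_types, lifting) ext)

lemma sweedler_apply:
  assumes "clinear f" "bilin \<beta>"
  shows "f (sweedler t \<beta>) = sweedler t (\<lambda>a b. f (\<beta> a b))"
proof -
  have b: "bilin (\<lambda>a b. f (\<beta> a b))"
    using assms by (auto intro!: bilinI clinear_comp[OF assms(1)] simp: bilin_def)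
  show ?thesis
    by (rule tensor_ext[of "\<lambda>t. f (sweedler t \<beta>)"])
      (use assms b in \<open>auto intro: clinear_comp sweedler_clinear simp: sweedler_tensor\<close>)
qed

lemma tensor_decomp: "\<exists>ps. t = (\<Sum>(a, b)\<leftarrow>ps. a \<otimes> b)"
proof -
  have "t \<in> cvec.span (range (\<lambda>(a, b). a \<otimes> b))" by (simp add: span_pure_tensors)
  then show ?thesis
  proof (induction rule: cvec.span_induct_alt)
    case base
    have "0 = (\<Sum>(a, b)\<leftarrow>[]. (a::'a) \<otimes> (b::'b))" by simp
    then show ?case by blast
  next
    case (step c x y)
    then obtain a b ps where "x = a \<otimes> b" "y = (\<Sum>(a, b)\<leftarrow>ps. a \<otimes> b)" by auto
    then have "c *\<^sub>C x + y = (\<Sum>(a, b)\<leftarrow>(c *\<^sub>C a, b) # ps. a \<otimes> b)"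
      by (simp add: tensor_scale_left)
    then show ?case by blast
  qed
qed

lemma sweedler_sum_list:
  assumes "bilin \<beta>"
  shows "sweedler (\<Sum>(a, b)\<leftarrow>ps. a \<otimes> b) \<beta> = (\<Sum>(a, b)\<leftarrow>ps. \<beta> a b)"
  by (induction ps)
    (auto simp: clinear_0[OF sweedler_clinear] clinear_add[OF sweedler_clinear] sweedler_tensor
        assms)

lemma clinear_sum_list: "(\<And>a. clinear (g a)) \<Longrightarrow> clinear (\<lambda>x. \<Sum>a\<leftarrow>ps. g a x)"
  by (induction ps) (auto intro: clin)

text \<open>A decomposition of \<open>t\<close> into finitely many pure tensors can be chosen
  independently of \<open>x\<close>, which turns the Sweedler sum into a finite sum of linear
  maps.\<close>

lemma clinear_sweedler_param:
  assumes "\<And>x. bilin (\<lambda>a b. \<beta> x a b)" "\<And>a b. clinear (\<lambda>x. \<beta> x a b)"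
  shows "clinear (\<lambda>x. sweedler t (\<lambda>a b. \<beta> x a b))"
proof -
  obtain ps where t: "t = (\<Sum>(a, b)\<leftarrow>ps. a \<otimes> b)" using tensor_decomp by blast
  show ?thesis unfolding t sweedler_sum_list[OF assms(1)]
    using assms(2) by (auto intro!: clinear_sum_list)
qed

lemma clinear_sweedler:
  assumes "bilin \<beta>" "clinear g"
  shows "clinear (\<lambda>x. sweedler (g x) \<beta>)"
  by (rule clinear_comp[OF sweedler_clinear[OF assms(1)] assms(2)])

lemmas clin_sweedler = clinear_sweedler clinear_sweedler_param

lemma sweedler_sweedler:
  assumes "bilin \<gamma>" "bilin \<beta>"
  shows "sweedler (sweedler t \<beta>) \<gamma> = sweedler t (\<lambda>a b. sweedler (\<beta> a b) \<gamma>)"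
  by (rule sweedler_apply[OF sweedler_clinear[OF assms(1)] assms(2)])

text \<open>Both sides are linear in \<open>t\<close>, and for a pure tensor \<open>t\<close> they
  are the same sum over \<open>s\<close>.\<close>

lemma sweedler_swap:
  assumes "\<And>a b. bilin (\<lambda>c d. \<gamma> a b c d)" "\<And>c d. bilin (\<lambda>a b. \<gamma> a b c d)"
  shows "sweedler s (\<lambda>a b. sweedler t (\<lambda>c d. \<gamma> a b c d)) =
    sweedler t (\<lambda>c d. sweedler s (\<lambda>a b. \<gamma> a b c d))"
proof -
  have b1: "bilin (\<lambda>a b. sweedler t (\<lambda>c d. \<gamma> a b c d))"
    using assms by (auto intro!: bilinI clinear_sweedler_param simp: bilin_def)
  have b2: "bilin (\<lambda>c d. sweedler s (\<lambda>a b. \<gamma> a b c d))"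
    using assms by (auto intro!: bilinI clinear_sweedler_param simp: bilin_def)
  show ?thesis
  proof (rule tensor_ext[of "\<lambda>t. sweedler s (\<lambda>a b. sweedler t (\<lambda>c d. \<gamma> a b c d))"])
    show "clinear (\<lambda>t. sweedler s (\<lambda>a b. sweedler t (\<lambda>c d. \<gamma> a b c d)))"
      by (rule clinear_sweedler_param)
        (use assms in \<open>auto intro!: sweedler_clinear bilinI clinear_sweedler_param simp: bilin_def\<close>)
  qed (use assms b1 b2 in \<open>auto intro!: sweedler_clinear simp: sweedler_tensor\<close>)
qed

lemma sweedler_id: "sweedler t (\<lambda>a b. a \<otimes> b) = t"
  by (rule sweedler_lift[OF bilin_tensor clinear_id]) simp

subsection \<open>Chains\<close>

lemma abs_chain_linear: "clinear abs_chain"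
  by (rule clinearI) (simp_all add: plus_chain.abs_eq scaleC_chain.abs_eq)

lemma pure_eq_abs: "pure as = abs_chain (free_gen as)"
  by (simp add: pure.abs_eq)

lemma abs_chain_surj: "\<exists>p. t = abs_chain p"
  using Quotient3_abs_rep[OF Quotient3_chain] by metis

lemma span_range_pure: "cvec.span (range pure) = UNIV"
proof -
  have "t \<in> cvec.span (range pure)" for t :: "('o, 'f::complex_vector) chain"
  proof -
    obtain p where "t = abs_chain p" using abs_chain_surj by blast
    moreover have "abs_chain p \<in> cvec.span (range (pure :: ('o, 'f) arrow list \<Rightarrow> _))"
      by (rule clinear_span_image[OF abs_chain_linear, of "range free_gen"])
        (auto simp: span_range_free_gen pure_eq_abs[symmetric] intro!: cvec.span_base)
    ultimately show ?thesis by simp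
  qed
  then show ?thesis by auto
qed

lemma chain_ext:
  assumes "clinear f" "clinear g" "\<And>as. f (pure as) = g (pure as)"
  shows "f c = g c"
  by (rule clinear_eq_on_span[of f g "range pure"])
    (use assms in \<open>auto simp: span_range_pure\<close>)

definition multilin :: "(('o, 'f::complex_vector) arrow list \<Rightarrow> 'b::complex_vector) \<Rightarrow> bool" where
  "multilin F \<longleftrightarrow> (\<forall>as X Y bs. clinear (\<lambda>f. F (as @ (X, Y, f) # bs)))"

lemma multilinI: "(\<And>as X Y bs. clinear (\<lambda>f. F (as @ (X, Y, f) # bs))) \<Longrightarrow> multilin F"
  by (simp add: multilin_def)

lemma pure_add: "pure (as @ (X, Y, f + g) # bs) = pure (as @ (X, Y, f) # bs) + pure (as @ (X, Y,
    g) # bs)"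
  by transfer (unfold chain_null_def, rule cvec.span_base, blast)

lemma pure_scale: "pure (as @ (X, Y, c *\<^sub>C f) # bs) = c *\<^sub>C pure (as @ (X, Y, f) # bs)"
  by transfer (unfold chain_null_def, rule cvec.span_base, blast)

lemma multilin_pure: "multilin pure"
  by (simp add: multilin_def clinear_iff pure_add pure_scale)

lemma chain_lift_exists:
  assumes "multilin F"
  shows "\<exists>L. clinear L \<and> (\<forall>as. L (pure as) = F as)"
proof -
  let ?ab = "abs_chain :: _ \<Rightarrow> ('a, 'b) chain"
  have "\<exists>L. clinear L \<and> (\<forall>x. L (?ab (free_gen x)) = F x)"
  proof (rule quotient_lift_exists[OF abs_chain_linear abs_chain_surj])
    show "?ab p = ?ab q \<Longrightarrow> p - q \<in> cvec.span ({free_gen (as @ (X, Y, f + g) # bs)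
        - (free_gen (as @ (X, Y, f) # bs) + free_gen (as @ (X, Y, g) # bs)) | as bs X Y f g. True} \<union>
     {free_gen (as @ (X, Y, c *\<^sub>C f) # bs) - c *\<^sub>C free_gen (as @ (X, Y, f) # bs)
        | as bs X Y c f. True})" for p q
      by (simp add: chain.abs_eq_iff chain_null_def)
  qed (use assms in \<open>auto simp: clinear_diff[OF clinear_free_ext] clinear_add[OF clinear_free_ext]
      clinear_scale[OF clinear_free_ext] free_ext_free_gen multilin_def clinear_iff\<close>)
  then show ?thesis by (auto simp: pure_eq_abs)
qed

definition chain_lift :: "(('o, 'f::complex_vector) arrow list \<Rightarrow> 'b::complex_vector) \<Rightarrow> ('o,
    'f) chain \<Rightarrow> 'b"
  where "chain_lift F = lin_ext pure UNIV F"

lemma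
  assumes "multilin F"
  shows clinear_chain_lift: "clinear (chain_lift F)"
    and chain_lift_pure: "chain_lift F (pure as) = F as"
proof -
  obtain L where "clinear L" "\<And>as. L (pure as) = F as"
    using chain_lift_exists[OF assms] by blast
  moreover from this have "chain_lift F = L"
    unfolding chain_lift_def by (intro lin_ext_clinear_eq) (auto simp: span_range_pure)
  ultimately show "clinear (chain_lift F)" "chain_lift F (pure as) = F as" by auto
qed

text \<open>A parameter can enter a slot of a pure chain linearly only while the two objects of that
  slot stay constant; arrows cannot be added otherwise.\<close>

definition alin :: "('a::complex_vector \<Rightarrow> ('o, 'f::complex_vector) arrow) \<Rightarrow> bool" where
  "alin u \<longleftrightarrow> (\<exists>X Y g. clinear g \<and> u = (\<lambda>x. (X, Y, g x)))"

lemma alinI: "clinear g \<Longrightarrow> alin (\<lambda>x. (X, Y, g x))"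
  unfolding alin_def by blast

lemma multilinD:
  assumes "multilin F" "alin u"
  shows "clinear (\<lambda>x. F (as @ u x # bs))"
proof -
  obtain X Y g where g: "clinear g" and u: "u = (\<lambda>x. (X, Y, g x))"
    using assms(2) unfolding alin_def by blast
  have "clinear (\<lambda>f. F (as @ (X, Y, f) # bs))"
    using assms(1) by (simp add: multilin_def)
  from clinear_comp[OF this g] show ?thesis unfolding u .
qed

lemma multilin_Cons: "multilin F \<Longrightarrow> alin u \<Longrightarrow> clinear (\<lambda>x. F (u x # bs))"
  using multilinD[of F u "[]"] by simp

lemma chain_cons_lift: "chain_cons a = chain_lift (\<lambda>as. pure (a # as))"
  by (simp add: chain_cons_def chain_lift_def)

lemma multilin_pure_Cons: "multilin (\<lambda>as. pure (a # as))"
  by (rule multilinI)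
    (use multilinD[OF multilin_pure alinI[OF clinear_id], of "a # as" for as] in simp)

lemma chain_cons_pure: "chain_cons a (pure as) = pure (a # as)"
  unfolding chain_cons_lift by (rule chain_lift_pure[OF multilin_pure_Cons])

lemma clinear_chain_cons: "clinear (chain_cons a)"
  unfolding chain_cons_lift by (rule clinear_chain_lift[OF multilin_pure_Cons])

text \<open>The two equations of linearity in the parameter are themselves linear in the chain, so
  they may be tested on pure chains.\<close>

lemma chain_param:
  assumes "\<And>x. clinear (\<lambda>c. L x c)" "\<And>as. clinear (\<lambda>x. L x (pure as))"
  shows "clinear (\<lambda>x. L x c)"
proof -
  have "L (x + y) c = L x c + L y c" for x y
    by (rule chain_ext[of "L (x + y)" "\<lambda>c. L x c + L y c"])
      (use assms clinear_add[OF assms(2)] in \<open>auto intro: clin\<close>)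
  moreover have "L (k *\<^sub>C x) c = k *\<^sub>C L x c" for k x
    by (rule chain_ext[of "L (k *\<^sub>C x)" "\<lambda>c. k *\<^sub>C L x c"])
      (use assms clinear_scale[OF assms(2)] in \<open>auto intro: clin\<close>)
  ultimately show ?thesis by (rule clinearI)
qed

lemma clin_chain_cons_left: "alin u \<Longrightarrow> clinear (\<lambda>x. chain_cons (u x) c)"
  by (rule chain_param) (auto simp: chain_cons_pure intro: clinear_chain_cons multilin_Cons[OF
      multilin_pure])

lemmas clin_chain_cons = clin_chain_cons_left clinear_comp[OF clinear_chain_cons]

text \<open>Mirror image of \<open>chain_cons\<close>, needed because the cyclic operator and the
  last face move the last arrow.\<close>

definition chain_snoc :: "('o, 'f::complex_vector) arrow \<Rightarrow> ('o, 'f) chain \<Rightarrow> ('o, 'f) chain" where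
  "chain_snoc a = chain_lift (\<lambda>as. pure (as @ [a]))"

lemma multilin_pure_snoc: "multilin (\<lambda>as. pure (as @ [a]))"
  by (rule multilinI)
    (use multilinD[OF multilin_pure alinI[OF clinear_id], of _ _ _ "bs @ [a]" for bs] in simp)

lemma chain_snoc_pure: "chain_snoc a (pure as) = pure (as @ [a])"
  unfolding chain_snoc_def by (rule chain_lift_pure[OF multilin_pure_snoc])

lemma clinear_chain_snoc: "clinear (chain_snoc a)"
  unfolding chain_snoc_def by (rule clinear_chain_lift[OF multilin_pure_snoc])

lemma clin_chain_snoc_left: "alin u \<Longrightarrow> clinear (\<lambda>x. chain_snoc (u x) c)"
  by (rule chain_param) (auto simp: chain_snoc_pure intro: clinear_chain_snoc multilinD[OF
      multilin_pure])

lemmas clin_chain_snoc = clin_chain_snoc_left clinear_comp[OF clinear_chain_snoc]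

section \<open>Sweedler calculus in a Hopf algebra\<close>

lemmas clin_mult = clinear_times_left clinear_times_right clinear_scaleC_left clinear_cmult

text \<open>Syntax-directed rules for linearity. The multilinearity side conditions of the Sweedler
  calculus are discharged by \<open>intro\<close> with extensions of this list.\<close>

lemmas clin_all = bilinI clin clin_mult clin_tensor clin_sweedler

context hopf_algebra
begin

lemmas clin_hopf = clinear_comp[OF linear_comul] clinear_comp[OF linear_counit]
  clinear_comp[OF linear_antipode]

text \<open>A trilinear \<gamma> induces a linear map \<open>G\<close> on the threefold tensor
  product, and \<open>G\<close> is applied to both sides of the coassociativity axiom.\<close>

lemma sweedler_coassoc:
  assumes 1: "\<And>b c. clinear (\<lambda>a. \<gamma> a b c)" and 2: "\<And>a c. clinear (\<lambda>b. \<gamma> a b c)"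
    and 3: "\<And>a b. clinear (\<lambda>c. \<gamma> a b c)"
  shows "(\<Sum>\<langle>a \<otimes> b \<leftarrow> comul H h\<rangle>. \<Sum>\<langle>c \<otimes> d \<leftarrow> comul H a\<rangle>. \<gamma> c d b) =
    (\<Sum>\<langle>a \<otimes> b \<leftarrow> comul H h\<rangle>. \<Sum>\<langle>c \<otimes> d \<leftarrow> comul H b\<rangle>. \<gamma> a c d)"
proof -
  note c = clinear_comp[OF 1] clinear_comp[OF 2] clinear_comp[OF 3]
  define G where "G t = (\<Sum>\<langle>c \<otimes> u \<leftarrow> t\<rangle>. \<Sum>\<langle>d \<otimes> b \<leftarrow> u\<rangle>. \<gamma> c d b)" for t
  have G: "clinear G" unfolding G_def by (intro clin_all c)
  have Gt: "G (c \<otimes> u) = (\<Sum>\<langle>d \<otimes> b \<leftarrow> u\<rangle>. \<gamma> c d b)" for c u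
    unfolding G_def by (rule sweedler_tensor) (intro clin_all c)
  have Gp: "G (c \<otimes> d \<otimes> b) = \<gamma> c d b" for c d b
    unfolding Gt by (rule sweedler_tensor) (intro clin_all c)
  have "G (\<Sum>\<langle>a \<otimes> b \<leftarrow> comul H h\<rangle>. \<Sum>\<langle>c \<otimes> d \<leftarrow> comul H a\<rangle>. c \<otimes> d \<otimes> b) =
      (\<Sum>\<langle>a \<otimes> b \<leftarrow> comul H h\<rangle>. G (\<Sum>\<langle>c \<otimes> d \<leftarrow> comul H a\<rangle>. c \<otimes> d \<otimes> b))"
    by (rule sweedler_apply[OF G]) (intro clin_all clin_hopf)
  also have "\<dots> = (\<Sum>\<langle>a \<otimes> b \<leftarrow> comul H h\<rangle>. \<Sum>\<langle>c \<otimes> d \<leftarrow> comul H a\<rangle>. \<gamma> c d b)"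
    by (subst sweedler_apply[OF G]) (intro clin_all, simp add: Gp)
  finally have l: "G (\<Sum>\<langle>a \<otimes> b \<leftarrow> comul H h\<rangle>. \<Sum>\<langle>c \<otimes> d \<leftarrow> comul H a\<rangle>. c \<otimes> d \<otimes> b) =
     (\<Sum>\<langle>a \<otimes> b \<leftarrow> comul H h\<rangle>. \<Sum>\<langle>c \<otimes> d \<leftarrow> comul H a\<rangle>. \<gamma> c d b)" .
  have r: "G (\<Sum>\<langle>a \<otimes> b \<leftarrow> comul H h\<rangle>. a \<otimes> comul H b) =
     (\<Sum>\<langle>a \<otimes> b \<leftarrow> comul H h\<rangle>. \<Sum>\<langle>c \<otimes> d \<leftarrow> comul H b\<rangle>. \<gamma> a c d)"
    by (subst sweedler_apply[OF G]) (intro clin_all clin_hopf, simp add: Gt)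
  show ?thesis using l r coassoc by simp
qed

lemma sweedler_counit_left:
  assumes "clinear g"
  shows "(\<Sum>\<langle>a \<otimes> b \<leftarrow> comul H h\<rangle>. counit H a *\<^sub>C g b) = g h"
proof -
  have "g (\<Sum>\<langle>a \<otimes> b \<leftarrow> comul H h\<rangle>. counit H a *\<^sub>C b) = (\<Sum>\<langle>a \<otimes> b \<leftarrow> comul H h\<rangle>. g (counit H a *\<^sub>C b))"
    by (rule sweedler_apply[OF assms]) (intro clin_all clin_hopf)
  then show ?thesis by (simp add: counit_left clinear_scale[OF assms])
qed

lemma sweedler_counit_right:
  assumes "clinear g"
  shows "(\<Sum>\<langle>a \<otimes> b \<leftarrow> comul H h\<rangle>. counit H b *\<^sub>C g a) = g h"
proof -
  have "g (\<Sum>\<langle>a \<otimes> b \<leftarrow> comul H h\<rangle>. counit H b *\<^sub>C a) = (\<Sum>\<langle>a \<otimes> b \<leftarrow> comul H h\<rangle>. g (counit H b *\<^sub>C a))"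
    by (rule sweedler_apply[OF assms]) (intro clin_all clin_hopf)
  then show ?thesis by (simp add: counit_right clinear_scale[OF assms])
qed

lemma sweedler_antipode_left:
  assumes "clinear g"
  shows "(\<Sum>\<langle>a \<otimes> b \<leftarrow> comul H h\<rangle>. g (antipode H a * b)) = counit H h *\<^sub>C g 1"
proof -
  have "g (\<Sum>\<langle>a \<otimes> b \<leftarrow> comul H h\<rangle>. antipode H a * b) = (\<Sum>\<langle>a \<otimes> b \<leftarrow> comul H h\<rangle>. g (antipode H a * b))"
    by (rule sweedler_apply[OF assms]) (intro clin_all clin_hopf)
  then show ?thesis by (simp add: antipode_left clinear_scale[OF assms])
qed

lemma sweedler_antipode_right:
  assumes "clinear g"
  shows "(\<Sum>\<langle>a \<otimes> b \<leftarrow> comul H h\<rangle>. g (a * antipode H b)) = counit H h *\<^sub>C g 1"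
proof -
  have "g (\<Sum>\<langle>a \<otimes> b \<leftarrow> comul H h\<rangle>. a * antipode H b) = (\<Sum>\<langle>a \<otimes> b \<leftarrow> comul H h\<rangle>. g (a * antipode H b))"
    by (rule sweedler_apply[OF assms]) (intro clin_all clin_hopf)
  then show ?thesis by (simp add: antipode_right clinear_scale[OF assms])
qed

lemma sweedler_comul_mult:
  assumes "bilin \<beta>"
  shows "sweedler (comul H (g * h)) \<beta> =
    (\<Sum>\<langle>a \<otimes> b \<leftarrow> comul H g\<rangle>. \<Sum>\<langle>c \<otimes> d \<leftarrow> comul H h\<rangle>. \<beta> (a * c) (b * d))"
  unfolding comul_mult
  by (subst sweedler_sweedler[OF assms], intro clin_all, subst sweedler_sweedler[OF assms],
      intro clin_all, simp add: sweedler_tensor[OF assms])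

lemma antipode_one: "antipode H 1 = 1"
proof -
  have b: "bilin (\<lambda>a b. antipode H a * b)" by (intro clin_all clin_hopf)
  have "sweedler (comul H 1) (\<lambda>a b. antipode H a * b) = counit H 1 *\<^sub>C 1" by (rule antipode_left)
  then show ?thesis by (simp add: comul_one counit_one sweedler_tensor[OF b] scaleC_one)
qed

lemma counit_antipode: "counit H (antipode H h) = counit H h"
proof -
  have "counit H (antipode H h) = (\<Sum>\<langle>a \<otimes> b \<leftarrow> comul H h\<rangle>. counit H b *\<^sub>C counit H (antipode H a))"
    by (rule sweedler_counit_right[symmetric]) (intro clin clin_hopf)
  also have "\<dots> = (\<Sum>\<langle>a \<otimes> b \<leftarrow> comul H h\<rangle>. counit H (antipode H a * b))"
    by (simp add: counit_mult scaleC_complex_def mult.commute)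
  also have "\<dots> = counit H h *\<^sub>C counit H 1"
    by (rule sweedler_antipode_left[OF linear_counit])
  finally show ?thesis by (simp add: counit_one scaleC_complex_def)
qed

text \<open>Both sides are the convolution inverse of the multiplication \<open>H \<otimes> H \<rightarrow> H\<close>: evaluate
  \<open>S(g\<^sub>1 h\<^sub>1) g\<^sub>2 h\<^sub>2 S(h\<^sub>3) S(g\<^sub>3)\<close> in two ways.\<close>

lemma antipode_mult: "antipode H (g * h) = antipode H h * antipode H g"
proof -
  let ?S = "antipode H"
  note I = clin_all clin_hopf
  have "?S (g * h) = (\<Sum>\<langle>a \<otimes> b \<leftarrow> comul H g\<rangle>. counit H b *\<^sub>C ?S (a * h))"
    by (rule sweedler_counit_right[symmetric]) (intro I)
  also have "\<dots> = (\<Sum>\<langle>a \<otimes> b \<leftarrow> comul H g\<rangle>. \<Sum>\<langle>b1 \<otimes> b2 \<leftarrow> comul H b\<rangle>. ?S (a * h) * (b1 * ?S b2))"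
    by (subst sweedler_antipode_right) (intro I, simp)
  also have "\<dots> = (\<Sum>\<langle>a \<otimes> b \<leftarrow> comul H g\<rangle>. \<Sum>\<langle>b1 \<otimes> b2 \<leftarrow> comul H b\<rangle>.
      \<Sum>\<langle>c \<otimes> d \<leftarrow> comul H h\<rangle>. counit H d *\<^sub>C (?S (a * c) * (b1 * ?S b2)))"
    by (subst sweedler_counit_right) (intro I, simp)
  also have "\<dots> = (\<Sum>\<langle>a \<otimes> b \<leftarrow> comul H g\<rangle>. \<Sum>\<langle>b1 \<otimes> b2 \<leftarrow> comul H b\<rangle>.
      \<Sum>\<langle>c \<otimes> d \<leftarrow> comul H h\<rangle>. \<Sum>\<langle>d1 \<otimes> d2 \<leftarrow> comul H d\<rangle>. ?S (a * c) * (b1 * (d1 * ?S d2) * ?S b2))"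
    by (subst sweedler_antipode_right[where g="\<lambda>z. ?S (a * c) * (b1 * z * ?S b2)" for a b1 b2 c])
      (intro I, simp)
  also have "\<dots> = (\<Sum>\<langle>a \<otimes> b \<leftarrow> comul H g\<rangle>. \<Sum>\<langle>b1 \<otimes> b2 \<leftarrow> comul H b\<rangle>.
      \<Sum>\<langle>c \<otimes> d \<leftarrow> comul H h\<rangle>. \<Sum>\<langle>c1 \<otimes> c2 \<leftarrow> comul H c\<rangle>. ?S (a * c1) * (b1 * (c2 * ?S d) * ?S b2))"
    by (subst sweedler_coassoc) (intro I, intro I, intro I, simp)
  also have "\<dots> = (\<Sum>\<langle>a \<otimes> b \<leftarrow> comul H g\<rangle>. \<Sum>\<langle>a1 \<otimes> a2 \<leftarrow> comul H a\<rangle>.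
      \<Sum>\<langle>c \<otimes> d \<leftarrow> comul H h\<rangle>. \<Sum>\<langle>c1 \<otimes> c2 \<leftarrow> comul H c\<rangle>. ?S (a1 * c1) * (a2 * (c2 * ?S d) * ?S b))"
    by (rule sweedler_coassoc[symmetric]) (intro I)+
  also have "\<dots> = (\<Sum>\<langle>a \<otimes> b \<leftarrow> comul H g\<rangle>. \<Sum>\<langle>c \<otimes> d \<leftarrow> comul H h\<rangle>.
      \<Sum>\<langle>a1 \<otimes> a2 \<leftarrow> comul H a\<rangle>. \<Sum>\<langle>c1 \<otimes> c2 \<leftarrow> comul H c\<rangle>. ?S (a1 * c1) * (a2 * c2) * (?S d * ?S b))"
    by (subst sweedler_swap) (intro I, intro I, simp add: mult.assoc)
  also have "\<dots> = (\<Sum>\<langle>a \<otimes> b \<leftarrow> comul H g\<rangle>. \<Sum>\<langle>c \<otimes> d \<leftarrow> comul H h\<rangle>.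
      \<Sum>\<langle>x \<otimes> y \<leftarrow> comul H (a * c)\<rangle>. ?S x * y * (?S d * ?S b))"
    by (subst sweedler_comul_mult) (intro I, simp)
  also have "\<dots> = (\<Sum>\<langle>a \<otimes> b \<leftarrow> comul H g\<rangle>. \<Sum>\<langle>c \<otimes> d \<leftarrow> comul H h\<rangle>.
      counit H c *\<^sub>C counit H a *\<^sub>C (?S d * ?S b))"
    by (subst sweedler_antipode_left) (intro I, simp add: counit_mult scaleC_scaleC mult.commute)
  also have "\<dots> = (\<Sum>\<langle>a \<otimes> b \<leftarrow> comul H g\<rangle>. counit H a *\<^sub>C (?S h * ?S b))"
    by (subst sweedler_counit_left) (intro I, simp)
  also have "\<dots> = ?S h * ?S g"
    by (rule sweedler_counit_left) (intro I)
  finally show ?thesis .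
qed

section \<open>The algebra H \<otimes> H and the coproduct of the antipode\<close>

definition tensor_mult :: "'h \<otimes> 'h \<Rightarrow> 'h \<otimes> 'h \<Rightarrow> 'h \<otimes> 'h" where
  "tensor_mult s t = (\<Sum>\<langle>a \<otimes> b \<leftarrow> s\<rangle>. \<Sum>\<langle>c \<otimes> d \<leftarrow> t\<rangle>. (a * c) \<otimes> (b * d))"

lemma bilin_tensor_mult: "bilin tensor_mult"
  unfolding tensor_mult_def by (intro clin_all)

lemmas clin_tensor_mult = bilin_left[OF bilin_tensor_mult] bilin_right[OF bilin_tensor_mult]

lemma tensor_mult_pure: "tensor_mult (a \<otimes> b) (c \<otimes> d) = (a * c) \<otimes> (b * d)"
  unfolding tensor_mult_def
  by (subst sweedler_tensor, intro clin_all, subst sweedler_tensor, intro clin_all, rule refl)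

lemma tensor_mult_assoc: "tensor_mult (tensor_mult s t) u = tensor_mult s (tensor_mult t u)"
proof (rule tensor_ext[where t=s])
  fix a b
  show "tensor_mult (tensor_mult (a \<otimes> b) t) u = tensor_mult (a \<otimes> b) (tensor_mult t u)"
  proof (rule tensor_ext[where t=t])
    fix c d
    show "tensor_mult (tensor_mult (a \<otimes> b) (c \<otimes> d)) u = tensor_mult (a \<otimes> b) (tensor_mult (c \<otimes> d) u)"
      by (rule tensor_ext[where t=u]) (intro clin clin_tensor_mult, intro clin clin_tensor_mult,
          simp add: tensor_mult_pure mult.assoc)
  qed (intro clin clin_tensor_mult)+
qed (intro clin clin_tensor_mult)+

lemma tensor_mult_one: "tensor_mult (1 \<otimes> 1) t = t"
  by (rule tensor_ext[where t=t]) (intro clin clin_tensor_mult, intro clin clin_tensor_mult,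
      simp add: tensor_mult_pure)

lemma tensor_mult_sweedler:
  assumes "bilin \<beta>"
  shows "tensor_mult s (sweedler t \<beta>) = sweedler t (\<lambda>a b. tensor_mult s (\<beta> a b))"
    and "tensor_mult (sweedler t \<beta>) s = sweedler t (\<lambda>a b. tensor_mult (\<beta> a b) s)"
  by (rule sweedler_apply[OF _ assms], intro clin clin_tensor_mult)+

lemma comul_mult': "comul H (g * h) = tensor_mult (comul H g) (comul H h)"
  by (simp add: comul_mult tensor_mult_def)

text \<open>As for \<open>antipode_mult\<close>, both sides are convolution inverse to \<open>\<Delta>\<close>.\<close>

lemma comul_antipode: "comul H (antipode H h) = (\<Sum>\<langle>a \<otimes> b \<leftarrow> comul H h\<rangle>. antipode H b \<otimes> antipode H a)"
proof -
  let ?S = "antipode H"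
  note I = clin_all clin_hopf clin_tensor_mult
  define R where "R x = (\<Sum>\<langle>c \<otimes> d \<leftarrow> comul H x\<rangle>. ?S d \<otimes> ?S c)" for x
  have R: "clinear R" unfolding R_def by (intro I)
  note J = I clinear_comp[OF R]
  \<comment> \<open>\<open>R\<close> is a right convolution inverse of \<Delta>. After
    coassociativity the product is p S(d) \<otimes> q S(c) with q, c adjacent: the inner pair
    collapses to a counit first, then the outer pair p, d.\<close>
  have key: "(\<Sum>\<langle>b1 \<otimes> b2 \<leftarrow> comul H b\<rangle>. tensor_mult (comul H b1) (R b2)) = counit H b *\<^sub>C (1 \<otimes> 1)"
    for b
  proof -
    have "(\<Sum>\<langle>b1 \<otimes> b2 \<leftarrow> comul H b\<rangle>. tensor_mult (comul H b1) (R b2)) =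
      (\<Sum>\<langle>b1 \<otimes> b2 \<leftarrow> comul H b\<rangle>. \<Sum>\<langle>p \<otimes> q \<leftarrow> comul H b1\<rangle>. tensor_mult (p \<otimes> q) (R b2))"
      by (subst tensor_mult_sweedler(2)[symmetric], rule bilin_tensor, simp add: sweedler_id)
    also have "\<dots> = (\<Sum>\<langle>p \<otimes> x \<leftarrow> comul H b\<rangle>. \<Sum>\<langle>q \<otimes> b2 \<leftarrow> comul H x\<rangle>. tensor_mult (p \<otimes> q) (R b2))"
      by (rule sweedler_coassoc) (intro J)+
    also have "\<dots> = (\<Sum>\<langle>p \<otimes> x \<leftarrow> comul H b\<rangle>. \<Sum>\<langle>q \<otimes> b2 \<leftarrow> comul H x\<rangle>. \<Sum>\<langle>c \<otimes> d \<leftarrow> comul H b2\<rangle>.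
        (p * ?S d) \<otimes> (q * ?S c))"
      unfolding R_def by (subst tensor_mult_sweedler(1)) (intro I, simp add: tensor_mult_pure)
    also have "\<dots> = (\<Sum>\<langle>p \<otimes> x \<leftarrow> comul H b\<rangle>. \<Sum>\<langle>y \<otimes> d \<leftarrow> comul H x\<rangle>. \<Sum>\<langle>q \<otimes> c \<leftarrow> comul H y\<rangle>.
        (p * ?S d) \<otimes> (q * ?S c))"
      by (subst sweedler_coassoc) (intro I, intro I, intro I, simp)
    also have "\<dots> = (\<Sum>\<langle>p \<otimes> x \<leftarrow> comul H b\<rangle>. \<Sum>\<langle>y \<otimes> d \<leftarrow> comul H x\<rangle>. counit H y *\<^sub>C ((p * ?S d) \<otimes> 1))"
      by (subst sweedler_antipode_right) (intro I, simp)
    also have "\<dots> = (\<Sum>\<langle>p \<otimes> x \<leftarrow> comul H b\<rangle>. (p * ?S x) \<otimes> 1)"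
      by (subst sweedler_counit_left) (intro I, simp)
    also have "\<dots> = counit H b *\<^sub>C (1 \<otimes> 1)"
      by (rule sweedler_antipode_right) (intro I)
    finally show ?thesis .
  qed
  have "comul H (?S h) = (\<Sum>\<langle>a \<otimes> b \<leftarrow> comul H h\<rangle>. counit H b *\<^sub>C comul H (?S a))"
    by (rule sweedler_counit_right[symmetric]) (intro I)
  also have "\<dots> = (\<Sum>\<langle>a \<otimes> b \<leftarrow> comul H h\<rangle>. tensor_mult (counit H b *\<^sub>C (1 \<otimes> 1)) (comul H (?S a)))"
    by (simp add: tensor_mult_one clinear_scale[of "\<lambda>s. tensor_mult s _",
        OF bilin_left[OF bilin_tensor_mult clinear_id]])
  also have "\<dots> = (\<Sum>\<langle>a \<otimes> b \<leftarrow> comul H h\<rangle>. tensor_mult (comul H (?S a)) (counit H b *\<^sub>C (1 \<otimes> 1)))"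
  proof -
    have "tensor_mult (1 \<otimes> 1) t = tensor_mult t (1 \<otimes> 1)" for t
      by (rule tensor_ext[where t=t]) (intro clin clin_tensor_mult, intro clin clin_tensor_mult,
          simp add: tensor_mult_pure)
    then show ?thesis
      by (simp add: clinear_scale[OF bilin_left[OF bilin_tensor_mult clinear_id]]
          clinear_scale[OF bilin_right[OF bilin_tensor_mult clinear_id]])
  qed
  also have "\<dots> = (\<Sum>\<langle>a \<otimes> b \<leftarrow> comul H h\<rangle>. \<Sum>\<langle>b1 \<otimes> b2 \<leftarrow> comul H b\<rangle>.
      tensor_mult (comul H (?S a)) (tensor_mult (comul H b1) (R b2)))"
    unfolding key[symmetric] by (subst tensor_mult_sweedler(1)) (intro J, simp)
  also have "\<dots> = (\<Sum>\<langle>a \<otimes> b2 \<leftarrow> comul H h\<rangle>. \<Sum>\<langle>a1 \<otimes> b1 \<leftarrow> comul H a\<rangle>.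
      tensor_mult (comul H (?S a1)) (tensor_mult (comul H b1) (R b2)))"
    by (rule sweedler_coassoc[symmetric]) (intro J)+
  also have "\<dots> = (\<Sum>\<langle>a \<otimes> b2 \<leftarrow> comul H h\<rangle>. \<Sum>\<langle>a1 \<otimes> b1 \<leftarrow> comul H a\<rangle>.
      tensor_mult (comul H (?S a1 * b1)) (R b2))"
    by (simp add: comul_mult' tensor_mult_assoc)
  also have "\<dots> = (\<Sum>\<langle>a \<otimes> b2 \<leftarrow> comul H h\<rangle>. counit H a *\<^sub>C tensor_mult (comul H 1) (R b2))"
    by (subst sweedler_antipode_left) (intro J, simp)
  also have "\<dots> = tensor_mult (comul H 1) (R h)"
    by (rule sweedler_counit_left) (intro J)
  also have "\<dots> = R h" by (simp add: comul_one tensor_mult_one)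
  finally show ?thesis by (simp add: R_def)
qed

lemma antipode_S_inv: "antipode H (S_inv H h) = h"
  and S_inv_antipode: "S_inv H (antipode H h) = h"
  using bij_antipode by (simp_all add: S_inv_def bij_is_inj bij_is_surj surj_f_inv_f)

lemma linear_S_inv: "clinear (S_inv H)"
proof (rule clinearI)
  fix x y c
  show "S_inv H (x + y) = S_inv H x + S_inv H y"
    by (metis antipode_S_inv S_inv_antipode clinear_add[OF linear_antipode])
  show "S_inv H (c *\<^sub>C x) = c *\<^sub>C S_inv H x"
    by (metis antipode_S_inv S_inv_antipode clinear_scale[OF linear_antipode])
qed

lemmas clin_hopf' = clin_hopf clinear_comp[OF linear_S_inv]

lemma S_inv_mult: "S_inv H (g * h) = S_inv H h * S_inv H g"
  by (metis antipode_S_inv S_inv_antipode antipode_mult)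

lemma counit_S_inv: "counit H (S_inv H h) = counit H h"
  by (metis antipode_S_inv counit_antipode)

text \<open>Write h = S(k) with k = S^-1(h) and apply \<open>comul_antipode\<close> to k; the two
  inverse antipodes on the summands then cancel.\<close>

lemma sweedler_comul_S_inv:
  assumes "bilin \<beta>"
  shows "sweedler (comul H (S_inv H h)) \<beta> = (\<Sum>\<langle>a \<otimes> b \<leftarrow> comul H h\<rangle>. \<beta> (S_inv H b) (S_inv H a))"
proof -
  note I = clin_all clin_hopf' bilin_left[OF assms] bilin_right[OF assms]
  let ?k = "S_inv H h"
  have b: "bilin (\<lambda>a b. \<beta> (S_inv H b) (S_inv H a))" by (intro I)
  have "(\<Sum>\<langle>a \<otimes> b \<leftarrow> comul H h\<rangle>. \<beta> (S_inv H b) (S_inv H a)) =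
      (\<Sum>\<langle>a \<otimes> b \<leftarrow> comul H (antipode H ?k)\<rangle>. \<beta> (S_inv H b) (S_inv H a))"
    by (simp add: antipode_S_inv)
  also have "\<dots> = sweedler (comul H ?k) \<beta>"
    unfolding comul_antipode
    by (subst sweedler_sweedler[OF b], intro I) (simp add: sweedler_tensor[OF b] S_inv_antipode)
  finally show ?thesis ..
qed

text \<open>Applying S to h_2 S^-1(h_1) reverses the product to h_1 S(h_2), which is the antipode
  axiom; S is injective and fixes 1.\<close>

lemma sweedler_S_inv_right:
  assumes "clinear g"
  shows "(\<Sum>\<langle>a \<otimes> b \<leftarrow> comul H h\<rangle>. g (b * S_inv H a)) = counit H h *\<^sub>C g 1"
proof -
  let ?s = "\<Sum>\<langle>a \<otimes> b \<leftarrow> comul H h\<rangle>. b * S_inv H a"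
  note I = clin_all clin_hopf'
  have "antipode H ?s = (\<Sum>\<langle>a \<otimes> b \<leftarrow> comul H h\<rangle>. antipode H (b * S_inv H a))"
    by (rule sweedler_apply[OF linear_antipode]) (intro I)
  also have "\<dots> = counit H h *\<^sub>C 1"
    by (simp add: antipode_mult antipode_S_inv antipode_right)
  also have "\<dots> = antipode H (counit H h *\<^sub>C 1)"
    by (simp add: clinear_scale[OF linear_antipode] antipode_one)
  finally have "?s = counit H h *\<^sub>C 1"
    by (metis S_inv_antipode)
  moreover have "g ?s = (\<Sum>\<langle>a \<otimes> b \<leftarrow> comul H h\<rangle>. g (b * S_inv H a))"
    by (rule sweedler_apply[OF assms]) (intro I)
  ultimately show ?thesis by (simp add: clinear_scale[OF assms])
qed

end

locale hopf_sayd = hopf_algebra H + sayd_module H M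
  for H :: "'h::complex_algebra_1 hopf" and M :: "('m::complex_vector, 'h) hopf_mod"
begin

lemmas clin_sayd = clin_hopf' clinear_comp[OF ract_linear_left] clinear_comp[OF ract_linear_right]
  clinear_comp[OF coact_linear]

lemma sweedler_coact_coassoc:
  assumes 1: "\<And>b c. clinear (\<lambda>a. \<gamma> a b c)" and 2: "\<And>a c. clinear (\<lambda>b. \<gamma> a b c)"
    and 3: "\<And>a b. clinear (\<lambda>c. \<gamma> a b c)"
  shows "(\<Sum>\<langle>a \<otimes> n \<leftarrow> coact M m\<rangle>. \<Sum>\<langle>c \<otimes> d \<leftarrow> comul H a\<rangle>. \<gamma> c d n) =
    (\<Sum>\<langle>a \<otimes> n \<leftarrow> coact M m\<rangle>. \<Sum>\<langle>c \<otimes> d \<leftarrow> coact M n\<rangle>. \<gamma> a c d)"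
proof -
  note c = clinear_comp[OF 1] clinear_comp[OF 2] clinear_comp[OF 3]
  define G where "G t = (\<Sum>\<langle>c \<otimes> u \<leftarrow> t\<rangle>. \<Sum>\<langle>d \<otimes> b \<leftarrow> u\<rangle>. \<gamma> c d b)" for t
  have G: "clinear G" unfolding G_def by (intro clin_all c)
  have Gt: "G (c \<otimes> u) = (\<Sum>\<langle>d \<otimes> b \<leftarrow> u\<rangle>. \<gamma> c d b)" for c u
    unfolding G_def by (rule sweedler_tensor) (intro clin_all c)
  have Gp: "G (c \<otimes> d \<otimes> b) = \<gamma> c d b" for c d b
    unfolding Gt by (rule sweedler_tensor) (intro clin_all c)
  have "G (\<Sum>\<langle>a \<otimes> n \<leftarrow> coact M m\<rangle>. \<Sum>\<langle>c \<otimes> d \<leftarrow> comul H a\<rangle>. c \<otimes> d \<otimes> n) =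
      (\<Sum>\<langle>a \<otimes> n \<leftarrow> coact M m\<rangle>. G (\<Sum>\<langle>c \<otimes> d \<leftarrow> comul H a\<rangle>. c \<otimes> d \<otimes> n))"
    by (rule sweedler_apply[OF G]) (intro clin_all clin_hopf)
  also have "\<dots> = (\<Sum>\<langle>a \<otimes> n \<leftarrow> coact M m\<rangle>. \<Sum>\<langle>c \<otimes> d \<leftarrow> comul H a\<rangle>. \<gamma> c d n)"
    by (subst sweedler_apply[OF G]) (intro clin_all, simp add: Gp)
  finally have l: "G (\<Sum>\<langle>a \<otimes> n \<leftarrow> coact M m\<rangle>. \<Sum>\<langle>c \<otimes> d \<leftarrow> comul H a\<rangle>. c \<otimes> d \<otimes> n) =
     (\<Sum>\<langle>a \<otimes> n \<leftarrow> coact M m\<rangle>. \<Sum>\<langle>c \<otimes> d \<leftarrow> comul H a\<rangle>. \<gamma> c d n)" .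
  have r: "G (\<Sum>\<langle>a \<otimes> n \<leftarrow> coact M m\<rangle>. a \<otimes> coact M n) =
     (\<Sum>\<langle>a \<otimes> n \<leftarrow> coact M m\<rangle>. \<Sum>\<langle>c \<otimes> d \<leftarrow> coact M n\<rangle>. \<gamma> a c d)"
    by (subst sweedler_apply[OF G]) (intro clin_all clin_sayd, simp add: Gt)
  show ?thesis using l r coact_coassoc by simp
qed

lemma sweedler_coact_counit:
  assumes "clinear g"
  shows "(\<Sum>\<langle>a \<otimes> n \<leftarrow> coact M m\<rangle>. counit H a *\<^sub>C g n) = g m"
proof -
  have "g (\<Sum>\<langle>a \<otimes> n \<leftarrow> coact M m\<rangle>. counit H a *\<^sub>C n) = (\<Sum>\<langle>a \<otimes> n \<leftarrow> coact M m\<rangle>. g (counit H a *\<^sub>C n))"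
    by (rule sweedler_apply[OF assms]) (intro clin_all clin_hopf)
  then show ?thesis by (simp add: coact_counit clinear_scale[OF assms])
qed

text \<open>Anti-comultiplicativity of \<open>S\<^sup>-\<^sup>1\<close> turns the coaction applied to a composite into the
  iterated coaction.\<close>

lemma sweedler_coact_S_inv:
  assumes 1: "\<And>b c. clinear (\<lambda>a. \<gamma> a b c)" and 2: "\<And>a c. clinear (\<lambda>b. \<gamma> a b c)"
    and 3: "\<And>a b. clinear (\<lambda>c. \<gamma> a b c)"
  shows "(\<Sum>\<langle>a \<otimes> n \<leftarrow> coact M m\<rangle>. \<Sum>\<langle>c \<otimes> d \<leftarrow> comul H (S_inv H a)\<rangle>. \<gamma> c d n) =
    (\<Sum>\<langle>a \<otimes> n \<leftarrow> coact M m\<rangle>. \<Sum>\<langle>c \<otimes> n' \<leftarrow> coact M n\<rangle>. \<gamma> (S_inv H c) (S_inv H a) n')"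
proof -
  note I = clin_all clin_sayd clinear_comp[OF 1] clinear_comp[OF 2] clinear_comp[OF 3]
  have "(\<Sum>\<langle>a \<otimes> n \<leftarrow> coact M m\<rangle>. \<Sum>\<langle>c \<otimes> d \<leftarrow> comul H (S_inv H a)\<rangle>. \<gamma> c d n) =
    (\<Sum>\<langle>a \<otimes> n \<leftarrow> coact M m\<rangle>. \<Sum>\<langle>c \<otimes> d \<leftarrow> comul H a\<rangle>. \<gamma> (S_inv H d) (S_inv H c) n)"
    by (subst sweedler_comul_S_inv) (intro I, simp)
  also have "\<dots> = (\<Sum>\<langle>a \<otimes> n \<leftarrow> coact M m\<rangle>. \<Sum>\<langle>c \<otimes> n' \<leftarrow> coact M n\<rangle>. \<gamma> (S_inv H c) (S_inv H a) n')"
    by (rule sweedler_coact_coassoc) (intro I)+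
  finally show ?thesis .
qed

text \<open>Applying S^-1 to the first leg S(h_3) a h_1 of the anti-Yetter-Drinfeld condition
  reverses the product and cancels S, leaving S^-1(h_1) S^-1(a) h_3.\<close>

lemma sweedler_coact_ract:
  assumes "bilin \<beta>"
  shows "(\<Sum>\<langle>a \<otimes> n \<leftarrow> coact M (ract M m h)\<rangle>. \<beta> (S_inv H a) n) =
    (\<Sum>\<langle>h1 \<otimes> h' \<leftarrow> comul H h\<rangle>. \<Sum>\<langle>h2 \<otimes> h3 \<leftarrow> comul H h'\<rangle>. \<Sum>\<langle>a \<otimes> n \<leftarrow> coact M m\<rangle>.
      \<beta> (S_inv H h1 * (S_inv H a * h3)) (ract M n h2))"
proof -
  note I = clin_all clin_sayd bilin_left[OF assms] bilin_right[OF assms]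
  have b: "bilin (\<lambda>a n. \<beta> (S_inv H a) n)" by (intro I)
  show ?thesis
    unfolding anti_yetter_drinfeld
    by (subst sweedler_sweedler[OF b], intro I, subst sweedler_sweedler[OF b], intro I,
        subst sweedler_sweedler[OF b], intro I)
      (simp add: sweedler_tensor[OF b] S_inv_mult S_inv_antipode mult.assoc)
qed

end

section \<open>Operators on chains\<close>

text \<open>The value 0 on arrows that do not match makes associativity and compatibility with the
  action valid for all triples, without side conditions on the objects.\<close>

fun comp_arr :: "('o \<Rightarrow> 'o \<Rightarrow> 'o \<Rightarrow> 'f \<Rightarrow> 'f \<Rightarrow> 'f) \<Rightarrow> ('o, 'f::complex_vector) arrow \<Rightarrow> ('o, 'f) arrow
    \<Rightarrow> ('o, 'f) arrow" where
  "comp_arr cmp (Y, Z, g) (X, Y', f) = (X, Z, if Y = Y' then cmp X Y Z g f else 0)"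

fun act_arr :: "('o \<Rightarrow> 'o \<Rightarrow> 'h \<Rightarrow> 'f \<Rightarrow> 'f) \<Rightarrow> 'h \<Rightarrow> ('o, 'f::complex_vector) arrow \<Rightarrow> ('o,
    'f) arrow" where
  "act_arr act h (X, Y, f) = (X, Y, act X Y h f)"

abbreviation src :: "('o, 'f) arrow \<Rightarrow> 'o" where "src x \<equiv> fst x"
abbreviation tgt :: "('o, 'f) arrow \<Rightarrow> 'o" where "tgt x \<equiv> fst (snd x)"

lemma src_comp_arr [simp]: "src (comp_arr cmp x y) = src y"
  and tgt_comp_arr [simp]: "tgt (comp_arr cmp x y) = tgt x"
  by (cases x; cases y; simp)+

lemma src_act_arr [simp]: "src (act_arr act h x) = src x"
  and tgt_act_arr [simp]: "tgt (act_arr act h x) = tgt x"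
  by (cases x; simp)+

fun linked :: "('o, 'f) arrow list \<Rightarrow> bool" where
  "linked [] = True"
| "linked [x] = True"
| "linked (x # y # as) = (src x = tgt y \<and> linked (y # as))"

lemma chain_snoc_cons: "chain_snoc z (chain_cons x c) = chain_cons x (chain_snoc z c)"
  by (rule chain_ext[where c=c])
    (intro clin clin_chain_cons clin_chain_snoc, intro clin clin_chain_cons clin_chain_snoc,
      simp add: chain_cons_pure chain_snoc_pure)

lemma clinear_pure_mid: "clinear (\<lambda>f. pure (as @ (X, Y, f) # bs))"
  by (rule multilin_pure[unfolded multilin_def, rule_format])

lemma pure_Cons: "pure (a # as) = chain_cons a (pure as)"
  by (simp add: chain_cons_pure)

lemmas clin_chain = clin_chain_cons clin_chain_snoc clinear_pure_mid alinI

text \<open>Bilinearity on the whole type is all that is needed to define the operators on chains.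
  Associativity and the laws of the action come later, so that the same operators are available for
  matrix-valued arrows.\<close>

locale bilinear_ops =
  fixes cmp :: "'o \<Rightarrow> 'o \<Rightarrow> 'o \<Rightarrow> 'f::complex_vector \<Rightarrow> 'f \<Rightarrow> 'f"
    and act :: "'o \<Rightarrow> 'o \<Rightarrow> 'h::complex_algebra_1 \<Rightarrow> 'f \<Rightarrow> 'f"
  assumes bilin_cmp: "bilin (cmp X Y Z)"
    and bilin_act: "bilin (act X Y)"
begin

abbreviation cm :: "('o, 'f) arrow \<Rightarrow> ('o, 'f) arrow \<Rightarrow> ('o, 'f) arrow" where
  "cm \<equiv> comp_arr cmp"
abbreviation ac :: "'h \<Rightarrow> ('o, 'f) arrow \<Rightarrow> ('o, 'f) arrow" where
  "ac \<equiv> act_arr act"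

lemmas clin_cmp = bilin_left[OF bilin_cmp] bilin_right[OF bilin_cmp]
lemmas clin_act = bilin_left[OF bilin_act] bilin_right[OF bilin_act]

lemma alin_cm_left: "alin u \<Longrightarrow> alin (\<lambda>x. cm (u x) b)"
  unfolding alin_def[of u] by (cases b) (auto intro!: alinI clin clin_cmp)

lemma alin_cm_right: "alin u \<Longrightarrow> alin (\<lambda>x. cm b (u x))"
  unfolding alin_def[of u] by (cases b) (auto intro!: alinI clin clin_cmp)

lemma alin_ac_left: "clinear g \<Longrightarrow> alin (\<lambda>x. ac (g x) b)"
  by (cases b) (auto intro!: alinI clin_act)

lemma alin_ac_right: "alin u \<Longrightarrow> alin (\<lambda>x. ac h (u x))"
  unfolding alin_def[of u] by (auto intro!: alinI clin_act)

lemmas clin_ops = clin_all clin_cmp clin_act clin_chain alin_cm_left alin_cm_right alin_ac_left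
    alin_ac_right

lemma cmp_0 [simp]: "cmp X Y Z 0 f = 0" "cmp X Y Z g 0 = 0"
  using clinear_0[OF bilin_left[OF bilin_cmp clinear_id]] clinear_0[OF bilin_right[OF bilin_cmp
      clinear_id]]
  by simp_all

text \<open>\<open>faces\<close> is the alternating sum of the inner faces \<open>\<delta>\<^sub>0, \<dots>, \<delta>\<^sub>n\<close>; the last face, which involves
  the coaction, is assembled from \<open>wrap\<close>.\<close>

fun faces_list :: "('o, 'f) arrow list \<Rightarrow> ('o, 'f) chain" where
  "faces_list [] = 0"
| "faces_list [x] = 0"
| "faces_list (x # y # as) = chain_cons (cm x y) (pure as) - chain_cons x (faces_list (y # as))"

lemma multilin_faces_list: "multilin faces_list"
proof (rule multilinI)
  fix as X Y bs
  show "clinear (\<lambda>f. faces_list (as @ (X, Y, f) # bs))"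
  proof (induction as rule: faces_list.induct)
    case 1
    show ?case by (cases bs) (simp_all, intro clin_ops, intro clin_ops)
  next
    case (2 x)
    show ?case by (cases bs) (simp_all, (intro clin_ops)+)
  next
    case (3 x y as)
    then show ?case
      by simp (intro clin_ops)
  qed
qed

definition faces :: "('o, 'f) chain \<Rightarrow> ('o, 'f) chain" where
  "faces = chain_lift faces_list"

lemma clinear_faces: "clinear faces"
  unfolding faces_def by (rule clinear_chain_lift[OF multilin_faces_list])

lemma faces_pure: "faces (pure as) = faces_list as"
  unfolding faces_def by (rule chain_lift_pure[OF multilin_faces_list])

lemmas clin_faces = clinear_comp[OF clinear_faces]

lemma faces_cons2:
  "faces (chain_cons x (chain_cons y c)) = chain_cons (cm x y) c - chain_cons x (faces (chain_cons
      y c))"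
  by (rule chain_ext[where c=c])
    (intro clin_ops clin_faces, intro clin_ops clin_faces, simp add: chain_cons_pure faces_pure)

lemma faces_short [simp]: "faces (pure []) = 0" "faces (pure [x]) = 0"
  by (simp_all add: faces_pure)

lemma faces_Cons2: "faces (pure (x # y # as)) =
    chain_cons (cm x y) (pure as) - chain_cons x (faces (pure (y # as)))"
  by (simp add: faces_pure)

text \<open>The recursion of \<open>faces\<close> read from the right: every face but the last
  leaves \<open>z\<close> alone, and the last one, of index \<open>length as\<close>, composes
  \<open>y\<close> with \<open>z\<close>.\<close>

lemma faces_snoc2: "faces (pure (as @ [y, z])) =
  chain_snoc z (faces (pure (as @ [y]))) + (-1) ^ length as *\<^sub>C pure (as @ [cm y z])"
proof (induction as)
  case Nil
  show ?case by (simp add: faces_Cons2 clinear_0[OF clinear_chain_cons] clinear_0[OF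
      clinear_chain_snoc] chain_cons_pure)
next
  case (Cons x as)
  note l = clinear_diff[OF clinear_chain_cons] clinear_add[OF clinear_chain_cons]
    clinear_diff[OF clinear_chain_snoc] clinear_scale[OF clinear_chain_cons]
  show ?case
  proof (cases as)
    case Nil
    then show ?thesis using Cons
      by (simp add: faces_Cons2 l chain_snoc_cons chain_cons_pure chain_snoc_pure
          clinear_0[OF clinear_chain_cons] clinear_0[OF clinear_chain_snoc])
  next
    case (Cons w ws)
    then show ?thesis using \<open>faces (pure (as @ [y, z])) = _\<close>
      by (simp add: faces_Cons2 l chain_snoc_cons chain_cons_pure chain_snoc_pure)
  qed
qed

section \<open>The face of index 0, the rotation and the wrapped face\<close>

fun face0_list :: "('o, 'f) arrow list \<Rightarrow> ('o, 'f) chain" where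
  "face0_list (x # y # as) = chain_cons (cm x y) (pure as)"
| "face0_list _ = 0"

lemma multilin_face0_list: "multilin face0_list"
proof (rule multilinI)
  fix as X Y bs
  show "clinear (\<lambda>f. face0_list (as @ (X, Y, f) # bs))"
    by (cases as rule: faces_list.cases; cases bs) (simp_all, (intro clin_ops)+)
qed

definition face0 :: "('o, 'f) chain \<Rightarrow> ('o, 'f) chain" where
  "face0 = chain_lift face0_list"

lemma clinear_face0: "clinear face0"
  unfolding face0_def by (rule clinear_chain_lift[OF multilin_face0_list])

lemma face0_pure: "face0 (pure as) = face0_list as"
  unfolding face0_def by (rule chain_lift_pure[OF multilin_face0_list])

lemmas clin_face0 = clinear_comp[OF clinear_face0]

lemma face0_cons2: "face0 (chain_cons x (chain_cons y c)) = chain_cons (cm x y) c"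
  by (rule chain_ext[where c=c])
    (intro clin_ops clin_face0, intro clin_ops clin_face0, simp add: chain_cons_pure face0_pure)

definition rotate_list :: "'h \<Rightarrow> ('o, 'f) arrow list \<Rightarrow> ('o, 'f) chain" where
  "rotate_list h as = (if as = [] then 0 else chain_cons (ac h (last as)) (pure (butlast as)))"

lemma multilin_rotate_list: "multilin (rotate_list h)"
proof (rule multilinI)
  fix as X Y bs
  show "clinear (\<lambda>f. rotate_list h (as @ (X, Y, f) # bs))"
    by (cases bs rule: rev_cases) (simp_all add: rotate_list_def butlast_append, (intro clin_ops)+)
qed

definition rotate :: "'h \<Rightarrow> ('o, 'f) chain \<Rightarrow> ('o, 'f) chain" where
  "rotate h = chain_lift (rotate_list h)"

lemma clinear_rotate: "clinear (rotate h)"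
  unfolding rotate_def by (rule clinear_chain_lift[OF multilin_rotate_list])

lemma rotate_pure: "rotate h (pure as) = rotate_list h as"
  unfolding rotate_def by (rule chain_lift_pure[OF multilin_rotate_list])

lemma clinear_rotate_left: "clinear (\<lambda>h. rotate h c)"
proof (rule chain_param[OF clinear_rotate])
  show "clinear (\<lambda>h. rotate h (pure as))" for as
    unfolding rotate_pure rotate_list_def by (intro clin_ops)
qed

lemmas clin_rotate = clinear_comp[OF clinear_rotate] clinear_comp[OF clinear_rotate_left]

lemma rotate_snoc: "rotate h (chain_snoc z c) = chain_cons (ac h z) c"
  by (rule chain_ext[where c=c])
    (intro clin_ops clin_rotate, intro clin_ops clin_rotate,
      simp add: chain_cons_pure chain_snoc_pure rotate_pure rotate_list_def)

lemma rotate_pure_snoc: "rotate h (pure (as @ [z])) = pure (ac h z # as)"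
  by (simp add: rotate_pure rotate_list_def chain_cons_pure)

text \<open>The cyclic identity that expresses the last coface as \<tau> applied to the coface of
  index 0, on the level of chains; \<open>h\<close> is a placeholder for S^-1 of the coaction
  factor.\<close>

definition wrap :: "'h \<Rightarrow> ('o, 'f) chain \<Rightarrow> ('o, 'f) chain" where
  "wrap h c = face0 (rotate h c)"

lemma clinear_wrap: "clinear (wrap h)" and clinear_wrap_left: "clinear (\<lambda>h. wrap h c)"
  unfolding wrap_def[abs_def] by (intro clin_face0 clin_rotate clin)+

lemmas clin_wrap = clinear_comp[OF clinear_wrap] clinear_comp[OF clinear_wrap_left]

lemma wrap_cons_snoc: "wrap h (chain_cons x (chain_snoc z c)) = chain_cons (cm (ac h z) x) c"
  by (simp add: wrap_def chain_snoc_cons[symmetric] rotate_snoc face0_cons2)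

lemma wrap_pure: "wrap h (pure (x # as @ [z])) = pure (cm (ac h z) x # as)"
  using wrap_cons_snoc[of h x z "pure as"] by (simp add: chain_cons_pure chain_snoc_pure)

text \<open>A single arrow has no face. The value 0 lets the homotopy formula below hold uniformly,
  including degree 0.\<close>

lemma wrap_single [simp]: "wrap h (pure [x]) = 0"
  by (simp add: wrap_def rotate_pure rotate_list_def chain_cons_pure face0_pure clinear_0[OF
      clinear_face0])

subsection \<open>Inserting an endomorphism of every object\<close>

abbreviation at_ob :: "('o \<Rightarrow> 'f) \<Rightarrow> 'o \<Rightarrow> ('o, 'f) arrow" where
  "at_ob K X \<equiv> (X, X, K X)"

text \<open>Signs alternate with the position. An insertion before the first arrow is left out on
  purpose: cyclically it is the insertion after the last one.\<close>

fun plug_list :: "('o \<Rightarrow> 'f) \<Rightarrow> ('o, 'f) arrow list \<Rightarrow> ('o, 'f) chain" where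
  "plug_list K [] = 0"
| "plug_list K (x # as) = chain_cons x (chain_cons (at_ob K (src x)) (pure as)) - chain_cons x
    (plug_list K as)"

lemma multilin_plug_list: "multilin (plug_list K)"
proof (rule multilinI)
  fix as X Y bs
  show "clinear (\<lambda>f. plug_list K (as @ (X, Y, f) # bs))"
  proof (induction as)
    case Nil
    show ?case by (simp, intro clin_ops)
  next
    case (Cons x as)
    then show ?case by (simp, intro clin_ops)
  qed
qed

definition plug :: "('o \<Rightarrow> 'f) \<Rightarrow> ('o, 'f) chain \<Rightarrow> ('o, 'f) chain" where
  "plug K = chain_lift (plug_list K)"

lemma clinear_plug: "clinear (plug K)"
  unfolding plug_def by (rule clinear_chain_lift[OF multilin_plug_list])

lemma plug_pure: "plug K (pure as) = plug_list K as"
  unfolding plug_def by (rule chain_lift_pure[OF multilin_plug_list])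

lemmas clin_plug = clinear_comp[OF clinear_plug]

lemma plug_cons:
  "plug K (chain_cons x c) = chain_cons x (chain_cons (at_ob K (src x)) c) - chain_cons x (plug K
      c)"
  by (rule chain_ext[where c=c])
    (intro clin_ops clin_plug, intro clin_ops clin_plug, simp add: chain_cons_pure plug_pure)

lemma plug_Nil [simp]: "plug K (pure []) = 0"
  by (simp add: plug_pure)

lemmas lin_simps = clinear_0[OF clinear_chain_cons] clinear_add[OF clinear_chain_cons]
  clinear_diff[OF clinear_chain_cons] clinear_minus[OF clinear_chain_cons] clinear_scale[OF
      clinear_chain_cons]
  clinear_0[OF clinear_chain_snoc] clinear_add[OF clinear_chain_snoc]
  clinear_diff[OF clinear_chain_snoc] clinear_minus[OF clinear_chain_snoc] clinear_scale[OF
      clinear_chain_snoc]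
  clinear_0[OF clinear_faces] clinear_add[OF clinear_faces]
  clinear_diff[OF clinear_faces] clinear_minus[OF clinear_faces] clinear_scale[OF clinear_faces]
  clinear_0[OF clinear_plug] clinear_add[OF clinear_plug]
  clinear_diff[OF clinear_plug] clinear_minus[OF clinear_plug] clinear_scale[OF clinear_plug]
  clinear_0[OF clinear_rotate] clinear_add[OF clinear_rotate]
  clinear_diff[OF clinear_rotate] clinear_minus[OF clinear_rotate] clinear_scale[OF clinear_rotate]
  clinear_0[OF clinear_wrap] clinear_add[OF clinear_wrap]
  clinear_diff[OF clinear_wrap] clinear_minus[OF clinear_wrap] clinear_scale[OF clinear_wrap]

lemma plug_snoc: "plug K (pure (as @ [z])) =
  chain_snoc z (plug K (pure as)) + (-1) ^ length as *\<^sub>C pure (as @ [z, at_ob K (src z)])"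
proof (induction as)
  case Nil
  show ?case by (simp add: pure_Cons plug_cons lin_simps)
next
  case (Cons x as)
  then show ?case
    by (simp add: pure_Cons plug_cons lin_simps chain_snoc_cons)
      (simp add: chain_cons_pure chain_snoc_pure)
qed

text \<open>The faces that compose the inserted K with a neighbour. K after the arrow of index k
  carries (-1)^k, and its two faces have indices k and k + 1, so f^k K enters with + and K f^(k+1)
  with -. After the last arrow only the first of the two occurs.\<close>

fun side :: "('o \<Rightarrow> 'f) \<Rightarrow> ('o, 'f) arrow list \<Rightarrow> ('o, 'f) chain" where
  "side K [] = 0"
| "side K [x] = chain_cons (cm x (at_ob K (src x))) (pure [])"
| "side K (x # y # as) = chain_cons (cm x (at_ob K (src x))) (chain_cons y (pure as))
    - chain_cons x (chain_cons (cm (at_ob K (src x)) y) (pure as)) + chain_cons x (side K (y # as))"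

text \<open>A face that does not involve K may be taken before the insertion, with opposite sign
  because one of the two positions shifts by one; what remains is \<open>side\<close>.\<close>

lemma faces_plug: "faces (plug K (pure xs)) = side K xs - plug K (faces (pure xs))"
proof (induction xs rule: faces_list.induct)
  case 1
  show ?case by (simp add: lin_simps)
next
  case (2 x)
  show ?case by (simp add: pure_Cons plug_cons lin_simps faces_cons2)
      (simp add: chain_cons_pure lin_simps)
next
  case (3 x y as)
  \<comment> \<open>What follows \<open>y\<close> when K is inserted after \<open>y\<close> or
    later; inserting K after \<open>x\<close> is the remaining case.\<close>
  let ?J = "chain_cons (at_ob K (src y)) (pure as) - plug K (pure as)"
  have y: "plug K (pure (y # as)) = chain_cons y ?J"
    by (simp add: pure_Cons plug_cons lin_simps)
  have "faces (plug K (pure (x # y # as))) =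
      faces (chain_cons x (chain_cons (at_ob K (src x)) (chain_cons y (pure as)))) - faces
          (chain_cons x (chain_cons y ?J))"
    by (simp add: pure_Cons[of x] plug_cons y lin_simps) (simp add: pure_Cons)
  also have "\<dots> = chain_cons (cm x (at_ob K (src x))) (chain_cons y (pure as))
     - chain_cons x (chain_cons (cm (at_ob K (src x)) y) (pure as))
     + chain_cons x (chain_cons (at_ob K (src x)) (faces (pure (y # as))))
     - (chain_cons (cm x y) ?J - chain_cons x (faces (plug K (pure (y # as)))))"
    by (simp add: faces_cons2 lin_simps y del: comp_arr.simps) (simp add: pure_Cons)
  also have "\<dots> = side K (x # y # as) - plug K (faces (pure (x # y # as)))"
    by (simp add: 3 faces_Cons2 plug_cons lin_simps del: comp_arr.simps)
  finally show ?case .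
qed

definition commutator :: "('o \<Rightarrow> 'f) \<Rightarrow> ('o, 'f) arrow \<Rightarrow> 'f" where
  "commutator K x = cmp (src x) (tgt x) (tgt x) (K (tgt x)) (snd (snd x))
    - cmp (src x) (src x) (tgt x) (snd (snd x)) (K (src x))"

fun derivation :: "(('o, 'f) arrow \<Rightarrow> 'f) \<Rightarrow> ('o, 'f) arrow list \<Rightarrow> ('o, 'f) chain" where
  "derivation d [] = 0"
| "derivation d (x # as) = chain_cons (src x, tgt x, d x) (pure as) +
    chain_cons x (derivation d as)"

lemma chain_cons_diff_left: "chain_cons (X, Y, f - g) c = chain_cons (X, Y, f) c - chain_cons (X,
    Y, g) c"
  by (rule clinear_diff[of "\<lambda>f. chain_cons (X, Y, f) c"]) (intro clin_ops)

lemma chain_cons_commutator: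
  "chain_cons (src x, tgt x, commutator K x) c =
    chain_cons (cm (at_ob K (tgt x)) x) c - chain_cons (cm x (at_ob K (src x))) c"
  by (cases x) (simp add: commutator_def chain_cons_diff_left)

text \<open>In a linked list the object of K between two arrows is the target of the second, so f^k
  K and -K f^k combine to -[K, f^k]. Only K f^0 is missing from \<open>side\<close>, hence the
  correction term.\<close>

lemma side_derivation:
  "linked (x # xs) \<Longrightarrow>
    side K (x # xs) = chain_cons (cm (at_ob K (tgt x)) x) (pure xs) - derivation (commutator K) (x
        # xs)"
proof (induction xs arbitrary: x)
  case Nil
  show ?case by (simp add: chain_cons_commutator lin_simps)
next
  case (Cons y xs)
  then have "side K (y # xs) =
    chain_cons (cm (at_ob K (src x)) y) (pure xs) - derivation (commutator K) (y # xs)" by simp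
  then show ?case
    by (simp add: chain_cons_commutator lin_simps pure_Cons[of y] derivation.simps(2)[of _ x]
        del: derivation.simps comp_arr.simps)
qed

text \<open>Wrapping affects only the two ends of the chain, so it commutes with insertions in the
  interior. The exception is the insertion after the last arrow: there K itself is wrapped around
  and composed with the first arrow.\<close>

lemma wrap_plug:
  "wrap h (plug K (pure (x # ys))) = plug K (wrap h (pure (x # ys)))
    + (-1) ^ length ys *\<^sub>C pure (cm (ac h (at_ob K (src (last (x # ys))))) x # ys)"
proof (cases ys rule: rev_cases)
  case Nil
  have "plug K (pure [x]) = pure (x # [] @ [at_ob K (src x)])"
    by (simp add: pure_Cons plug_cons lin_simps)
  then show ?thesis
    by (simp add: Nil wrap_pure lin_simps del: append_Nil append_Cons)
next
  case (snoc as z)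
  let ?J = "chain_cons (at_ob K (src x)) (pure as) - plug K (pure as)"
  have "plug K (pure ((x # as) @ [z])) =
    chain_snoc z (chain_cons x ?J) + (-1) ^ length (x # as) *\<^sub>C pure ((x # as) @ [z,
        at_ob K (src z)])"
    unfolding plug_snoc by (simp add: pure_Cons plug_cons lin_simps)
  then have "plug K (pure (x # ys)) =
    chain_cons x (chain_snoc z ?J) + (-1) ^ length ys *\<^sub>C pure (x # ys @ [at_ob K (src z)])"
    by (simp add: snoc chain_snoc_cons)
  then have "wrap h (plug K (pure (x # ys))) = chain_cons (cm (ac h z) x) ?J
      + (-1) ^ length ys *\<^sub>C pure (cm (ac h (at_ob K (src z))) x # ys)"
    by (simp add: lin_simps(21-) wrap_cons_snoc wrap_pure)
  moreover have "plug K (wrap h (pure (x # ys))) = chain_cons (cm (ac h z) x) ?J"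
    by (simp add: snoc wrap_pure) (simp add: pure_Cons plug_cons lin_simps)
  ultimately show ?thesis by (simp add: snoc)
qed

end

section \<open>The diagonal action\<close>

lemma sweedler_zero: "sweedler t (\<lambda>a b. 0) = 0"
  by (rule sweedler_lift[OF _ clinear_zero]) (intro clin_all, simp)

lemma sweedler_diff:
  assumes "bilin \<beta>" "bilin \<gamma>"
  shows "sweedler t (\<lambda>a b. \<beta> a b - \<gamma> a b) = sweedler t \<beta> - sweedler t \<gamma>"
proof (rule sweedler_lift)
  show "bilin (\<lambda>a b. \<beta> a b - \<gamma> a b)"
    by (intro bilinI clin bilin_left[OF assms(1)] bilin_left[OF assms(2)]
        bilin_right[OF assms(1)] bilin_right[OF assms(2)])
  show "clinear (\<lambda>t. sweedler t \<beta> - sweedler t \<gamma>)"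
    by (intro clin clin_sweedler assms)
qed (simp add: sweedler_tensor assms)

lemma sweedler_lincomb:
  assumes "bilin \<beta>" "bilin \<gamma>"
  shows "(\<Sum>\<langle>a \<otimes> m' \<leftarrow> t\<rangle>. \<beta> a m' + k * \<gamma> a m') = sweedler t \<beta> + k * (sweedler t \<gamma> :: complex)"
proof (rule sweedler_lift)
  show "bilin (\<lambda>a m'. \<beta> a m' + k * \<gamma> a m')"
    by (intro bilinI clin clinear_cmult bilin_left[OF assms(1)] bilin_left[OF assms(2)]
        bilin_right[OF assms(1)] bilin_right[OF assms(2)])
  show "clinear (\<lambda>t. sweedler t \<beta> + k * sweedler t \<gamma>)"
    by (intro clin clinear_cmult clin_sweedler assms)
qed (simp add: sweedler_tensor assms)

lemma sweedler_in_subspace: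
  assumes "bilin \<beta>" "cvec.subspace V" "\<And>a b. \<beta> a b \<in> V"
  shows "sweedler t \<beta> \<in> V"
proof -
  obtain ps where t: "t = (\<Sum>(a, b)\<leftarrow>ps. a \<otimes> b)" using tensor_decomp by blast
  show ?thesis unfolding t sweedler_sum_list[OF assms(1)]
    using assms by (induction ps) (auto simp: cvec.subspace_0 cvec.subspace_add)
qed

locale hopf_ops = hopf_algebra H + bilinear_ops cmp act
  for H :: "'h::complex_algebra_1 hopf"
    and cmp :: "'o \<Rightarrow> 'o \<Rightarrow> 'o \<Rightarrow> 'f::complex_vector \<Rightarrow> 'f \<Rightarrow> 'f"
    and act :: "'o \<Rightarrow> 'o \<Rightarrow> 'h \<Rightarrow> 'f \<Rightarrow> 'f"
begin

fun dact_list :: "'h \<Rightarrow> ('o, 'f) arrow list \<Rightarrow> ('o, 'f) chain" where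
  "dact_list h [] = counit H h *\<^sub>C pure []"
| "dact_list h (x # as) = (\<Sum>\<langle>h1 \<otimes> h2 \<leftarrow> comul H h\<rangle>. chain_cons (ac h1 x) (dact_list h2 as))"

lemma clinear_dact_list_left: "clinear (\<lambda>h. dact_list h as)"
proof (induction as)
  case Nil
  then show ?case by simp (intro clin_ops clin_hopf)
next
  case (Cons x as)
  show ?case by simp (intro clin_ops clin_hopf clinear_comp[OF Cons.IH])
qed

lemmas clinear_dact_list = clinear_comp[OF clinear_dact_list_left]

lemma multilin_dact_list: "multilin (dact_list h)"
proof (rule multilinI)
  fix as X Y bs
  show "clinear (\<lambda>f. dact_list h (as @ (X, Y, f) # bs))"
  proof (induction as arbitrary: h)
    case Nil
    show ?case by (simp, intro clin_ops clinear_dact_list)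
  next
    case (Cons x as)
    then show ?case by simp (intro clin_ops clinear_dact_list | assumption)+
  qed
qed

definition dact :: "'h \<Rightarrow> ('o, 'f) chain \<Rightarrow> ('o, 'f) chain" where
  "dact h = chain_lift (dact_list h)"

lemma clinear_dact: "clinear (dact h)"
  unfolding dact_def by (rule clinear_chain_lift[OF multilin_dact_list])

lemma dact_pure: "dact h (pure as) = dact_list h as"
  unfolding dact_def by (rule chain_lift_pure[OF multilin_dact_list])

lemma clinear_dact_left: "clinear (\<lambda>h. dact h c)"
  by (rule chain_param[OF clinear_dact]) (simp add: dact_pure clinear_dact_list_left)

lemmas clin_dact = clinear_comp[OF clinear_dact] clinear_comp[OF clinear_dact_left]

lemmas lin_rules = clin_ops clin_hopf' clin_dact clin_faces clin_face0 clin_rotate clin_wrap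
    clin_plug

lemma dact_Nil: "dact h (pure []) = counit H h *\<^sub>C pure []"
  by (simp add: dact_pure)

lemma dact_cons:
  "dact h (chain_cons x c) = (\<Sum>\<langle>h1 \<otimes> h2 \<leftarrow> comul H h\<rangle>. chain_cons (ac h1 x) (dact h2 c))"
  by (rule chain_ext[where c=c]) (intro lin_rules, intro lin_rules,
      simp add: chain_cons_pure dact_pure)

lemma dact_sweedler: "bilin \<beta> \<Longrightarrow> dact h (sweedler t \<beta>) = sweedler t (\<lambda>a b. dact h (\<beta> a b))"
  by (rule sweedler_apply[OF clinear_dact])

text \<open>The recursion of \<open>dact_list\<close> splits the factor of the first arrow off h;
  coassociativity allows that of the last arrow to be split off instead.\<close>

lemma dact_snoc:
  "dact h (chain_snoc z c) = (\<Sum>\<langle>h1 \<otimes> h2 \<leftarrow> comul H h\<rangle>. chain_snoc (ac h2 z) (dact h1 c))"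
proof (rule chain_ext[where c=c])
  fix as
  show "dact h (chain_snoc z (pure as)) = (\<Sum>\<langle>h1 \<otimes> h2 \<leftarrow> comul H h\<rangle>.
      chain_snoc (ac h2 z) (dact h1 (pure as)))"
  proof (induction as arbitrary: h)
    case Nil
    have "(\<Sum>\<langle>h1 \<otimes> h2 \<leftarrow> comul H h\<rangle>. counit H h2 *\<^sub>C chain_cons (ac h1 z) (pure [])) =
        chain_cons (ac h z) (pure [])"
      by (rule sweedler_counit_right) (intro lin_rules)
    moreover have "(\<Sum>\<langle>h1 \<otimes> h2 \<leftarrow> comul H h\<rangle>. counit H h1 *\<^sub>C chain_snoc (ac h2 z) (pure [])) =
        chain_snoc (ac h z) (pure [])"
      by (rule sweedler_counit_left) (intro lin_rules)
    ultimately show ?case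
      by (simp add: chain_snoc_pure pure_Cons dact_cons dact_Nil lin_simps)
  next
    case (Cons x as)
    have "dact h (chain_snoc z (pure (x # as))) =
      (\<Sum>\<langle>h1 \<otimes> h' \<leftarrow> comul H h\<rangle>. \<Sum>\<langle>h2 \<otimes> h3 \<leftarrow> comul H h'\<rangle>.
          chain_cons (ac h1 x) (chain_snoc (ac h3 z) (dact h2 (pure as))))"
      unfolding pure_Cons chain_snoc_cons dact_cons Cons
      by (subst sweedler_apply[OF clinear_chain_cons]) (intro lin_rules, simp)
    also have "\<dots> = (\<Sum>\<langle>h' \<otimes> h3 \<leftarrow> comul H h\<rangle>. \<Sum>\<langle>h1 \<otimes> h2 \<leftarrow> comul H h'\<rangle>.
        chain_cons (ac h1 x) (chain_snoc (ac h3 z) (dact h2 (pure as))))"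
      by (rule sweedler_coassoc[symmetric]) (intro lin_rules)+
    also have "\<dots> = (\<Sum>\<langle>h' \<otimes> h3 \<leftarrow> comul H h\<rangle>. chain_snoc (ac h3 z) (dact h' (pure (x # as))))"
      unfolding pure_Cons dact_cons
      by (subst sweedler_apply[OF clinear_chain_snoc]) (intro lin_rules, simp add: chain_snoc_cons)
    finally show ?case .
  qed
qed (intro lin_rules)+

text \<open>An invariant K absorbs its Sweedler factor into a counit, so inserting it does not
  disturb the distribution of h over the other arrows.\<close>

lemma dact_plug:
  assumes K: "\<And>X h. act X X h (K X) = counit H h *\<^sub>C K X"
  shows "dact h (plug K c) = plug K (dact h c)"
proof -
  have at: "dact h (chain_cons (at_ob K X) c) = chain_cons (at_ob K X) (dact h c)" for X c h
  proof -
    have "chain_cons (X, X, k *\<^sub>C v) d = k *\<^sub>C chain_cons (X, X, v) d" for k v and d :: "('o,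
        'f) chain"
      by (rule clinear_scale[of "\<lambda>v. chain_cons (X, X, v) d"]) (intro lin_rules)
    then have "dact h (chain_cons (at_ob K X) c) =
        (\<Sum>\<langle>h1 \<otimes> h2 \<leftarrow> comul H h\<rangle>. counit H h1 *\<^sub>C chain_cons (at_ob K X) (dact h2 c))"
      by (simp add: dact_cons K)
    also have "\<dots> = chain_cons (at_ob K X) (dact h c)"
      by (rule sweedler_counit_left) (intro lin_rules)
    finally show ?thesis .
  qed
  show ?thesis
  proof (rule chain_ext[where c=c])
    fix as
    show "dact h (plug K (pure as)) = plug K (dact h (pure as))"
    proof (induction as arbitrary: h)
      case Nil
      show ?case by (simp add: dact_Nil lin_simps clinear_0[OF clinear_dact])
    next
      case (Cons x as)
      have "dact h (plug K (pure (x # as))) =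
        (\<Sum>\<langle>h1 \<otimes> h2 \<leftarrow> comul H h\<rangle>. chain_cons (ac h1 x) (chain_cons (at_ob K (src x)) (dact h2 (pure
            as)))) -
        (\<Sum>\<langle>h1 \<otimes> h2 \<leftarrow> comul H h\<rangle>. chain_cons (ac h1 x) (plug K (dact h2 (pure as))))"
        unfolding pure_Cons plug_cons clinear_diff[OF clinear_dact]
        by (simp only: dact_cons[of _ x] at Cons)
      also have "\<dots> = (\<Sum>\<langle>h1 \<otimes> h2 \<leftarrow> comul H h\<rangle>. plug K (chain_cons (ac h1 x) (dact h2 (pure as))))"
        unfolding plug_cons src_act_arr by (rule sweedler_diff[symmetric]) (intro lin_rules)+
      also have "\<dots> = plug K (dact h (pure (x # as)))"
        unfolding pure_Cons dact_cons by (rule sweedler_apply[OF clinear_plug,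
            symmetric]) (intro lin_rules)
      finally show ?case .
    qed
  qed (intro lin_rules)+
qed

end

locale hcat_ops = hopf_ops H cmp act
  for H :: "'h::complex_algebra_1 hopf"
    and cmp :: "'o \<Rightarrow> 'o \<Rightarrow> 'o \<Rightarrow> 'f::complex_vector \<Rightarrow> 'f \<Rightarrow> 'f"
    and act :: "'o \<Rightarrow> 'o \<Rightarrow> 'h \<Rightarrow> 'f \<Rightarrow> 'f" +
  assumes act_mult: "act X Y (g * h) f = act X Y g (act X Y h f)"
    and act_cmp: "act X Z h (cmp X Y Z f' f) =
      (\<Sum>\<langle>h1 \<otimes> h2 \<leftarrow> comul H h\<rangle>. cmp X Y Z (act Y Z h1 f') (act X Y h2 f))"
    and cmp_assoc: "cmp W X Z (cmp X Y Z f' f) e = cmp W Y Z f' (cmp W X Y f e)"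
begin

lemma ac_mult: "ac (g * h) x = ac g (ac h x)"
  by (cases x) (simp add: act_mult)

lemma cm_assoc: "cm (cm x y) z = cm x (cm y z)"
  by (cases x; cases y; cases z) (simp add: cmp_assoc)

text \<open>Arrows, being triples, cannot be summed; hence the rule is stated under a map
  \<open>F\<close> that is linear in the morphism.\<close>

lemma ac_cm:
  assumes F: "\<And>X Y. clinear (\<lambda>f. F (X, Y, f))"
  shows "F (ac h (cm x y)) = (\<Sum>\<langle>h1 \<otimes> h2 \<leftarrow> comul H h\<rangle>. F (cm (ac h1 x) (ac h2 y)))"
proof -
  obtain Y Z g X Y' f where xy: "x = (Y, Z, g)" "y = (X, Y', f)" by (cases x; cases y)
  have "act X Z h 0 = 0" using clinear_0[OF bilin_right[OF bilin_act clinear_id]] .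
  then show ?thesis
    by (simp add: xy act_cmp clinear_0[OF F] sweedler_zero)
      (rule impI, rule sweedler_apply[OF F], intro lin_rules)
qed

lemma dact_mult: "dact (g * h) c = dact g (dact h c)"
proof (rule chain_ext[where c=c])
  fix as
  show "dact (g * h) (pure as) = dact g (dact h (pure as))"
  proof (induction as arbitrary: g h)
    case Nil
    show ?case by (simp add: dact_Nil clinear_scale[OF clinear_dact] counit_mult scaleC_scaleC
        mult.commute)
  next
    case (Cons x as)
    have "dact (g * h) (pure (x # as)) = (\<Sum>\<langle>g1 \<otimes> g2 \<leftarrow> comul H g\<rangle>. \<Sum>\<langle>h1 \<otimes> h2 \<leftarrow> comul H h\<rangle>.
        chain_cons (ac g1 (ac h1 x)) (dact g2 (dact h2 (pure as))))"
      unfolding pure_Cons dact_cons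
      by (subst sweedler_comul_mult) (intro lin_rules, simp add: ac_mult Cons)
    also have "\<dots> = (\<Sum>\<langle>h1 \<otimes> h2 \<leftarrow> comul H h\<rangle>. \<Sum>\<langle>g1 \<otimes> g2 \<leftarrow> comul H g\<rangle>.
        chain_cons (ac g1 (ac h1 x)) (dact g2 (dact h2 (pure as))))"
      by (rule sweedler_swap) (intro lin_rules)+
    also have "\<dots> = dact g (dact h (pure (x # as)))"
      unfolding pure_Cons dact_cons by (subst dact_sweedler) (intro lin_rules, simp add: dact_cons)
    finally show ?case .
  qed
qed (intro lin_rules)+

lemma dact_cons2: "dact h (chain_cons (cm x y) c) =
  (\<Sum>\<langle>h1 \<otimes> h' \<leftarrow> comul H h\<rangle>. \<Sum>\<langle>h2 \<otimes> h3 \<leftarrow> comul H h'\<rangle>.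
      chain_cons (cm (ac h1 x) (ac h2 y)) (dact h3 c))"
proof -
  have "dact h (chain_cons (cm x y) c) = (\<Sum>\<langle>h' \<otimes> h3 \<leftarrow> comul H h\<rangle>. \<Sum>\<langle>h1 \<otimes> h2 \<leftarrow> comul H h'\<rangle>.
      chain_cons (cm (ac h1 x) (ac h2 y)) (dact h3 c))"
    unfolding dact_cons by (subst ac_cm) (intro lin_rules, simp)
  also have "\<dots> = (\<Sum>\<langle>h1 \<otimes> h' \<leftarrow> comul H h\<rangle>. \<Sum>\<langle>h2 \<otimes> h3 \<leftarrow> comul H h'\<rangle>.
      chain_cons (cm (ac h1 x) (ac h2 y)) (dact h3 c))"
    by (rule sweedler_coassoc) (intro lin_rules)+
  finally show ?thesis .
qed

text \<open>Two neighbouring Sweedler factors acting on f^i and f^(i+1) become one factor acting on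
  the composite, by the compatibility of action and composition.\<close>

lemma dact_faces: "dact h (faces c) = faces (dact h c)"
proof (rule chain_ext[where c=c])
  fix as
  show "dact h (faces (pure as)) = faces (dact h (pure as))"
  proof (induction as arbitrary: h rule: faces_list.induct)
    case 1
    show ?case by (simp add: dact_Nil lin_simps clinear_0[OF clinear_dact])
  next
    case (2 x)
    have "faces (chain_cons (ac h1 x) (dact h2 (pure []))) = 0" for h1 h2
      by (simp add: dact_Nil lin_simps chain_cons_pure)
    then show ?case
      by (simp add: clinear_0[OF clinear_dact])
        (simp add: pure_Cons dact_cons, subst sweedler_apply[OF clinear_faces], intro lin_rules,
            simp add: sweedler_zero)
  next
    case (3 x y as)
    have "faces (dact h (pure (x # y # as))) =
      (\<Sum>\<langle>h1 \<otimes> h' \<leftarrow> comul H h\<rangle>. \<Sum>\<langle>h2 \<otimes> h3 \<leftarrow> comul H h'\<rangle>.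
         chain_cons (cm (ac h1 x) (ac h2 y)) (dact h3 (pure as))
         - chain_cons (ac h1 x) (faces (chain_cons (ac h2 y) (dact h3 (pure as)))))"
      unfolding pure_Cons dact_cons[of _ x] dact_cons[of _ y]
      by (subst sweedler_apply[OF clinear_chain_cons], intro lin_rules,
          subst sweedler_apply[OF clinear_faces], intro lin_rules,
          subst sweedler_apply[OF clinear_faces], intro lin_rules) (simp add: faces_cons2)
    also have "\<dots> = (\<Sum>\<langle>h1 \<otimes> h' \<leftarrow> comul H h\<rangle>. (\<Sum>\<langle>h2 \<otimes> h3 \<leftarrow> comul H h'\<rangle>.
         chain_cons (cm (ac h1 x) (ac h2 y)) (dact h3 (pure as)))
         - chain_cons (ac h1 x) (faces (dact h' (pure (y # as)))))"
      unfolding pure_Cons dact_cons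
      by (subst sweedler_diff, intro lin_rules, intro lin_rules,
          subst sweedler_apply[OF clinear_comp[OF clinear_chain_cons clinear_faces], symmetric],
          intro lin_rules, simp)
    also have "\<dots> = (\<Sum>\<langle>h1 \<otimes> h' \<leftarrow> comul H h\<rangle>. (\<Sum>\<langle>h2 \<otimes> h3 \<leftarrow> comul H h'\<rangle>.
         chain_cons (cm (ac h1 x) (ac h2 y)) (dact h3 (pure as)))
         - chain_cons (ac h1 x) (dact h' (faces (pure (y # as)))))"
      by (simp add: 3)
    also have "\<dots> = (\<Sum>\<langle>h1 \<otimes> h' \<leftarrow> comul H h\<rangle>. (\<Sum>\<langle>h2 \<otimes> h3 \<leftarrow> comul H h'\<rangle>.
         chain_cons (cm (ac h1 x) (ac h2 y)) (dact h3 (pure as))))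
         - (\<Sum>\<langle>h1 \<otimes> h' \<leftarrow> comul H h\<rangle>. chain_cons (ac h1 x) (dact h' (faces (pure (y # as)))))"
      by (rule sweedler_diff) (intro lin_rules)+
    also have "\<dots> = dact h (faces (pure (x # y # as)))"
      by (simp add: faces_Cons2 clinear_diff[OF clinear_dact] dact_cons2 dact_cons[of _ x])
    finally show ?case ..
  qed
qed (intro lin_rules)+

lemma wrap_snoc_faces:
  "wrap h (chain_snoc z (faces (pure (x # ys)))) = faces (pure (cm (ac h z) x # ys))"
  by (cases ys) (simp_all add: faces_Cons2 lin_simps chain_snoc_cons wrap_cons_snoc cm_assoc)

text \<open>The bar differential squares to zero. Only the first three entries have to be compared,
  by associativity; the rest is the same statement for the tail.\<close>

lemma faces_faces: "faces (faces c) = 0"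
proof (rule chain_ext[where c=c])
  fix as
  show "faces (faces (pure as)) = 0"
  proof (induction as rule: faces_list.induct)
    case (3 x y as)
    show ?case
    proof (cases as)
      case Nil
      then show ?thesis by (simp add: faces_Cons2 lin_simps chain_cons_pure)
    next
      case (Cons z zs)
      let ?F = "faces (pure (z # zs))"
      have "faces (faces (pure (y # z # zs))) = 0" using 3 Cons by simp
      then have e: "faces (chain_cons (cm y z) (pure zs)) = faces (chain_cons y ?F)"
        by (simp add: faces_Cons2 lin_simps)
      have "faces (chain_cons (cm x y) (pure (z # zs))) =
          chain_cons (cm (cm x y) z) (pure zs) - chain_cons (cm x y) ?F"
        by (simp add: pure_Cons faces_cons2)
      then show ?thesis
        by (simp add: Cons faces_Cons2[of x] faces_Cons2[of y] lin_simps faces_cons2 cm_assoc e)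
    qed
  qed (simp_all add: lin_simps)
qed (intro lin_rules clin_faces)+

end

section \<open>Cyclic strings and cochains\<close>

lemma length_Suc_Suc_E:
  assumes "length as = Suc (Suc n)"
  obtains bs y z where "as = bs @ [y, z]" "length bs = n"
proof (cases as rule: rev_cases)
  case (snoc as' z)
  then show ?thesis
    by (cases as' rule: rev_cases) (use assms that in auto)
qed (use assms in simp)

locale hom_family =
  fixes obj :: "'o set" and hom :: "'o \<Rightarrow> 'o \<Rightarrow> 'f::complex_vector set"
begin

text \<open>Lists are read in the order of composition, f^0 being applied last: \<open>Y\<close> is
  the target of the first entry and \<open>X\<close> the source of the last.\<close>

fun is_path :: "'o \<Rightarrow> ('o, 'f) arrow list \<Rightarrow> 'o \<Rightarrow> bool" where
  "is_path Y [] X \<longleftrightarrow> Y = X"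
| "is_path Y (x # as) X \<longleftrightarrow> tgt x = Y \<and> src x \<in> obj \<and> tgt x \<in> obj \<and> snd (snd x) \<in> hom (src x) (tgt x)
    \<and> is_path (src x) as X"

abbreviation is_arrow :: "('o, 'f) arrow \<Rightarrow> bool" where
  "is_arrow x \<equiv> src x \<in> obj \<and> tgt x \<in> obj \<and> snd (snd x) \<in> hom (src x) (tgt x)"

lemma path_append: "is_path Y (as @ bs) X \<longleftrightarrow> (\<exists>Z. is_path Y as Z \<and> is_path Z bs X)"
  by (induction as arbitrary: Y) auto

lemma path_linked: "is_path Y as X \<Longrightarrow> linked as"
  by (induction as arbitrary: Y rule: linked.induct) auto

definition path_span :: "nat \<Rightarrow> 'o \<Rightarrow> 'o \<Rightarrow> ('o, 'f) chain set" where
  "path_span n Y X = cvec.span (pure ` {as. length as = n \<and> is_path Y as X})"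

lemma path_span_pure: "is_path Y as X \<Longrightarrow> length as = n \<Longrightarrow> pure as \<in> path_span n Y X"
  unfolding path_span_def by (rule cvec.span_base) auto

lemma subspace_path_span: "cvec.subspace (path_span n Y X)"
  unfolding path_span_def by (rule cvec.subspace_span)

lemma path_span_cons:
  assumes "is_arrow x" "c \<in> path_span n (src x) X"
  shows "chain_cons x c \<in> path_span (Suc n) (tgt x) X"
  unfolding path_span_def
  by (rule clinear_span_image[OF clinear_chain_cons _ assms(2)[unfolded path_span_def]])
    (use assms(1) in \<open>auto intro!: cvec.span_base simp: chain_cons_pure\<close>)

definition cyc :: "nat \<Rightarrow> ('o, 'f) arrow list set" where
  "cyc n = {as. length as = Suc n \<and> (\<exists>X. is_path X as X)}"

definition cyc_span :: "nat \<Rightarrow> ('o, 'f) chain set" where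
  "cyc_span n = cvec.span (pure ` cyc n)"

lemma cyc_span_pure: "as \<in> cyc n \<Longrightarrow> pure as \<in> cyc_span n"
  unfolding cyc_span_def by (rule cvec.span_base) auto

lemma subspace_cyc_span: "cvec.subspace (cyc_span n)"
  unfolding cyc_span_def by (rule cvec.subspace_span)

lemma path_span_cyc: "c \<in> path_span (Suc n) X X \<Longrightarrow> c \<in> cyc_span n"
  unfolding path_span_def cyc_span_def
  by (erule set_mp[OF cvec.span_mono, rotated]) (auto simp: cyc_def)

lemma cyc_span_image:
  assumes "clinear f" "\<And>as. as \<in> cyc n \<Longrightarrow> f (pure as) \<in> V" "cvec.subspace V" "c \<in> cyc_span n"
  shows "f c \<in> V"
proof -
  have "f c \<in> cvec.span V"
    by (rule clinear_span_image[OF assms(1) _ assms(4)[unfolded cyc_span_def]])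
      (use assms(2) in \<open>auto intro: cvec.span_base\<close>)
  then show ?thesis using cvec.span_minimal[OF order_refl assms(3)] by blast
qed

lemma cyc_span_eq:
  assumes "clinear f" "clinear g" "\<And>as. as \<in> cyc n \<Longrightarrow> f (pure as) = g (pure as)" "c \<in> cyc_span n"
  shows "f c = g c"
  by (rule clinear_eq_on_span[OF assms(1,2) _ assms(4)[unfolded cyc_span_def]]) (use assms(3)
      in auto)

lemma cyc_cases:
  assumes "as \<in> cyc n"
  obtains X bs z where "as = bs @ [z]" "length bs = n" "is_path X as X" "src z = X" "is_arrow z"
    "is_path X bs (tgt z)"
  using assms by (cases as rule: rev_cases) (auto simp: cyc_def path_append)

lemma cyc_Suc_cases:
  assumes "as \<in> cyc (Suc n)"
  obtains x bs z where "as = x # bs @ [z]" "length bs = n" "is_path (tgt x) as (tgt x)"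
    "is_arrow x" "is_arrow z" "src z = tgt x" "is_path (src x) bs (tgt z)"
proof -
  from assms obtain X bs' z where 1: "as = bs' @ [z]" "length bs' =
      Suc n" "is_path X as X" "src z = X" "is_arrow z"
    "is_path X bs' (tgt z)" by (rule cyc_cases)
  then obtain x bs where bs': "bs' = x # bs" by (cases bs') auto
  have "X = tgt x" using 1(3) unfolding 1(1) bs' by simp
  with 1 show ?thesis unfolding bs' by (intro that[of x bs z]) simp_all
qed

end

locale hom_ops = bilinear_ops cmp act + hom_family obj hom
  for cmp :: "'o \<Rightarrow> 'o \<Rightarrow> 'o \<Rightarrow> 'f::complex_vector \<Rightarrow> 'f \<Rightarrow> 'f"
    and act :: "'o \<Rightarrow> 'o \<Rightarrow> 'h::complex_algebra_1 \<Rightarrow> 'f \<Rightarrow> 'f"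
    and obj :: "'o set" and hom :: "'o \<Rightarrow> 'o \<Rightarrow> 'f set" +
  assumes cmp_closed: "\<lbrakk>X \<in> obj; Y \<in> obj; Z \<in> obj; f \<in> hom X Y; f' \<in> hom Y Z\<rbrakk> \<Longrightarrow>
      cmp X Y Z f' f \<in> hom X Z"
    and act_closed: "\<lbrakk>X \<in> obj; Y \<in> obj; f \<in> hom X Y\<rbrakk> \<Longrightarrow> act X Y h f \<in> hom X Y"
begin

lemma is_arrow_cm: "is_arrow x \<Longrightarrow> is_arrow y \<Longrightarrow> src x = tgt y \<Longrightarrow> is_arrow (cm x y)"
  by (cases x; cases y) (auto intro: cmp_closed)

lemma is_arrow_ac: "is_arrow x \<Longrightarrow> is_arrow (ac h x)"
  by (cases x) (auto intro: act_closed)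

lemma faces_path: "is_path Y as X \<Longrightarrow> length as = Suc n \<Longrightarrow> faces (pure as) \<in> path_span n Y X"
proof (induction as arbitrary: Y n rule: faces_list.induct)
  case (2 x)
  then show ?case by (simp add: cvec.subspace_0[OF subspace_path_span])
next
  case (3 x y as)
  then obtain k where n: "n = Suc k" by auto
  have "chain_cons x (faces (pure (y # as))) \<in> path_span (Suc k) (tgt x) X"
    by (rule path_span_cons) (use 3 n in auto)
  moreover have "chain_cons (cm x y) (pure as) \<in> path_span (Suc k) (tgt (cm x y)) X"
    by (rule path_span_cons[OF is_arrow_cm]) (use 3 n in \<open>auto intro: path_span_pure\<close>)
  ultimately show ?case using 3(2)
    by (simp add: faces_Cons2 n cvec.subspace_diff[OF subspace_path_span])
qed simp

lemma faces_cyc: "c \<in> cyc_span (Suc n) \<Longrightarrow> faces c \<in> cyc_span n"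
  by (rule cyc_span_image[OF clinear_faces _ subspace_cyc_span])
    (auto simp: cyc_def intro: path_span_cyc faces_path)

lemma rotate_cyc: "c \<in> cyc_span n \<Longrightarrow> rotate h c \<in> cyc_span n"
proof (rule cyc_span_image[OF clinear_rotate _ subspace_cyc_span])
  fix as assume "as \<in> cyc n"
  then obtain X bs z where "as = bs @ [z]" "length bs = n" "is_path X as X" "src z = X" "is_arrow z"
    "is_path X bs (tgt z)" by (rule cyc_cases)
  then show "rotate h (pure as) \<in> cyc_span n"
    using is_arrow_ac[of z h] by (auto intro!: cyc_span_pure simp: rotate_pure_snoc cyc_def)
qed

lemma wrap_cyc: "c \<in> cyc_span (Suc n) \<Longrightarrow> wrap h c \<in> cyc_span n"
proof (rule cyc_span_image[OF clinear_wrap _ subspace_cyc_span])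
  fix as assume "as \<in> cyc (Suc n)"
  then obtain x bs z where "as = x # bs @ [z]" "length bs = n" "is_path (tgt x) as (tgt x)"
    "is_arrow x" "is_arrow z" "src z = tgt x" "is_path (src x) bs (tgt z)" by (rule cyc_Suc_cases)
  then show "wrap h (pure as) \<in> cyc_span n"
    using is_arrow_cm[OF is_arrow_ac[of z h], of x]
    by (auto intro!: cyc_span_pure simp: wrap_pure cyc_def)
qed

lemma plug_path:
  assumes "\<And>X. X \<in> obj \<Longrightarrow> K X \<in> hom X X"
  shows "is_path Y as X \<Longrightarrow> length as = n \<Longrightarrow> plug K (pure as) \<in> path_span (Suc n) Y X"
proof (induction as arbitrary: Y n)
  case Nil
  then show ?case by (simp add: cvec.subspace_0[OF subspace_path_span])
next
  case (Cons x as)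
  then obtain k where n: "n = Suc k" by auto
  have "chain_cons (at_ob K (src x)) (pure as) \<in> path_span (Suc k) (tgt (at_ob K (src x))) X"
    by (rule path_span_cons) (use Cons n assms in \<open>auto intro: path_span_pure\<close>)
  then have "chain_cons x (chain_cons (at_ob K (src x)) (pure as)) \<in> path_span (Suc (Suc k)) (tgt
      x) X"
    by (intro path_span_cons) (use Cons in auto)
  moreover have "chain_cons x (plug K (pure as)) \<in> path_span (Suc (Suc k)) (tgt x) X"
    by (rule path_span_cons) (use Cons n in auto)
  ultimately show ?case using Cons(2)
    by (simp add: pure_Cons plug_cons n cvec.subspace_diff[OF subspace_path_span])
qed

end

locale hom_hopf = hopf_ops H cmp act + hom_ops cmp act obj hom
  for H :: "'h::complex_algebra_1 hopf"
    and cmp :: "'o \<Rightarrow> 'o \<Rightarrow> 'o \<Rightarrow> 'f::complex_vector \<Rightarrow> 'f \<Rightarrow> 'f"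
    and act :: "'o \<Rightarrow> 'o \<Rightarrow> 'h \<Rightarrow> 'f \<Rightarrow> 'f"
    and obj :: "'o set" and hom :: "'o \<Rightarrow> 'o \<Rightarrow> 'f set"
begin

lemma dact_path: "is_path Y as X \<Longrightarrow> length as = n \<Longrightarrow> dact h (pure as) \<in> path_span n Y X"
proof (induction as arbitrary: Y n h)
  case Nil
  then show ?case by (auto simp: dact_Nil intro!: cvec.subspace_scale[OF subspace_path_span]
      path_span_pure)
next
  case (Cons x as)
  then obtain k where n: "n = Suc k" by auto
  have "chain_cons (ac h1 x) (dact h2 (pure as)) \<in> path_span n Y X" for h1 h2
  proof -
    have "chain_cons (ac h1 x) (dact h2 (pure as)) \<in> path_span (Suc k) (tgt (ac h1 x)) X"
      by (rule path_span_cons[OF is_arrow_ac]) (use Cons n in auto)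
    then show ?thesis using Cons n by simp
  qed
  then show ?case
    unfolding pure_Cons dact_cons
    by (intro sweedler_in_subspace[OF _ subspace_path_span]) (intro lin_rules, simp)
qed

lemma dact_cyc: "c \<in> cyc_span n \<Longrightarrow> dact h c \<in> cyc_span n"
  by (rule cyc_span_image[OF clinear_dact _ subspace_cyc_span])
    (auto simp: cyc_def intro: path_span_cyc dact_path)

end

section \<open>Curried cochains and the coboundary\<close>

locale cochain_ops = hopf_sayd H M + bilinear_ops cmp act
  for H :: "'h::complex_algebra_1 hopf" and M :: "('m::complex_vector, 'h) hopf_mod"
    and cmp :: "'o \<Rightarrow> 'o \<Rightarrow> 'o \<Rightarrow> 'f::complex_vector \<Rightarrow> 'f \<Rightarrow> 'f"
    and act :: "'o \<Rightarrow> 'o \<Rightarrow> 'h \<Rightarrow> 'f \<Rightarrow> 'f"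
begin

sublocale hopf_ops H cmp act ..

text \<open>For a curried \<open>n\<close>-cochain \<open>\<Phi>\<close>, \<open>rot \<Phi>\<close> is \<open>\<tau>\<^sub>n \<Phi>\<close>, \<open>last_face \<Phi>\<close> is \<open>\<delta>\<^bsub>n+1\<^esub> \<Phi>\<close> and
  \<open>cob n \<Phi>\<close> is \<open>b \<Phi>\<close>.\<close>

definition rot :: "('m \<Rightarrow> ('o, 'f) chain \<Rightarrow> complex) \<Rightarrow> 'm \<Rightarrow> ('o, 'f) chain \<Rightarrow> complex" where
  "rot \<Phi> m c = (\<Sum>\<langle>a \<otimes> m' \<leftarrow> coact M m\<rangle>. \<Phi> m' (rotate (S_inv H a) c))"

definition last_face :: "('m \<Rightarrow> ('o, 'f) chain \<Rightarrow> complex) \<Rightarrow> 'm \<Rightarrow> ('o, 'f) chain \<Rightarrow> complex" where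
  "last_face \<Phi> m c = (\<Sum>\<langle>a \<otimes> m' \<leftarrow> coact M m\<rangle>. \<Phi> m' (wrap (S_inv H a) c))"

definition cob :: "nat \<Rightarrow> ('m \<Rightarrow> ('o, 'f) chain \<Rightarrow> complex) \<Rightarrow> 'm \<Rightarrow> ('o, 'f) chain \<Rightarrow> complex" where
  "cob n \<Phi> m c = \<Phi> m (faces c) + (-1) ^ Suc n * last_face \<Phi> m c"

lemmas lin_rules_M = lin_rules clin_sayd

context
  fixes \<Phi> :: "'m \<Rightarrow> ('o, 'f) chain \<Rightarrow> complex"
  assumes bilin_\<Phi>: "bilin \<Phi>"
begin

lemmas clin_\<Phi> = bilin_left[OF bilin_\<Phi>] bilin_right[OF bilin_\<Phi>]

lemma bilin_rot: "bilin (rot \<Phi>)"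
  unfolding rot_def[abs_def] by (intro lin_rules_M clin_\<Phi>)

lemma bilin_last_face: "bilin (last_face \<Phi>)"
  unfolding last_face_def[abs_def] by (intro lin_rules_M clin_\<Phi>)

lemma bilin_cob: "bilin (cob n \<Phi>)"
  unfolding cob_def[abs_def]
  by (intro lin_rules_M clin_\<Phi> bilin_left[OF bilin_last_face] bilin_right[OF bilin_last_face])

end

end

locale cyclic_complex = cochain_ops H M cmp act + hcat_ops H cmp act + hom_ops cmp act obj hom
  for H :: "'h::complex_algebra_1 hopf" and M :: "('m::complex_vector, 'h) hopf_mod"
    and cmp :: "'o \<Rightarrow> 'o \<Rightarrow> 'o \<Rightarrow> 'f::complex_vector \<Rightarrow> 'f \<Rightarrow> 'f"
    and act :: "'o \<Rightarrow> 'o \<Rightarrow> 'h \<Rightarrow> 'f \<Rightarrow> 'f"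
    and obj :: "'o set" and hom :: "'o \<Rightarrow> 'o \<Rightarrow> 'f set"
begin

sublocale hom_hopf H cmp act obj hom ..

text \<open>The cochain condition in balanced form, with h moved from M to the chain. The
  equivalence with the form that involves the antipode is \<open>cut_in_cochains\<close>.\<close>

definition invariant :: "nat \<Rightarrow> ('m \<Rightarrow> ('o, 'f) chain \<Rightarrow> complex) \<Rightarrow> bool" where
  "invariant n \<Phi> \<longleftrightarrow> (\<forall>m h. \<forall>c\<in>cyc_span n. \<Phi> (ract M m h) c = \<Phi> m (dact h c))"

text \<open>The equation (1 - \<lambda>) \<Phi> = 0 solved for \<tau>; the sign (-1)^n is its own
  inverse.\<close>

definition is_cyclic :: "nat \<Rightarrow> ('m \<Rightarrow> ('o, 'f) chain \<Rightarrow> complex) \<Rightarrow> bool" where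
  "is_cyclic n \<Phi> \<longleftrightarrow> (\<forall>m. \<forall>c\<in>cyc_span n. rot \<Phi> m c = (-1) ^ n * \<Phi> m c)"

context
  fixes \<Phi> :: "'m \<Rightarrow> ('o, 'f) chain \<Rightarrow> complex"
  assumes bil: "bilin \<Phi>"
begin

lemmas lin_rules_arg = lin_rules_M bilin_left[OF bil] bilin_right[OF bil]

lemmas \<Phi>_simps = clinear_add[OF bilin_right[OF bil clinear_id]] clinear_diff[OF bilin_right[OF bil
    clinear_id]]
  clinear_scale[OF bilin_right[OF bil clinear_id]] clinear_0[OF bilin_right[OF bil clinear_id]]

text \<open>By the anti-Yetter-Drinfeld condition the wrapped arrow \<open>z\<close> receives
  S^-1(h_1) S^-1(a) h_3, while h_2 acts on the module. Invariance of \<Phi> moves h_2 to the wrapped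
  chain, where its first part hits \<open>z\<close> and cancels S^-1(h_1). What is left of h acts on
  the remaining arrows and then, innermost, on \<open>z\<close>: this is the diagonal action before
  wrapping.\<close>

lemma last_face_invariant:
  assumes inv: "invariant n \<Phi>" and c: "c \<in> cyc_span (Suc n)"
  shows "last_face \<Phi> (ract M m h) c = last_face \<Phi> m (dact h c)"
proof (rule cyc_span_eq[OF _ _ _ c])
  note lf = bilin_right[OF bilin_last_face[OF bil]]
  show "clinear (last_face \<Phi> (ract M m h))" "clinear (\<lambda>c. last_face \<Phi> m (dact h c))"
    by (intro lf lin_rules_M)+
  fix as assume as: "as \<in> cyc (Suc n)"
  then obtain x bs z where xz: "as = x # bs @ [z]" and *: "length bs =
      n" "is_path (tgt x) as (tgt x)"
    "is_arrow x" "is_arrow z" "src z = tgt x" "is_path (src x) bs (tgt z)" by (rule cyc_Suc_cases)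
  let ?p = "pure (x # bs)"
  \<comment> \<open>\<open>G v k\<close> composes \<open>v\<close> with the first arrow after
    \<open>k\<close> has acted on all arrows except \<open>z\<close>. It separates what acts on
    \<open>z\<close> from what acts on the rest.\<close>
  define G where "G v k = face0 (chain_cons v (dact k ?p))" for v k
  have pas: "pure as = chain_snoc z ?p" "pure as = chain_cons x (chain_snoc z (pure bs))"
    by (simp_all add: xz chain_cons_pure chain_snoc_pure)
  have G: "G v k = (\<Sum>\<langle>s \<otimes> q \<leftarrow> comul H k\<rangle>. chain_cons (cm v (ac s x)) (dact q (pure bs)))" for v k
    unfolding G_def pure_Cons dact_cons
    by (subst sweedler_apply[OF clinear_comp[OF clinear_face0 clinear_chain_cons]])
      (intro lin_rules_M, simp add: face0_cons2)
  have linG: "clinear (\<lambda>y. G v (g y))" if "clinear g" for g :: "'x::complex_vector \<Rightarrow> 'h" and v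
    unfolding G_def by (intro lin_rules_M that)
  have alinG: "clinear (\<lambda>y. G (u y) k)" if "alin u" for u :: "'x::complex_vector \<Rightarrow> _" and k
    unfolding G_def by (intro lin_rules_M that)
  have dw: "dact k (wrap g (pure as)) = (\<Sum>\<langle>r \<otimes> q \<leftarrow> comul H k\<rangle>. G (ac r (ac g z)) q)" for k g
    unfolding pas(2) wrap_cons_snoc dact_cons2 G ..
  have wc: "wrap k (pure as) \<in> cyc_span n" for k
    by (intro wrap_cyc cyc_span_pure as)
  note N = lin_rules_arg linG alinG
  have "last_face \<Phi> (ract M m h) (pure as) =
    (\<Sum>\<langle>h1 \<otimes> h' \<leftarrow> comul H h\<rangle>. \<Sum>\<langle>h2 \<otimes> h3 \<leftarrow> comul H h'\<rangle>. \<Sum>\<langle>a \<otimes> n \<leftarrow> coact M m\<rangle>.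
      \<Phi> (ract M n h2) (wrap (S_inv H h1 * (S_inv H a * h3)) (pure as)))"
    unfolding last_face_def
    by (rule sweedler_coact_ract[where \<beta>="\<lambda>k n. \<Phi> n (wrap k (pure as))"]) (intro lin_rules_arg)
  also have "\<dots> = (\<Sum>\<langle>h1 \<otimes> h' \<leftarrow> comul H h\<rangle>. \<Sum>\<langle>h2 \<otimes> h3 \<leftarrow> comul H h'\<rangle>. \<Sum>\<langle>a \<otimes> n \<leftarrow> coact M m\<rangle>.
      \<Sum>\<langle>r \<otimes> q \<leftarrow> comul H h2\<rangle>. \<Phi> n (G (ac (r * S_inv H h1) (ac (S_inv H a * h3) z)) q))"
    using inv wc
    by (simp add: invariant_def dw ac_mult sweedler_apply[OF bilin_right[OF bil clinear_id]] N)
  also have "\<dots> = (\<Sum>\<langle>h1 \<otimes> h' \<leftarrow> comul H h\<rangle>. \<Sum>\<langle>h2 \<otimes> h3 \<leftarrow> comul H h'\<rangle>. \<Sum>\<langle>r \<otimes> q \<leftarrow> comul H h2\<rangle>.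
      \<Sum>\<langle>a \<otimes> n \<leftarrow> coact M m\<rangle>. \<Phi> n (G (ac (r * S_inv H h1) (ac (S_inv H a * h3) z)) q))"
    by (subst sweedler_swap) (intro N, intro N, simp)
  also have "\<dots> = (\<Sum>\<langle>h1 \<otimes> h' \<leftarrow> comul H h\<rangle>. \<Sum>\<langle>r \<otimes> h'' \<leftarrow> comul H h'\<rangle>. \<Sum>\<langle>q \<otimes> h3 \<leftarrow> comul H h''\<rangle>.
      \<Sum>\<langle>a \<otimes> n \<leftarrow> coact M m\<rangle>. \<Phi> n (G (ac (r * S_inv H h1) (ac (S_inv H a * h3) z)) q))"
    by (subst sweedler_coassoc) (intro N, intro N, intro N, simp)
  also have "\<dots> = (\<Sum>\<langle>k \<otimes> h'' \<leftarrow> comul H h\<rangle>. \<Sum>\<langle>h1 \<otimes> r \<leftarrow> comul H k\<rangle>. \<Sum>\<langle>q \<otimes> h3 \<leftarrow> comul H h''\<rangle>.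
      \<Sum>\<langle>a \<otimes> n \<leftarrow> coact M m\<rangle>. \<Phi> n (G (ac (r * S_inv H h1) (ac (S_inv H a * h3) z)) q))"
    by (rule sweedler_coassoc[symmetric]) (intro N)+
  \<comment> \<open>The cancellation r S^-1(h_1) = 1, available once coassociativity has made h_1
    and r the two parts of one element k.\<close>
  also have "\<dots> = (\<Sum>\<langle>k \<otimes> h'' \<leftarrow> comul H h\<rangle>. counit H k *\<^sub>C (\<Sum>\<langle>q \<otimes> h3 \<leftarrow> comul H h''\<rangle>.
      \<Sum>\<langle>a \<otimes> n \<leftarrow> coact M m\<rangle>. \<Phi> n (G (ac 1 (ac (S_inv H a * h3) z)) q)))"
    by (subst sweedler_S_inv_right[where g="\<lambda>y. \<Sum>\<langle>q \<otimes> h3 \<leftarrow> comul H h''\<rangle>.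
      \<Sum>\<langle>a \<otimes> n \<leftarrow> coact M m\<rangle>. \<Phi> n (G (ac y (ac (S_inv H a * h3) z)) q)" for h'']) (intro N, simp)
  also have "\<dots> = (\<Sum>\<langle>q \<otimes> h3 \<leftarrow> comul H h\<rangle>. \<Sum>\<langle>a \<otimes> n \<leftarrow> coact M m\<rangle>.
      \<Phi> n (G (ac 1 (ac (S_inv H a * h3) z)) q))"
    by (rule sweedler_counit_left) (intro N)
  also have "\<dots> = (\<Sum>\<langle>q \<otimes> h3 \<leftarrow> comul H h\<rangle>. \<Sum>\<langle>a \<otimes> n \<leftarrow> coact M m\<rangle>.
      \<Phi> n (wrap (S_inv H a) (chain_snoc (ac h3 z) (dact q ?p))))"
    by (simp add: ac_mult[symmetric] wrap_def rotate_snoc G_def)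
  also have "\<dots> = (\<Sum>\<langle>a \<otimes> n \<leftarrow> coact M m\<rangle>. \<Sum>\<langle>q \<otimes> h3 \<leftarrow> comul H h\<rangle>.
      \<Phi> n (wrap (S_inv H a) (chain_snoc (ac h3 z) (dact q ?p))))"
    by (rule sweedler_swap) (intro N)+
  also have "\<dots> = last_face \<Phi> m (dact h (pure as))"
    unfolding last_face_def pas(1) dact_snoc
    by (subst sweedler_apply[OF clinear_wrap], intro lin_rules_arg,
        subst sweedler_apply[OF bilin_right[OF bil clinear_id]])
      (intro lin_rules_arg, simp)
  finally show "last_face \<Phi> (ract M m h) (pure as) = last_face \<Phi> m (dact h (pure as))" .
qed

lemma cob_invariant: "invariant n \<Phi> \<Longrightarrow> invariant (Suc n) (cob n \<Phi>)"
  unfolding invariant_def[of "Suc n"] cob_def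
  by (auto simp: last_face_invariant dact_faces[symmetric] invariant_def faces_cyc)

lemma sign_mult: "(-1) ^ n *\<^sub>C x = (-1) ^ n * (x::complex)"
  by (simp add: scaleC_complex_def)

text \<open>Acting on a composite splits S^-1(a) into two factors; anti-comultiplicativity of S^-1
  and coassociativity of the coaction turn them into two successive coactions.\<close>

lemma last_composition:
  "(\<Sum>\<langle>a \<otimes> m' \<leftarrow> coact M m\<rangle>. \<Phi> m' (chain_cons (ac (S_inv H a) (cm y z)) c)) =
   (\<Sum>\<langle>a \<otimes> m' \<leftarrow> coact M m\<rangle>. \<Sum>\<langle>a' \<otimes> m'' \<leftarrow> coact M m'\<rangle>.
     \<Phi> m'' (chain_cons (cm (ac (S_inv H a') y) (ac (S_inv H a) z)) c))"
proof -
  have "(\<Sum>\<langle>a \<otimes> m' \<leftarrow> coact M m\<rangle>. \<Phi> m' (chain_cons (ac (S_inv H a) (cm y z)) c)) =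
    (\<Sum>\<langle>a \<otimes> m' \<leftarrow> coact M m\<rangle>. \<Sum>\<langle>h1 \<otimes> h2 \<leftarrow> comul H (S_inv H a)\<rangle>.
      \<Phi> m' (chain_cons (cm (ac h1 y) (ac h2 z)) c))"
    by (subst ac_cm[where F="\<lambda>x. \<Phi> m' (chain_cons x c)" for m']) (intro lin_rules_arg, simp)
  also have "\<dots> = (\<Sum>\<langle>a \<otimes> m' \<leftarrow> coact M m\<rangle>. \<Sum>\<langle>a' \<otimes> m'' \<leftarrow> coact M m'\<rangle>.
     \<Phi> m'' (chain_cons (cm (ac (S_inv H a') y) (ac (S_inv H a) z)) c))"
    by (rule sweedler_coact_S_inv) (intro lin_rules_arg)+
  finally show ?thesis .
qed

text \<open>Rotation exchanges the wrapped face with the face of index 0 and shifts the other inner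
  faces. The composite of the last two arrows appears twice, once acted on as a whole and once
  factor by factor; by \<open>last_composition\<close> these agree, and their signs are opposite.
  What remains is governed by the cyclicity of \<Phi> itself.\<close>

lemma cob_is_cyclic:
  assumes cyc: "is_cyclic n \<Phi>"
  shows "is_cyclic (Suc n) (cob n \<Phi>)"
  unfolding is_cyclic_def
proof (intro allI ballI)
  fix m c assume c: "c \<in> cyc_span (Suc n)"
  note rt = bilin_right[OF bilin_rot[OF bilin_cob[OF bil]] clinear_id]
  note cb = bilin_right[OF bilin_cob[OF bil] clinear_id]
  show "rot (cob n \<Phi>) m c = (-1) ^ Suc n * cob n \<Phi> m c"
  proof (rule cyc_span_eq[OF rt _ _ c])
    show "clinear (\<lambda>c. (-1) ^ Suc n * cob n \<Phi> m c)" by (intro clinear_cmult cb)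
    fix as assume as: "as \<in> cyc (Suc n)"
    then have "length as = Suc (Suc n)" by (simp add: cyc_def)
    then obtain bs y z where yz: "as = bs @ [y, z]" and n: "length bs = n"
      by (rule length_Suc_Suc_E)
    have p: "pure as = chain_snoc z (pure (bs @ [y]))"
      by (simp add: yz chain_snoc_pure)
    let ?F = "faces (pure (bs @ [y]))"
    have f1: "faces (rotate k (pure as)) = wrap k (pure as) - chain_cons (ac k z) ?F" for k
      unfolding p rotate_snoc wrap_def
        by (cases bs) (simp_all add: pure_Cons faces_cons2 face0_cons2)
    have f2: "chain_cons (ac k z) ?F = rotate k (faces (pure as)) - (-1) ^ n *\<^sub>C chain_cons (ac k
        (cm y z)) (pure bs)" for k
      by (simp add: yz faces_snoc2 n lin_simps rotate_snoc rotate_pure_snoc pure_Cons)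
    have w: "wrap k' (rotate k (pure as)) = chain_cons (cm (ac k' y) (ac k z)) (pure bs)" for k k'
      unfolding p rotate_snoc by (simp add: wrap_cons_snoc chain_snoc_pure[symmetric])
    have "rot (cob n \<Phi>) m (pure as) =
      (\<Sum>\<langle>a \<otimes> m' \<leftarrow> coact M m\<rangle>. ((\<Phi> m' (wrap (S_inv H a) (pure as))
          + (-1) * \<Phi> m' (rotate (S_inv H a) (faces (pure as))))
        + (-1) ^ n * \<Phi> m' (chain_cons (ac (S_inv H a) (cm y z)) (pure bs)))
        + (-1) ^ Suc n * (\<Sum>\<langle>a' \<otimes> m'' \<leftarrow> coact M m'\<rangle>.
             \<Phi> m'' (chain_cons (cm (ac (S_inv H a') y) (ac (S_inv H a) z)) (pure bs))))"
      unfolding rot_def cob_def last_face_def f1 f2 w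
      by (simp add: \<Phi>_simps sign_mult algebra_simps)
    also have "\<dots> = last_face \<Phi> m (pure as) + (-1) * rot \<Phi> m (faces (pure as))
        + (-1) ^ n * (\<Sum>\<langle>a \<otimes> m' \<leftarrow> coact M m\<rangle>. \<Phi> m' (chain_cons (ac (S_inv H a) (cm y z)) (pure bs)))
        + (-1) ^ Suc n * (\<Sum>\<langle>a \<otimes> m' \<leftarrow> coact M m\<rangle>. \<Sum>\<langle>a' \<otimes> m'' \<leftarrow> coact M m'\<rangle>.
             \<Phi> m'' (chain_cons (cm (ac (S_inv H a') y) (ac (S_inv H a) z)) (pure bs)))"
      unfolding rot_def last_face_def
      by (subst sweedler_lincomb, intro lin_rules_arg, intro lin_rules_arg,
          subst sweedler_lincomb, intro lin_rules_arg, intro lin_rules_arg,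
          subst sweedler_lincomb, intro lin_rules_arg, intro lin_rules_arg, rule refl)
    also have "\<dots> = last_face \<Phi> m (pure as) - rot \<Phi> m (faces (pure as))"
      by (simp add: last_composition)
    also have "rot \<Phi> m (faces (pure as)) = (-1) ^ n * \<Phi> m (faces (pure as))"
      using cyc faces_cyc[OF cyc_span_pure[OF as]] by (simp add: is_cyclic_def)
    also have "last_face \<Phi> m (pure as) - (-1) ^ n * \<Phi> m (faces (pure as)) =
        (-1) ^ Suc n * cob n \<Phi> m (pure as)"
      by (simp add: cob_def algebra_simps flip: power_add mult_2)
    finally show "rot (cob n \<Phi>) m (pure as) = (-1) ^ Suc n * cob n \<Phi> m (pure as)" .
  qed
qed

text \<open>The inner part vanishes by \<open>faces_faces\<close>. The wrapped face of the
  coboundary (\<open>cl\<close>) and the wrapped face after an inner one (\<open>lf\<close>) have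
  the same value and enter with opposite signs; in both, the double wrap accounts for the composite
  of the last two arrows.\<close>

lemma cob_cob:
  assumes c: "c \<in> cyc_span (Suc (Suc n))"
  shows "cob (Suc n) (cob n \<Phi>) m c = 0"
proof (rule cyc_span_eq[OF bilin_right[OF bilin_cob[OF bilin_cob[OF bil]] clinear_id] clinear_zero
    _ c])
  fix as assume "as \<in> cyc (Suc (Suc n))"
  then have "length as = Suc (Suc (Suc n))" by (simp add: cyc_def)
  then obtain as' y z where as': "as = as' @ [y, z]" "length as' = Suc n"
    by (rule length_Suc_Suc_E)
  then obtain x bs where yz: "as = x # bs @ [y, z]" and n: "length bs = n"
    by (cases as') auto
  have p: "pure as = chain_cons x (chain_snoc z (pure (bs @ [y])))"
    by (simp add: yz chain_snoc_pure chain_cons_pure)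
  have f: "faces (pure as) = chain_snoc z (faces (pure (x # bs @ [y]))) +
      (-1) ^ Suc n *\<^sub>C pure (x # bs @ [cm y z])"
    using faces_snoc2[of "x # bs" y z] by (simp add: yz n)
  have w1: "wrap k (faces (pure as)) = faces (wrap k (pure as)) +
      (-1) ^ Suc n *\<^sub>C chain_cons (cm (ac k (cm y z)) x) (pure bs)" for k
    unfolding f by (simp add: lin_simps(21-) wrap_snoc_faces wrap_pure p wrap_cons_snoc
        chain_cons_pure)
  have w2: "wrap k' (wrap k (pure as)) = chain_cons (cm (cm (ac k' y) (ac k z)) x) (pure bs)"
    for k k'
    unfolding p wrap_cons_snoc by (simp add: wrap_cons_snoc chain_snoc_pure[symmetric] cm_assoc)
  \<comment> \<open>Wrapping \<open>y z\<close> at once agrees with wrapping \<open>z\<close> and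
    then \<open>y\<close>, by the same use of coassociativity as in
    \<open>last_composition\<close>.\<close>
  have last: "(\<Sum>\<langle>a \<otimes> m' \<leftarrow> coact M m\<rangle>. \<Phi> m' (chain_cons (cm (ac (S_inv H a) (cm y z)) x) (pure
      bs))) =
     last_face (last_face \<Phi>) m (pure as)"
  proof -
    have "(\<Sum>\<langle>a \<otimes> m' \<leftarrow> coact M m\<rangle>. \<Phi> m' (chain_cons (cm (ac (S_inv H a) (cm y z)) x) (pure bs))) =
      (\<Sum>\<langle>a \<otimes> m' \<leftarrow> coact M m\<rangle>. \<Sum>\<langle>h1 \<otimes> h2 \<leftarrow> comul H (S_inv H a)\<rangle>.
        \<Phi> m' (chain_cons (cm (cm (ac h1 y) (ac h2 z)) x) (pure bs)))"
      by (subst ac_cm[where F="\<lambda>w. \<Phi> m' (chain_cons (cm w x) (pure bs))"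
        for m']) (intro lin_rules_arg, simp)
    also have "\<dots> = (\<Sum>\<langle>a \<otimes> m' \<leftarrow> coact M m\<rangle>. \<Sum>\<langle>a' \<otimes> m'' \<leftarrow> coact M m'\<rangle>.
       \<Phi> m'' (chain_cons (cm (cm (ac (S_inv H a') y) (ac (S_inv H a) z)) x) (pure bs)))"
      by (rule sweedler_coact_S_inv) (intro lin_rules_arg)+
    finally show ?thesis by (simp add: last_face_def w2)
  qed
  have cl: "last_face (cob n \<Phi>) m (pure as) = (\<Sum>\<langle>a \<otimes> m' \<leftarrow> coact M m\<rangle>.
      \<Phi> m' (faces (wrap (S_inv H a) (pure as)))) +
      (-1) ^ Suc n * last_face (last_face \<Phi>) m (pure as)"
    unfolding last_face_def[of "cob n \<Phi>"] last_face_def[of "last_face \<Phi>"] cob_def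
    by (rule sweedler_lincomb) (intro lin_rules_arg bilin_left[OF bilin_last_face[OF bil]]
        bilin_right[OF bilin_last_face[OF bil]])+
  have lf: "last_face \<Phi> m (faces (pure as)) = (\<Sum>\<langle>a \<otimes> m' \<leftarrow> coact M m\<rangle>.
      \<Phi> m' (faces (wrap (S_inv H a) (pure as)))) +
      (-1) ^ Suc n * last_face (last_face \<Phi>) m (pure as)"
    unfolding last_face_def[of \<Phi>] w1 last[symmetric] \<Phi>_simps sign_mult
    by (rule sweedler_lincomb) (intro lin_rules_arg)+
  show "cob (Suc n) (cob n \<Phi>) m (pure as) = 0"
    unfolding cob_def[of "Suc n"] cl
    unfolding cob_def faces_faces lf by (simp add: \<Phi>_simps)
qed

end

end

section \<open>Inner derivations act trivially\<close>

context cochain_ops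
begin

context
  fixes \<theta> :: "'m \<Rightarrow> ('o, 'f) chain \<Rightarrow> complex" and K :: "'o \<Rightarrow> 'f"
  assumes bil\<theta>: "bilin \<theta>" and K: "\<And>X h. act X X h (K X) = counit H h *\<^sub>C K X"
begin

lemmas lin_rules_arg = lin_rules_M bilin_left[OF bil\<theta>] bilin_right[OF bil\<theta>]

lemmas \<theta>_simps = clinear_add[OF bilin_right[OF bil\<theta> clinear_id]] clinear_diff[OF bilin_right[OF
    bil\<theta> clinear_id]]
  clinear_scale[OF bilin_right[OF bil\<theta> clinear_id]] clinear_minus[OF bilin_right[OF bil\<theta>
      clinear_id]]

text \<open>For invariant K the action of S^-1(a) is multiplication by a counit, so the coaction
  disappears.\<close>

lemma coact_at_ob:
  assumes F: "\<And>m. clinear (\<lambda>v. F m (X, X, v))" "\<And>x. clinear (\<lambda>m. F m x)"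
  shows "(\<Sum>\<langle>a \<otimes> m' \<leftarrow> coact M m\<rangle>. F m' (ac (S_inv H a) (at_ob K X))) = F m (at_ob K X)"
proof -
  have "F m' (ac (S_inv H a) (at_ob K X)) = counit H a *\<^sub>C F m' (at_ob K X)" for a m'
    by (simp add: K counit_S_inv clinear_scale[OF F(1)])
  then show ?thesis by (simp add: sweedler_coact_counit[OF F(2)])
qed

text \<open>Cartan's formula for an inner derivation. The inner faces contribute K f^0 minus the
  derivation, by \<open>side_derivation\<close>; the wrapped face contributes -K f^0, since
  (-1)^(n+1) meets the sign (-1)^n of the last insertion. The two boundary terms cancel.\<close>

lemma cob_plug:
  assumes xs: "linked (x # ys)" "src (last (x # ys)) = tgt x" "length ys = n"
  shows "cob n \<theta> m (plug K (pure (x # ys))) =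
    - (\<theta> m (plug K (faces (pure (x # ys)))) + (-1) ^ n *
        (\<Sum>\<langle>a \<otimes> m' \<leftarrow> coact M m\<rangle>. \<theta> m' (plug K (wrap (S_inv H a) (pure (x # ys))))))
    - \<theta> m (derivation (commutator K) (x # ys))"
proof -
  have sgn: "(-1) ^ n *\<^sub>C (y::complex) = (-1) ^ n * y" for y by (simp add: scaleC_complex_def)
  have "last_face \<theta> m (plug K (pure (x # ys))) =
      (\<Sum>\<langle>a \<otimes> m' \<leftarrow> coact M m\<rangle>. \<theta> m' (plug K (wrap (S_inv H a) (pure (x # ys)))) +
        (-1) ^ n * \<theta> m' (chain_cons (cm (ac (S_inv H a) (at_ob K (tgt x))) x) (pure ys)))"
    unfolding last_face_def wrap_plug xs(2,3) by (simp add: \<theta>_simps sgn pure_Cons)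
  also have "\<dots> = (\<Sum>\<langle>a \<otimes> m' \<leftarrow> coact M m\<rangle>. \<theta> m' (plug K (wrap (S_inv H a) (pure (x # ys))))) +
      (-1) ^ n * (\<Sum>\<langle>a \<otimes> m' \<leftarrow> coact M m\<rangle>.
        \<theta> m' (chain_cons (cm (ac (S_inv H a) (at_ob K (tgt x))) x) (pure ys)))"
    by (rule sweedler_lincomb) (intro lin_rules_arg)+
  also have "(\<Sum>\<langle>a \<otimes> m' \<leftarrow> coact M m\<rangle>.
        \<theta> m' (chain_cons (cm (ac (S_inv H a) (at_ob K (tgt x))) x) (pure ys))) =
      \<theta> m (chain_cons (cm (at_ob K (tgt x)) x) (pure ys))"
    by (rule coact_at_ob[where F="\<lambda>m y. \<theta> m (chain_cons (cm y x) (pure ys))"]) (intro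
        lin_rules_arg)+
  finally show ?thesis
    unfolding cob_def faces_plug side_derivation[OF xs(1)]
    by (simp add: \<theta>_simps algebra_simps flip: power_add mult_2)
qed

text \<open>Rotating moves \<open>z\<close> to the front, so K after \<open>z\<close> turns from the
  last insertion into the first. This mismatch is the first and the third term on the right; they
  cancel as soon as \<theta> is cyclic.\<close>

lemma rot_plug:
  assumes "length as = k"
  shows "(\<Sum>\<langle>a \<otimes> m' \<leftarrow> coact M m\<rangle>. \<theta> m' (plug K (rotate (S_inv H a) (pure (as @ [z]))))) =
    rot \<theta> m (pure (at_ob K (src z) # as @ [z])) - rot \<theta> m (plug K (pure (as @ [z])))
    + (-1) ^ k * \<theta> m (pure (at_ob K (src z) # as @ [z]))"
proof -
  have sgn: "(-1) ^ n *\<^sub>C (y::complex) = (-1) ^ n * y" for y n by (simp add: scaleC_complex_def)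
  have 1: "chain_cons (ac h z) (plug K (pure as)) =
      rotate h (plug K (pure (as @ [z]))) - (-1) ^ k *\<^sub>C chain_cons (ac h (at_ob K (src z))) (pure
          (as @ [z]))" for h
    using rotate_pure_snoc[of h "as @ [z]" "at_ob K (src z)"]
    by (simp add: plug_snoc lin_simps assms rotate_snoc pure_Cons)
  have 2: "pure (ac h z # at_ob K (src z) # as) = rotate h (pure (at_ob K (src z) # as @ [z]))"
    for h
    using rotate_pure_snoc[of h "at_ob K (src z) # as" z] by simp
  have "(\<Sum>\<langle>a \<otimes> m' \<leftarrow> coact M m\<rangle>. \<theta> m' (plug K (rotate (S_inv H a) (pure (as @ [z]))))) =
     (\<Sum>\<langle>a \<otimes> m' \<leftarrow> coact M m\<rangle>. (\<theta> m' (rotate (S_inv H a) (pure (at_ob K (src z) # as @ [z])))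
        + (-1) * \<theta> m' (rotate (S_inv H a) (plug K (pure (as @ [z])))))
      + (-1) ^ k * \<theta> m' (chain_cons (ac (S_inv H a) (at_ob K (src z))) (pure (as @ [z]))))"
    unfolding rotate_pure_snoc pure_Cons plug_cons src_act_arr 1 unfolding pure_Cons[symmetric] 2
    by (simp add: \<theta>_simps sgn algebra_simps)
  also have "\<dots> = rot \<theta> m (pure (at_ob K (src z) # as @ [z]))
      + (-1) * rot \<theta> m (plug K (pure (as @ [z])))
      + (-1) ^ k * (\<Sum>\<langle>a \<otimes> m' \<leftarrow> coact M m\<rangle>. \<theta> m' (chain_cons (ac (S_inv H a) (at_ob K (src z)))
          (pure (as @ [z]))))"
    unfolding rot_def
    by (subst sweedler_lincomb, intro lin_rules_arg, intro lin_rules_arg, subst sweedler_lincomb,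
        intro lin_rules_arg, intro lin_rules_arg, rule refl)
  also have "(\<Sum>\<langle>a \<otimes> m' \<leftarrow> coact M m\<rangle>. \<theta> m' (chain_cons (ac (S_inv H a) (at_ob K (src z))) (pure (as
      @ [z])))) =
      \<theta> m (chain_cons (at_ob K (src z)) (pure (as @ [z])))"
    by (rule coact_at_ob[where F="\<lambda>m y. \<theta> m (chain_cons y (pure (as @ [z])))"]) (intro
        lin_rules_arg)+
  finally show ?thesis by (simp add: pure_Cons)
qed

end

end

section \<open>Matrix-valued arrows and the trace\<close>

definition mat_cmp :: "('o \<Rightarrow> 'o \<Rightarrow> 'o \<Rightarrow> 'f::complex_vector \<Rightarrow> 'f \<Rightarrow> 'f)
    \<Rightarrow> 'o \<Rightarrow> 'o \<Rightarrow> 'o \<Rightarrow> 'f^3^3 \<Rightarrow> 'f^3^3 \<Rightarrow> 'f^3^3" where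
  "mat_cmp cmp X Y Z x y = (\<chi> i j. \<Sum>k\<in>UNIV. cmp X Y Z (x $ i $ k) (y $ k $ j))"

definition mat_act :: "('o \<Rightarrow> 'o \<Rightarrow> 'h \<Rightarrow> 'f::complex_vector \<Rightarrow> 'f) \<Rightarrow> 'o \<Rightarrow> 'o \<Rightarrow> 'h \<Rightarrow> 'f^3^3 \<Rightarrow>
    'f^3^3" where
  "mat_act act X Y h x = (\<chi> i j. act X Y h (x $ i $ j))"

definition mat_hom :: "('o \<Rightarrow> 'o \<Rightarrow> 'f set) \<Rightarrow> 'o \<Rightarrow> 'o \<Rightarrow> ('f^3^3) set" where
  "mat_hom hom X Y = {x. \<forall>i j. x $ i $ j \<in> hom X Y}"

definition entry :: "('o, 'f^3^3) arrow \<Rightarrow> 3 \<Rightarrow> 3 \<Rightarrow> ('o, 'f) arrow" where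
  "entry x i j = (src x, tgt x, snd (snd x) $ i $ j)"

lemma mat_hom_entry: "x \<in> mat_hom hom X Y \<Longrightarrow> x $ i $ j \<in> hom X Y"
  by (simp add: mat_hom_def)

lemma entry_tgt [simp]: "tgt (entry x i j) = tgt x"
  by (simp add: entry_def)

lemma alin_entry: "alin u \<Longrightarrow> alin (\<lambda>y. entry (u y) i j)"
  unfolding alin_def[of u] entry_def by (auto intro!: alinI clin)

text \<open>The entry (i, j) of the product of the matrices, multiplied over the algebra of chains
  under concatenation; the empty product is the identity matrix.\<close>

fun mat_prod_list :: "('o, 'f::complex_vector^3^3) arrow list \<Rightarrow> 3 \<Rightarrow> 3 \<Rightarrow> ('o, 'f) chain" where
  "mat_prod_list [] i j = (if i = j then pure [] else 0)"
| "mat_prod_list (x # xs) i j = (\<Sum>k\<in>UNIV. chain_cons (entry x i k) (mat_prod_list xs k j))"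

lemma multilin_mat_prod_list: "multilin (\<lambda>xs. mat_prod_list xs i j)"
proof (rule multilinI)
  fix as X Y bs
  show "clinear (\<lambda>f. mat_prod_list (as @ (X, Y, f) # bs) i j)"
  proof (induction as arbitrary: i)
    case Nil
    show ?case by simp (intro clin clin_chain alin_entry)
  next
    case (Cons a as)
    show ?case by simp (intro clin clin_chain alin_entry Cons)
  qed
qed

definition mat_prod :: "3 \<Rightarrow> 3 \<Rightarrow> ('o, 'f::complex_vector^3^3) chain \<Rightarrow> ('o, 'f) chain" where
  "mat_prod i j = chain_lift (\<lambda>xs. mat_prod_list xs i j)"

lemma clinear_mat_prod: "clinear (mat_prod i j)"
  unfolding mat_prod_def by (rule clinear_chain_lift[OF multilin_mat_prod_list])

lemma mat_prod_pure: "mat_prod i j (pure xs) = mat_prod_list xs i j"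
  unfolding mat_prod_def by (rule chain_lift_pure[OF multilin_mat_prod_list])

lemmas clin_mat_prod = clinear_comp[OF clinear_mat_prod]

lemma mat_prod_cons: "mat_prod i j (chain_cons x c) =
    (\<Sum>k\<in>UNIV. chain_cons (entry x i k) (mat_prod k j c))"
  by (rule chain_ext[where c=c])
    (intro clin clin_chain clin_mat_prod, intro clin clin_chain clin_mat_prod,
     simp add: chain_cons_pure mat_prod_pure)

lemma mat_prod_snoc: "mat_prod i j (chain_snoc z c) =
    (\<Sum>k\<in>UNIV. chain_snoc (entry z k j) (mat_prod i k c))"
proof (rule chain_ext[where c=c])
  fix xs
  show "mat_prod i j (chain_snoc z (pure xs)) =
      (\<Sum>k\<in>UNIV. chain_snoc (entry z k j) (mat_prod i k (pure xs)))"
  proof (induction xs arbitrary: i)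
    case Nil
    show ?case
      by (simp add: chain_snoc_pure mat_prod_pure clinear_0[OF clinear_chain_cons]
          clinear_0[OF clinear_chain_snoc] chain_cons_pure if_distrib[of "chain_cons _"]
          if_distrib[of "chain_snoc _"] cong: if_cong)
  next
    case (Cons x xs)
    show ?case
      by (simp add: pure_Cons chain_snoc_cons mat_prod_cons Cons clinear_sum[OF clinear_chain_cons]
          clinear_sum[OF clinear_chain_snoc]) (rule sum.swap)
  qed
qed (intro clin clin_chain clin_mat_prod)+

text \<open>The generalized trace of Morita invariance: composing a cochain with it gives a cochain
  on matrix-valued arrows.\<close>

definition chain_trace :: "('o, 'f::complex_vector^3^3) chain \<Rightarrow> ('o, 'f) chain" where
  "chain_trace c = (\<Sum>i\<in>UNIV. mat_prod i i c)"

lemma clinear_trace: "clinear chain_trace"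
  unfolding chain_trace_def[abs_def] by (intro clin clin_mat_prod)

lemmas clin_trace = clinear_comp[OF clinear_trace]

locale matrix_complex = cyclic_complex H M cmp act obj hom
  for H :: "'h::complex_algebra_1 hopf" and M :: "('m::complex_vector, 'h) hopf_mod"
    and cmp :: "'o \<Rightarrow> 'o \<Rightarrow> 'o \<Rightarrow> 'f::complex_vector \<Rightarrow> 'f \<Rightarrow> 'f"
    and act :: "'o \<Rightarrow> 'o \<Rightarrow> 'h \<Rightarrow> 'f \<Rightarrow> 'f"
    and obj :: "'o set" and hom :: "'o \<Rightarrow> 'o \<Rightarrow> 'f set" +
  assumes hom_subspace: "\<lbrakk>X \<in> obj; Y \<in> obj\<rbrakk> \<Longrightarrow> cvec.subspace (hom X Y)"
begin

text \<open>Only locales without associativity are interpreted for matrices. Cocycle and cyclicity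
  identities are carried over from the entries, along the compatibility of the trace with faces,
  rotation and wrapping.\<close>

sublocale mat: cochain_ops H M "mat_cmp cmp" "mat_act act"
  by unfold_locales
    (auto intro!: bilinI clin clin_cmp clin_act simp: mat_cmp_def mat_act_def)

sublocale mat: hom_hopf H "mat_cmp cmp" "mat_act act" obj "mat_hom hom"
  by unfold_locales
    (auto simp: mat_cmp_def mat_act_def mat_hom_def intro!: cvec.subspace_sum[OF hom_subspace]
      cmp_closed act_closed)

lemma entry_ac: "entry (mat.ac h x) i j = ac h (entry x i j)"
  by (cases x) (simp add: entry_def mat_act_def)

lemma chain_cons_sum_left: "chain_cons (X, Y, \<Sum>k\<in>A. g k) c = (\<Sum>k\<in>A. chain_cons (X, Y, g k) c)"
  by (rule clinear_sum[of "\<lambda>f. chain_cons (X, Y, f) c"]) (intro lin_rules)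

lemma chain_cons_zero_left: "chain_cons (X, Y, 0) c = 0"
  by (rule clinear_0[of "\<lambda>f. chain_cons (X, Y, f) c"]) (intro lin_rules)

lemma entry_cm: "chain_cons (entry (mat.cm x y) i j) c =
    (\<Sum>k\<in>UNIV. chain_cons (cm (entry x i k) (entry y k j)) c)"
  by (cases x; cases y) (simp add: entry_def mat_cmp_def chain_cons_sum_left chain_cons_zero_left)

lemma mat_prod_faces: "mat_prod i j (mat.faces c) = faces (mat_prod i j c)"
proof (rule chain_ext[where c=c])
  fix xs
  show "mat_prod i j (mat.faces (pure xs)) = faces (mat_prod i j (pure xs))"
  proof (induction xs arbitrary: i rule: induct_list012)
    case 1
    show ?case by (simp add: mat_prod_pure clinear_0[OF clinear_mat_prod] lin_simps)
  next
    case (2 x)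
    show ?case
      by (simp add: mat_prod_pure clinear_0[OF clinear_mat_prod] lin_simps clinear_sum[OF
          clinear_faces]
          if_distrib[of "chain_cons _"] chain_cons_pure if_distrib[of faces] cong: if_cong)
  next
    case (3 x y as)
    show ?case
      unfolding mat.faces_Cons2 clinear_diff[OF clinear_mat_prod] mat_prod_cons 3
      unfolding pure_Cons mat_prod_cons
      by (simp add: clinear_sum[OF clinear_faces] clinear_sum[OF clinear_chain_cons] faces_cons2
          sum_subtractf entry_cm) (rule sum.swap)
  qed
qed (intro lin_rules mat.lin_rules clin_mat_prod)+

lemma trace_faces: "chain_trace (mat.faces c) = faces (chain_trace c)"
  by (simp add: chain_trace_def mat_prod_faces clinear_sum[OF clinear_faces])

lemma mat_prod_face0: "mat_prod i j (mat.face0 c) = face0 (mat_prod i j c)"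
proof (rule chain_ext[where c=c])
  fix xs
  show "mat_prod i j (mat.face0 (pure xs)) = face0 (mat_prod i j (pure xs))"
  proof (cases xs rule: remdups_adj.cases)
    case 1
    then show ?thesis by (simp add: mat_prod_pure mat.face0_pure clinear_0[OF clinear_mat_prod]
          clinear_0[OF clinear_face0] face0_pure)
  next
    case (2 x)
    then show ?thesis
      by (simp add: mat_prod_pure mat.face0_pure clinear_0[OF clinear_mat_prod] lin_simps
          clinear_sum[OF clinear_face0]
          if_distrib[of "chain_cons _"] chain_cons_pure if_distrib[of face0] face0_pure
          clinear_0[OF clinear_face0] cong: if_cong)
  next
    case (3 x y as)
    show ?thesis
      unfolding 3 pure_Cons mat.face0_cons2 mat_prod_cons
      by (simp add: clinear_sum[OF clinear_face0] clinear_sum[OF clinear_chain_cons] face0_cons2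
          entry_cm) (rule sum.swap)
  qed
qed (intro lin_rules mat.lin_rules clin_mat_prod)+

text \<open>Cyclicity of the trace, obtained by exchanging the two index sums. A single entry
  \<open>mat_prod i j\<close> has no such property, hence neither has the wrapped face before the
  trace is taken.\<close>

lemma trace_rotate: "chain_trace (mat.rotate h c) = rotate h (chain_trace c)"
proof (rule chain_ext[where c=c])
  fix xs
  show "chain_trace (mat.rotate h (pure xs)) = rotate h (chain_trace (pure xs))"
  proof (cases xs rule: rev_cases)
    case Nil
    then show ?thesis
      by (simp add: mat.rotate_pure mat.rotate_list_def clinear_0[OF clinear_trace])
        (simp add: chain_trace_def mat_prod_pure clinear_sum[OF clinear_rotate] rotate_pure
            rotate_list_def)
  next
    case (snoc as z)
    show ?thesis
      unfolding snoc chain_snoc_pure[symmetric] mat.rotate_snoc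
      by (simp add: chain_trace_def mat_prod_cons mat_prod_snoc clinear_sum[OF clinear_rotate]
          rotate_snoc entry_ac)
        (rule sum.swap)
  qed
qed (intro lin_rules mat.lin_rules clin_trace)+

lemma trace_wrap: "chain_trace (mat.wrap h c) = wrap h (chain_trace c)"
  by (simp add: mat.wrap_def wrap_def trace_rotate[symmetric])
    (simp add: chain_trace_def mat_prod_face0 clinear_sum[OF clinear_face0])

lemma mat_prod_dact: "mat_prod i j (mat.dact h c) = dact h (mat_prod i j c)"
proof (rule chain_ext[where c=c])
  fix xs
  show "mat_prod i j (mat.dact h (pure xs)) = dact h (mat_prod i j (pure xs))"
  proof (induction xs arbitrary: i h)
    case Nil
    show ?case by (simp add: mat.dact_Nil mat_prod_pure clinear_scale[OF clinear_mat_prod] dact_Nil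
          clinear_0[OF clinear_dact])
  next
    case (Cons x xs)
    have "mat_prod i j (mat.dact h (pure (x # xs))) =
      (\<Sum>\<langle>h1 \<otimes> h2 \<leftarrow> comul H h\<rangle>. (\<Sum>k\<in>UNIV. chain_cons (ac h1 (entry x i k)) (dact h2 (mat_prod k j
          (pure xs)))))"
      unfolding pure_Cons mat.dact_cons
      by (subst sweedler_apply[OF clinear_mat_prod], intro mat.lin_rules) (simp add: mat_prod_cons
          Cons entry_ac)
    also have "\<dots> = (\<Sum>k\<in>UNIV. (\<Sum>\<langle>h1 \<otimes> h2 \<leftarrow> comul H h\<rangle>.
        chain_cons (ac h1 (entry x i k)) (dact h2 (mat_prod k j (pure xs)))))"
    proof (rule sweedler_lift)
      show "bilin (\<lambda>h1 h2. \<Sum>k\<in>UNIV. chain_cons (ac h1 (entry x i k)) (dact h2 (mat_prod k j (pure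
          xs))))"
        by (intro lin_rules)
      show "clinear (\<lambda>t. \<Sum>k\<in>UNIV. (\<Sum>\<langle>h1 \<otimes> h2 \<leftarrow> t\<rangle>.
          chain_cons (ac h1 (entry x i k)) (dact h2 (mat_prod k j (pure xs)))))"
        by (intro lin_rules)
      show "(\<Sum>k\<in>UNIV. (\<Sum>\<langle>h1 \<otimes> h2 \<leftarrow> a \<otimes> b\<rangle>. chain_cons (ac h1 (entry x i k)) (dact h2 (mat_prod k j
          (pure xs))))) =
        (\<Sum>k\<in>UNIV. chain_cons (ac a (entry x i k)) (dact b (mat_prod k j (pure xs))))" for a b
        by (subst sweedler_tensor) (intro lin_rules, rule refl)
    qed
    also have "\<dots> = dact h (mat_prod i j (pure (x # xs)))"
      by (simp add: pure_Cons mat_prod_cons clinear_sum[OF clinear_dact] dact_cons)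
    finally show ?case .
  qed
qed (intro lin_rules mat.lin_rules clin_mat_prod)+

lemma trace_dact: "chain_trace (mat.dact h c) = dact h (chain_trace c)"
  by (simp add: chain_trace_def mat_prod_dact clinear_sum[OF clinear_dact])

lemma mat_prod_path: "mat.is_path Y xs X \<Longrightarrow> length xs = n \<Longrightarrow> mat_prod i j (pure xs) \<in> path_span n Y X"
proof (induction xs arbitrary: Y n i)
  case Nil
  then show ?case by (auto simp: mat_prod_pure cvec.subspace_0[OF subspace_path_span] intro!:
      path_span_pure)
next
  case (Cons x xs)
  then obtain k where n: "n = Suc k" by auto
  have "chain_cons (entry x i l) (mat_prod l j (pure xs)) \<in> path_span (Suc k) (tgt (entry x i l))
      X" for l
    by (rule path_span_cons) (use Cons n mat_hom_entry in \<open>auto simp: entry_def\<close>)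
  then show ?case using Cons(2)
    by (auto simp: pure_Cons mat_prod_cons n intro!: cvec.subspace_sum[OF subspace_path_span])
qed

lemma trace_cyc: "c \<in> mat.cyc_span n \<Longrightarrow> chain_trace c \<in> cyc_span n"
proof (rule mat.cyc_span_image[OF clinear_trace _ subspace_cyc_span])
  fix xs assume "xs \<in> mat.cyc n"
  then obtain X where "mat.is_path X xs X" "length xs = Suc n" by (auto simp: mat.cyc_def)
  then show "chain_trace (pure xs) \<in> cyc_span n"
    unfolding chain_trace_def
    by (intro cvec.subspace_sum[OF subspace_cyc_span] path_span_cyc[OF mat_prod_path])
qed

end

section \<open>The homotopy attached to a matrix-valued semifunctor\<close>

locale mat_semifunctor = matrix_complex H M cmp act obj hom
  for H :: "'h::complex_algebra_1 hopf" and M :: "('m::complex_vector, 'h) hopf_mod"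
    and cmp :: "'o \<Rightarrow> 'o \<Rightarrow> 'o \<Rightarrow> 'f::complex_vector \<Rightarrow> 'f \<Rightarrow> 'f"
    and act :: "'o \<Rightarrow> 'o \<Rightarrow> 'h \<Rightarrow> 'f \<Rightarrow> 'f"
    and obj :: "'o set" and hom :: "'o \<Rightarrow> 'o \<Rightarrow> 'f set" +
  fixes \<rho> :: "'o \<Rightarrow> 'o \<Rightarrow> 'f \<Rightarrow> 'f^3^3" and K :: "'o \<Rightarrow> 'f^3^3"
  assumes rho_linear: "clinear (\<rho> X Y)"
    and rho_cmp: "\<rho> X Z (cmp X Y Z f' f) = mat_cmp cmp X Y Z (\<rho> Y Z f') (\<rho> X Y f)"
    and rho_act: "\<rho> X Y (act X Y h f) = mat_act act X Y h (\<rho> X Y f)"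
    and rho_hom: "\<lbrakk>X \<in> obj; Y \<in> obj; f \<in> hom X Y\<rbrakk> \<Longrightarrow> \<rho> X Y f \<in> mat_hom hom X Y"
    and K_inv: "mat_act act X X h (K X) = counit H h *\<^sub>C K X"
    and K_hom: "X \<in> obj \<Longrightarrow> K X \<in> mat_hom hom X X"
begin

definition rho_arr :: "('o, 'f) arrow \<Rightarrow> ('o, 'f^3^3) arrow" where
  "rho_arr x = (src x, tgt x, \<rho> (src x) (tgt x) (snd (snd x)))"

lemma rho_arr_src [simp]: "src (rho_arr x) = src x" and rho_arr_tgt [simp]: "tgt (rho_arr x) =
    tgt x"
  by (simp_all add: rho_arr_def)

lemma alin_rho_arr: "alin u \<Longrightarrow> alin (\<lambda>y. rho_arr (u y))"
  unfolding alin_def[of u] rho_arr_def by (auto intro!: alinI clinear_comp[OF rho_linear])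

lemma rho_arr_cm: "rho_arr (cm x y) = mat.cm (rho_arr x) (rho_arr y)"
  by (cases x; cases y) (simp add: rho_arr_def rho_cmp clinear_0[OF rho_linear])

lemma rho_arr_ac: "rho_arr (ac h x) = mat.ac h (rho_arr x)"
  by (cases x) (simp add: rho_arr_def rho_act)

section \<open>Transport of chains along the semifunctor\<close>

definition push :: "('o, 'f) chain \<Rightarrow> ('o, 'f^3^3) chain" where
  "push = chain_lift (\<lambda>as. pure (map rho_arr as))"

lemma multilin_map_rho_arr: "multilin (\<lambda>as. pure (map rho_arr as))"
  by (rule multilinI) (simp, intro multilinD[OF multilin_pure] alin_rho_arr alinI clinear_id)

lemma clinear_push: "clinear push"
  unfolding push_def by (rule clinear_chain_lift[OF multilin_map_rho_arr])

lemma push_pure: "push (pure as) = pure (map rho_arr as)"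
  unfolding push_def by (rule chain_lift_pure[OF multilin_map_rho_arr])

lemmas clin_push = clinear_comp[OF clinear_push]

lemma push_cons: "push (chain_cons x c) = chain_cons (rho_arr x) (push c)"
  by (rule chain_ext[where c=c])
    (intro clin_chain clin_push clin, intro clin_chain clin_push clin,
        simp add: chain_cons_pure push_pure)

lemma push_faces: "push (faces c) = mat.faces (push c)"
proof (rule chain_ext[where c=c])
  fix as
  show "push (faces (pure as)) = mat.faces (push (pure as))"
    by (induction as rule: induct_list012)
      (simp_all add: push_pure faces_Cons2 mat.faces_Cons2 clinear_0[OF clinear_push]
        clinear_diff[OF clinear_push] push_cons rho_arr_cm)
qed (intro lin_rules mat.lin_rules clin_push)+

lemma push_rotate: "push (rotate h c) = mat.rotate h (push c)"
proof (rule chain_ext[where c=c])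
  fix as
  show "push (rotate h (pure as)) = mat.rotate h (push (pure as))"
    by (cases as rule: rev_cases)
      (simp_all add: push_pure rotate_pure_snoc mat.rotate_pure_snoc rho_arr_ac
        rotate_pure rotate_list_def mat.rotate_pure mat.rotate_list_def clinear_0[OF clinear_push]
        push_cons)
qed (intro lin_rules mat.lin_rules clin_push)+

lemma push_wrap: "push (wrap h c) = mat.wrap h (push c)"
proof -
  have "push (face0 c) = mat.face0 (push c)" for c
  proof (rule chain_ext[where c=c])
    fix as
    show "push (face0 (pure as)) = mat.face0 (push (pure as))"
      by (cases as rule: remdups_adj.cases)
        (simp_all add: push_pure face0_pure mat.face0_pure clinear_0[OF clinear_push] push_cons
            rho_arr_cm)
  qed (intro lin_rules mat.lin_rules clin_push)+
  then show ?thesis by (simp add: wrap_def mat.wrap_def push_rotate)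
qed

lemma push_dact: "push (dact h c) = mat.dact h (push c)"
proof (rule chain_ext[where c=c])
  fix as
  show "push (dact h (pure as)) = mat.dact h (push (pure as))"
  proof (induction as arbitrary: h)
    case Nil
    show ?case by (simp add: push_pure dact_Nil mat.dact_Nil clinear_scale[OF clinear_push])
  next
    case (Cons x as)
    show ?case
      unfolding pure_Cons dact_cons push_cons mat.dact_cons
      by (subst sweedler_apply[OF clinear_push], intro lin_rules) (simp add: push_cons rho_arr_ac
          Cons)
  qed
qed (intro lin_rules mat.lin_rules clin_push)+

lemma push_path: "is_path Y as X \<Longrightarrow> mat.is_path Y (map rho_arr as) X"
  by (induction as arbitrary: Y) (auto simp: rho_arr_def intro: rho_hom)

text \<open>The homotopy is contraction with \<open>K\<close>: the trace of the sum over all \<open>k\<close> of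
  \<open>(-1)\<^sup>k \<rho> f\<^sup>0 \<otimes> \<dots> \<otimes> \<rho> f\<^sup>k \<otimes> K \<otimes> \<rho> f\<^bsub>k+1\<^esub> \<otimes> \<dots>\<close>.\<close>

definition homot :: "('m \<Rightarrow> ('o, 'f) chain \<Rightarrow> complex) \<Rightarrow> 'm \<Rightarrow> ('o, 'f) chain \<Rightarrow> complex" where
  "homot \<Phi> m c = \<Phi> m (chain_trace (mat.plug K (push c)))"

lemma homot_cyc: "c \<in> cyc_span n \<Longrightarrow> chain_trace (mat.plug K (push c)) \<in> cyc_span (Suc n)"
proof (rule cyc_span_image[where f="\<lambda>c. chain_trace (mat.plug K (push c))",
    OF _ _ subspace_cyc_span])
  show "clinear (\<lambda>c. chain_trace (mat.plug K (push c)))"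
    by (intro clin_trace mat.lin_rules clin_push)
  fix as assume "as \<in> cyc n"
  then obtain X where "is_path X as X" "length as = Suc n" by (auto simp: cyc_def)
  then show "chain_trace (mat.plug K (push (pure as))) \<in> cyc_span (Suc n)"
    unfolding push_pure
    by (intro trace_cyc mat.path_span_cyc mat.plug_path[OF K_hom] push_path) auto
qed

context
  fixes \<Phi> :: "'m \<Rightarrow> ('o, 'f) chain \<Rightarrow> complex"
  assumes bil: "bilin \<Phi>"
begin

lemma bilin_homot: "bilin (homot \<Phi>)"
  unfolding homot_def[abs_def]
  by (intro bilinI bilin_left[OF bil] bilin_right[OF bil] clin_trace mat.lin_rules clin_push)

definition tr_cochain :: "'m \<Rightarrow> ('o, 'f^3^3) chain \<Rightarrow> complex" where
  "tr_cochain m c = \<Phi> m (chain_trace c)"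

lemma bilin_tr_cochain: "bilin tr_cochain"
  unfolding tr_cochain_def[abs_def]
  by (intro bilinI bilin_left[OF bil] bilin_right[OF bil] clin_trace clin)

lemma mat_cob_tr: "mat.cob n tr_cochain m c = cob n \<Phi> m (chain_trace c)"
  by (simp add: mat.cob_def cob_def mat.last_face_def last_face_def tr_cochain_def trace_faces
      trace_wrap)

lemma mat_rot_tr: "mat.rot tr_cochain m c = rot \<Phi> m (chain_trace c)"
  by (simp add: mat.rot_def rot_def tr_cochain_def trace_rotate)

lemma homot_invariant: "invariant (Suc n) \<Phi> \<Longrightarrow> invariant n (homot \<Phi>)"
  by (simp add: invariant_def homot_def homot_cyc push_dact mat.dact_plug[OF K_inv,
      symmetric] trace_dact)

lemma homot_cyclic:
  assumes "is_cyclic (Suc n) \<Phi>"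
  shows "is_cyclic n (homot \<Phi>)"
  unfolding is_cyclic_def
proof (intro allI ballI)
  fix m c assume c: "c \<in> cyc_span n"
  have rt: "clinear (rot (homot \<Phi>) m)"
    by (rule bilin_right[OF bilin_rot[OF bilin_homot] clinear_id])
  show "rot (homot \<Phi>) m c = (-1) ^ n * homot \<Phi> m c"
  proof (rule cyc_span_eq[OF rt _ _ c])
    show "clinear (\<lambda>c. (-1) ^ n * homot \<Phi> m c)"
      by (intro clinear_cmult bilin_right[OF bilin_homot clinear_id])
    fix as assume as: "as \<in> cyc n"
    then obtain X bs z where bs: "as = bs @ [z]" "length bs = n" "is_path X as X" "src z =
        X" "is_arrow z"
      "is_path X bs (tgt z)" by (rule cyc_cases)
    let ?xs = "map rho_arr bs @ [rho_arr z]"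
    have xs: "push (pure as) = pure ?xs" by (simp add: push_pure bs)
    have mxs: "mat.is_path X ?xs X" using push_path[OF bs(3)] bs(1) by simp
    let ?k = "mat.at_ob K (src (rho_arr z))"
    have cyc1: "chain_trace (pure (?k # ?xs)) \<in> cyc_span (Suc n)"
      by (intro trace_cyc mat.cyc_span_pure)
        (use mxs bs K_hom in \<open>auto simp: mat.cyc_def\<close>)
    have cyc2: "chain_trace (mat.plug K (pure ?xs)) \<in> cyc_span (Suc n)"
      using homot_cyc[OF cyc_span_pure[OF as]] by (simp add: xs)
    \<comment> \<open>With these signs the two terms that carry K in front cancel in
      \<open>rot_plug\<close>, and the remaining one acquires the sign (-1)^n.\<close>
    have r: "mat.rot tr_cochain m (pure (?k # ?xs)) = (-1) ^ Suc n * tr_cochain m (pure (?k # ?xs))"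
      "mat.rot tr_cochain m (mat.plug K (pure ?xs)) =
          (-1) ^ Suc n * tr_cochain m (mat.plug K (pure ?xs))"
      using assms cyc1 cyc2 by (simp_all only: is_cyclic_def mat_rot_tr tr_cochain_def)
    have "rot (homot \<Phi>) m (pure as) =
      (\<Sum>\<langle>a \<otimes> m' \<leftarrow> coact M m\<rangle>. tr_cochain m' (mat.plug K (mat.rotate (S_inv H a) (pure ?xs))))"
      by (simp add: rot_def homot_def push_rotate xs tr_cochain_def)
    also have "\<dots> = mat.rot tr_cochain m (pure (?k # ?xs)) - mat.rot tr_cochain m (mat.plug K (pure
        ?xs))
      + (-1) ^ n * tr_cochain m (pure (?k # ?xs))"
      by (rule mat.rot_plug[OF bilin_tr_cochain K_inv]) (simp add: bs)
    also have "\<dots> = (-1) ^ n * homot \<Phi> m (pure as)"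
      unfolding r by (simp add: homot_def xs tr_cochain_def)
    finally show "rot (homot \<Phi>) m (pure as) = (-1) ^ n * homot \<Phi> m (pure as)" .
  qed
qed

text \<open>The cocycle is evaluated on the contracted chain. In positive degree the left side is
  the coboundary of the homotopy; writing it with \<open>n\<close> instead of a predecessor includes
  degree 0, where both terms vanish.\<close>

lemma homot_cob:
  assumes coc: "\<And>m c. c \<in> cyc_span (Suc n) \<Longrightarrow> cob n \<Phi> m c = 0" and as: "as \<in> cyc n"
  shows "homot \<Phi> m (faces (pure as)) + (-1) ^ n * last_face (homot \<Phi>) m (pure as) =
    - \<Phi> m (chain_trace (mat.derivation (mat.commutator K) (map rho_arr as)))"
proof -
  obtain x ys where xy: "map rho_arr as = x # ys" "length ys = n"
    using as by (cases as) (auto simp: cyc_def)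
  obtain X where X: "is_path X as X" "length as = Suc n" using as by (auto simp: cyc_def)
  have p: "mat.is_path X (x # ys) X" unfolding xy(1)[symmetric] by (rule push_path[OF X(1)])
  have lk: "linked (x # ys)" by (rule mat.path_linked[OF p])
  obtain bs z where bz: "x # ys = bs @ [z]" by (cases "x # ys" rule: rev_cases) auto
  have "src z = X" using p[unfolded bz] by (auto simp: mat.path_append)
  moreover have "tgt x = X" using p by simp
  ultimately have ls: "src (last (x # ys)) = tgt x" unfolding bz by simp
  have "0 = cob n \<Phi> m (chain_trace (mat.plug K (push (pure as))))"
    using coc[OF homot_cyc[OF cyc_span_pure[OF as]]] by simp
  also have "\<dots> = mat.cob n tr_cochain m (mat.plug K (pure (x # ys)))"
    by (simp add: mat_cob_tr push_pure xy)
  also have "\<dots> = - (tr_cochain m (mat.plug K (mat.faces (pure (x # ys)))) + (-1) ^ n *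
        (\<Sum>\<langle>a \<otimes> m' \<leftarrow> coact M m\<rangle>. tr_cochain m' (mat.plug K (mat.wrap (S_inv H a) (pure (x # ys))))))
    - tr_cochain m (mat.derivation (mat.commutator K) (x # ys))"
    by (rule mat.cob_plug[OF bilin_tr_cochain K_inv lk ls xy(2)])
  finally show ?thesis
    by (simp add: homot_def last_face_def push_faces push_wrap push_pure xy tr_cochain_def
        eq_neg_iff_add_eq_0
        algebra_simps)
qed

end

end

section \<open>Integrating along a path of semifunctors\<close>

text \<open>A decomposition of \<open>s\<close> independent of t reduces the claims to finite sums
  of continuous functions.\<close>

lemma integral_sweedler:
  fixes \<beta> :: "real \<Rightarrow> 'a::complex_vector \<Rightarrow> 'b::complex_vector \<Rightarrow> complex"
  assumes b: "\<And>t. bilin (\<beta> t)" and bi: "bilin (\<lambda>a b. integral {0..1} (\<lambda>t. \<beta> t a b))"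
    and c: "\<And>a b. continuous_on {0..1} (\<lambda>t. \<beta> t a b)"
  shows "sweedler s (\<lambda>a b. integral {0..1} (\<lambda>t. \<beta> t a b)) = integral {0..1} (\<lambda>t. sweedler s (\<beta> t))"
    and "continuous_on {0..1} (\<lambda>t. sweedler s (\<beta> t))"
proof -
  obtain ps where s: "s = (\<Sum>(a, b)\<leftarrow>ps. a \<otimes> b)" using tensor_decomp by blast
  have cont: "continuous_on {0..1} (\<lambda>t. \<Sum>(a, b)\<leftarrow>ps. \<beta> t a b)" for ps
    by (induction ps) (auto intro!: continuous_intros c)
  show "continuous_on {0..1} (\<lambda>t. sweedler s (\<beta> t))"
    unfolding s sweedler_sum_list[OF b] by (rule cont)
  show "sweedler s (\<lambda>a b. integral {0..1} (\<lambda>t. \<beta> t a b)) = integral {0..1} (\<lambda>t. sweedler s (\<beta> t))"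
    unfolding s sweedler_sum_list[OF b] sweedler_sum_list[OF bi]
  proof (induction ps)
    case (Cons p ps)
    then show ?case
      by (cases p) (simp add: integral_add integrable_continuous_real c cont)
  qed simp
qed

text \<open>Quadratic polynomials are expanded in 1, t, t - t^2, so that \<open>C\<close> drops out
  at both ends and the derivative is B + (1 - 2 t) C. The generator \<open>K\<close> does not depend
  on t.\<close>

locale semifunctor_path = matrix_complex H M cmp act obj hom
  for H :: "'h::complex_algebra_1 hopf" and M :: "('m::complex_vector, 'h) hopf_mod"
    and cmp :: "'o \<Rightarrow> 'o \<Rightarrow> 'o \<Rightarrow> 'f::complex_vector \<Rightarrow> 'f \<Rightarrow> 'f"
    and act :: "'o \<Rightarrow> 'o \<Rightarrow> 'h \<Rightarrow> 'f \<Rightarrow> 'f"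
    and obj :: "'o set" and hom :: "'o \<Rightarrow> 'o \<Rightarrow> 'f set" +
  fixes A B C :: "'o \<Rightarrow> 'o \<Rightarrow> 'f \<Rightarrow> 'f^3^3" and K :: "'o \<Rightarrow> 'f^3^3"
    and \<rho> :: "real \<Rightarrow> 'o \<Rightarrow> 'o \<Rightarrow> 'f \<Rightarrow> 'f^3^3"
  assumes rho: "\<rho> t X Y f = A X Y f + of_real t *\<^sub>C B X Y f + of_real (t - t\<^sup>2) *\<^sub>C C X Y f"
    and semifunctor: "mat_semifunctor H M cmp act obj hom (\<rho> t) K"
    and rho_deriv: "mat_cmp cmp X Y Y (K Y) (\<rho> t X Y f) - mat_cmp cmp X X Y (\<rho> t X Y f) (K X) =
      B X Y f + of_real (1 - 2 * t) *\<^sub>C C X Y f"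
    and endpoints: "as \<in> cyc n \<Longrightarrow>
      chain_trace (pure (map (\<lambda>(X, Y, f). (X, Y, \<rho> 0 X Y f)) as)) =
      pure as + chain_trace (pure (map (\<lambda>(X, Y, f). (X, Y, \<rho> 1 X Y f)) as))"
begin

interpretation sf: mat_semifunctor H M cmp act obj hom "\<rho> t" K for t
  by (rule semifunctor)

text \<open>The Leibniz rule, by induction on the list. Composing with a scalar-valued linear
  \<open>L\<close> avoids putting a topology on the chains.\<close>

lemma push_derivative:
  assumes "clinear L"
  shows "((\<lambda>t. L (sf.push t (pure as))) has_vector_derivative
    (L (mat.derivation (mat.commutator K) (map (sf.rho_arr t) as)) :: complex)) (at t)"
  using assms
proof (induction as arbitrary: L)
  case Nil
  then show ?case by (simp add: sf.push_pure clinear_0)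
next
  case (Cons x as)
  obtain X Y f where x: "x = (X, Y, f)" by (cases x)
  \<comment> \<open>Separates the first slot, a quadratic polynomial in t, from the tail, which is
    covered by the induction hypothesis applied to \<open>LL v\<close>.\<close>
  define LL where "LL v c = L (chain_cons (X, Y, v) c)" for v c
  have lv: "clinear (\<lambda>v. LL v c)" for c
    unfolding LL_def by (intro clinear_comp[OF Cons.prems] clin_chain clinear_id)
  have lc: "clinear (LL v)" for v
    unfolding LL_def[abs_def] by (intro clinear_comp[OF Cons.prems] clin_chain clinear_id)
  let ?p = "\<lambda>t. sf.push t (pure as)"
  let ?d = "\<lambda>t. mat.derivation (mat.commutator K) (map (sf.rho_arr t) as)"
  have rx: "LL (\<rho> t X Y f) c = LL (A X Y f) c + of_real t * LL (B X Y f) c +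
      of_real (t - t\<^sup>2) * LL (C X Y f) c" for t c
    by (simp add: rho clinear_add[OF lv] clinear_scale[OF lv] scaleC_complex_def del: of_real_diff)
  have "L (sf.push t (pure (x # as))) = LL (A X Y f) (?p t) + of_real t * LL (B X Y f) (?p t)
      + of_real (t - t\<^sup>2) * LL (C X Y f) (?p t)" for t
  proof -
    have "L (sf.push t (pure (x # as))) = LL (\<rho> t X Y f) (?p t)"
      by (simp only: pure_Cons[of x] sf.push_cons) (simp add: sf.rho_arr_def x LL_def)
    then show ?thesis by (simp only: rx)
  qed
  moreover have "((\<lambda>t. LL (A X Y f) (?p t) + of_real t * LL (B X Y f) (?p t)
      + of_real (t - t\<^sup>2) * LL (C X Y f) (?p t)) has_vector_derivative
      LL (A X Y f) (?d t) + (of_real t * LL (B X Y f) (?d t) + 1 * LL (B X Y f) (?p t))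
      + (of_real (t - t\<^sup>2) * LL (C X Y f) (?d t) +
          of_real (1 - 2 * t) * LL (C X Y f) (?p t))) (at t)"
  proof -
    have d1: "(complex_of_real has_vector_derivative 1) (at t)"
      using has_vector_derivative_of_real[OF DERIV_ident] by simp
    have d2: "((\<lambda>t. complex_of_real (t - t\<^sup>2)) has_vector_derivative of_real (1 - 2 * t)) (at t)"
      by (rule has_vector_derivative_of_real) (auto intro!: derivative_eq_intros)
    show ?thesis
      by (intro has_vector_derivative_add has_vector_derivative_mult Cons.IH lc d1 d2)
  qed
  moreover have "L (mat.derivation (mat.commutator K) (map (sf.rho_arr t) (x # as))) =
      LL (A X Y f) (?d t) + (of_real t * LL (B X Y f) (?d t) + 1 * LL (B X Y f) (?p t))
      + (of_real (t - t\<^sup>2) * LL (C X Y f) (?d t) + of_real (1 - 2 * t) * LL (C X Y f) (?p t))"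
  proof -
    have c: "mat.commutator K (sf.rho_arr t x) = B X Y f + of_real (1 - 2 * t) *\<^sub>C C X Y f"
      by (simp add: mat.commutator_def sf.rho_arr_def x rho_deriv)
    have "L (mat.derivation (mat.commutator K) (map (sf.rho_arr t) (x # as))) =
      LL (B X Y f + of_real (1 - 2 * t) *\<^sub>C C X Y f) (?p t) + LL (\<rho> t X Y f) (?d t)"
      by (simp only: list.map mat.derivation.simps c clinear_add[OF Cons.prems])
        (simp add: LL_def sf.push_pure sf.rho_arr_def x)
    then show ?thesis
      unfolding rx clinear_add[OF lv] clinear_scale[OF lv] scaleC_complex_def mult_1
      by (simp only: ac_simps)
  qed
  ultimately show ?case by simp
qed

lemma push_continuous:
  assumes "clinear L"
  shows "continuous_on S (\<lambda>t. L (sf.push t c) :: complex)"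
proof -
  have "c \<in> cvec.span (range pure)" by (simp add: span_range_pure)
  then show ?thesis
  proof (induction rule: cvec.span_induct_alt)
    case base
    then show ?case by (simp add: clinear_0[OF sf.clinear_push] clinear_0[OF assms])
  next
    case (step k x y)
    then obtain as where x: "x = pure as" by auto
    have "continuous_on S (\<lambda>t. L (sf.push t (pure as)))"
      by (intro continuous_at_imp_continuous_on ballI)
        (rule has_vector_derivative_continuous[OF push_derivative[OF assms]])
    with step show ?case
      by (auto simp: x clinear_add[OF sf.clinear_push] clinear_scale[OF sf.clinear_push]
          clinear_add[OF assms]
          clinear_scale[OF assms] scaleC_complex_def intro!: continuous_intros)
  qed
qed

context
  fixes \<Phi> :: "'m \<Rightarrow> ('o, 'f) chain \<Rightarrow> complex"
  assumes bil: "bilin \<Phi>"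
begin

definition int_homot :: "'m \<Rightarrow> ('o, 'f) chain \<Rightarrow> complex" where
  "int_homot m c = integral {0..1} (\<lambda>t. sf.homot t \<Phi> m c)"

lemma homot_continuous: "continuous_on S (\<lambda>t. sf.homot t \<Phi> m c)"
  unfolding sf.homot_def
  by (rule push_continuous) (intro bilin_right[OF bil] clin_trace mat.lin_rules)

lemma homot_integrable: "(\<lambda>t. sf.homot t \<Phi> m c) integrable_on {0..1}"
  by (rule integrable_continuous_real[OF homot_continuous])

lemma bilin_int_homot: "bilin int_homot"
  unfolding bilin_def clinear_iff int_homot_def
  using sf.bilin_homot[OF bil]
  by (auto simp: bilin_def clinear_iff scaleC_complex_def integral_add homot_integrable)

lemma last_face_int_homot: "last_face int_homot m c =
    integral {0..1} (\<lambda>t. last_face (sf.homot t \<Phi>) m c)"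
  and last_face_homot_continuous: "continuous_on {0..1} (\<lambda>t. last_face (sf.homot t \<Phi>) m c)"
proof -
  note b = bilin_left[OF sf.bilin_homot[OF bil]] bilin_right[OF sf.bilin_homot[OF bil]]
    bilin_left[OF bilin_int_homot] bilin_right[OF bilin_int_homot]
  show "last_face int_homot m c = integral {0..1} (\<lambda>t. last_face (sf.homot t \<Phi>) m c)"
    unfolding last_face_def int_homot_def
    by (rule integral_sweedler(1)) (intro lin_rules_M b | (fold int_homot_def,
        intro lin_rules_M b) | rule homot_continuous)+
  show "continuous_on {0..1} (\<lambda>t. last_face (sf.homot t \<Phi>) m c)"
    unfolding last_face_def
    by (rule integral_sweedler(2)) (intro lin_rules_M b | (fold int_homot_def,
        intro lin_rules_M b) | rule homot_continuous)+
qed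

lemma rot_int_homot: "rot int_homot m c = integral {0..1} (\<lambda>t. rot (sf.homot t \<Phi>) m c)"
proof -
  note b = bilin_left[OF sf.bilin_homot[OF bil]] bilin_right[OF sf.bilin_homot[OF bil]]
    bilin_left[OF bilin_int_homot] bilin_right[OF bilin_int_homot]
  show ?thesis
    unfolding rot_def int_homot_def
    by (rule integral_sweedler(1)) (intro lin_rules_M b | (fold int_homot_def,
        intro lin_rules_M b) | rule homot_continuous)+
qed

lemma int_homot_invariant: "invariant (Suc n) \<Phi> \<Longrightarrow> invariant n int_homot"
  using sf.homot_invariant[OF bil] by (simp add: invariant_def int_homot_def)

lemma int_homot_cyclic: "is_cyclic (Suc n) \<Phi> \<Longrightarrow> is_cyclic n int_homot"
  unfolding is_cyclic_def[of n int_homot] rot_int_homot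
  using sf.homot_cyclic[OF bil] by (simp add: is_cyclic_def int_homot_def)

text \<open>By \<open>homot_cob\<close> the integrand is minus the derivative of \<Phi> applied to
  the trace along the path, so the fundamental theorem of calculus gives the value at 0 minus the
  value at 1; the endpoint condition identifies this difference with \<Phi>.\<close>

lemma int_homot_cob:
  assumes coc: "\<And>m c. c \<in> cyc_span (Suc n) \<Longrightarrow> cob n \<Phi> m c = 0" and as: "as \<in> cyc n"
  shows "int_homot m (faces (pure as)) + (-1) ^ n * last_face int_homot m (pure as) = \<Phi> m (pure as)"
proof -
  let ?L = "\<lambda>c. \<Phi> m (chain_trace c)"
  have L: "clinear ?L" by (intro bilin_right[OF bil] clinear_trace)
  let ?g = "\<lambda>t. ?L (mat.derivation (mat.commutator K) (map (sf.rho_arr t) as))"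
  have "(?g has_integral ?L (sf.push 1 (pure as)) - ?L (sf.push 0 (pure as))) {0..1}"
    by (rule fundamental_theorem_of_calculus)
      (auto intro: has_vector_derivative_at_within push_derivative[OF L])
  moreover have "?L (sf.push 1 (pure as)) - ?L (sf.push 0 (pure as)) = - \<Phi> m (pure as)"
  proof -
    have m: "map (sf.rho_arr t) as = map (\<lambda>(X, Y, f). (X, Y, \<rho> t X Y f)) as" for t
      by (auto simp: sf.rho_arr_def)
    show ?thesis
      using endpoints[OF as]
        by (simp add: sf.push_pure m clinear_add[OF bilin_right[OF bil clinear_id]])
  qed
  ultimately have 1: "integral {0..1} ?g = - \<Phi> m (pure as)"
    by (simp add: integral_unique)
  have "int_homot m (faces (pure as)) + (-1) ^ n * last_face int_homot m (pure as) =
    integral {0..1} (\<lambda>t. sf.homot t \<Phi> m (faces (pure as)) +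
        (-1) ^ n * last_face (sf.homot t \<Phi>) m (pure as))"
    unfolding last_face_int_homot unfolding int_homot_def
    by (simp add: integral_add homot_integrable integrable_continuous_real
        last_face_homot_continuous
        integrable_on_mult_right)
  also have "\<dots> = integral {0..1} (\<lambda>t. - ?g t)"
    by (simp add: sf.homot_cob[OF bil coc as])
  also have "\<dots> = \<Phi> m (pure as)" using 1 by simp
  finally show ?thesis .
qed

end

text \<open>In degree 0 there are no cochains below, but both terms of \<open>int_homot_cob\<close>
  vanish on a single arrow, so \<Phi> itself is 0. In positive degree the integrated homotopy is the
  primitive.\<close>

lemma cocycle_trivial:
  assumes bil: "bilin \<Phi>" and inv: "invariant n \<Phi>" and cyc: "is_cyclic n \<Phi>"
    and coc: "\<And>m c. c \<in> cyc_span (Suc n) \<Longrightarrow> cob n \<Phi> m c = 0"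
  shows "n = 0 \<Longrightarrow> c \<in> cyc_span 0 \<Longrightarrow> \<Phi> m c = 0"
    and "n = Suc k \<Longrightarrow> \<exists>\<Psi>. bilin \<Psi> \<and> invariant k \<Psi> \<and> is_cyclic k \<Psi> \<and>
      (\<forall>m. \<forall>c\<in>cyc_span n. cob k \<Psi> m c = \<Phi> m c)"
proof -
  have lin: "clinear (\<Phi> m)" for m by (rule bilin_right[OF bil clinear_id])
  {
    assume n: "n = 0" and c: "c \<in> cyc_span 0"
    show "\<Phi> m c = 0"
    proof (rule cyc_span_eq[OF lin clinear_zero _ c])
      fix as assume as: "as \<in> cyc 0"
      then obtain x where x: "as = [x]" by (auto simp: cyc_def length_Suc_conv)
      have "last_face (int_homot \<Phi>) m (pure as) = 0"
        by (simp add: x last_face_def clinear_0[OF bilin_right[OF bilin_int_homot[OF bil]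
            clinear_id]] sweedler_zero)
      then show "\<Phi> m (pure as) = 0"
        using int_homot_cob[OF bil coc[unfolded n] as, of m]
        by (simp add: x n clinear_0[OF bilin_right[OF bilin_int_homot[OF bil] clinear_id]])
    qed
  }
  assume n: "n = Suc k"
  have "cob k (int_homot \<Phi>) m c = \<Phi> m c" if c: "c \<in> cyc_span n" for m c
    by (rule cyc_span_eq[OF bilin_right[OF bilin_cob[OF bilin_int_homot[OF bil]] clinear_id] lin _
        c])
      (use int_homot_cob[OF bil coc] in \<open>simp add: cob_def n\<close>)
  then show "\<exists>\<Psi>. bilin \<Psi> \<and> invariant k \<Psi> \<and> is_cyclic k \<Psi> \<and> (\<forall>m. \<forall>c\<in>cyc_span n. cob k \<Psi> m c = \<Phi> m c)"
    using bilin_int_homot[OF bil] int_homot_invariant[OF bil] int_homot_cyclic[OF bil] inv cyc n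
      by blast
qed

end

section \<open>A path of semifunctors into 3x3 matrices\<close>

definition mat3 :: "'f::zero \<Rightarrow> 'f \<Rightarrow> 'f \<Rightarrow> 'f \<Rightarrow> 'f \<Rightarrow> 'f \<Rightarrow> 'f \<Rightarrow> 'f \<Rightarrow> 'f \<Rightarrow> 'f^3^3" where
  "mat3 a b c d e f g h i = vector [vector [a, b, c], vector [d, e, f], vector [g, h, i]]"

lemma mat3_nth [simp]:
  "mat3 a b c d e f g h i $ 1 $ 1 = a" "mat3 a b c d e f g h i $ 1 $ 2 =
      b" "mat3 a b c d e f g h i $ 1 $ 3 = c"
  "mat3 a b c d e f g h i $ 2 $ 1 = d" "mat3 a b c d e f g h i $ 2 $ 2 =
      e" "mat3 a b c d e f g h i $ 2 $ 3 = f"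
  "mat3 a b c d e f g h i $ 3 $ 1 = g" "mat3 a b c d e f g h i $ 3 $ 2 =
      h" "mat3 a b c d e f g h i $ 3 $ 3 = i"
  by (simp_all add: mat3_def)

lemma mat3_eq_iff: "x = y \<longleftrightarrow> (\<forall>i j. x $ i $ j = (y :: 'f^3^3) $ i $ j)"
  by (auto simp: vec_eq_iff)

lemma scaleC_vec_nth [simp]: "(c *\<^sub>C x) $ i = c *\<^sub>C (x $ i)"
  by (simp add: scaleC_vec_def)

lemma clinear_mat3:
  assumes "clinear a" "clinear b" "clinear c" "clinear d" "clinear e" "clinear f" "clinear g"
      "clinear h" "clinear i"
  shows "clinear (\<lambda>x. mat3 (a x) (b x) (c x) (d x) (e x) (f x) (g x) (h x) (i x))"
  using assms by (auto simp: clinear_iff mat3_eq_iff forall_3)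

text \<open>An Eilenberg swindle: the sum of the identity and \<upsilon> is isomorphic to
  \<upsilon>. With p a row, q a column and \<alpha> f = diag (f, \<upsilon> f), the assumption
  \<open>qp\<close> says q p \<alpha> = \<alpha>, \<open>pq\<close> says p \<alpha> q = \<upsilon>,
  and \<open>q_u\<close>, \<open>u_p\<close> are the intertwining relations. They are required for
  all elements of the type, with the projection \<open>act X Y 1 f\<close> in place of f.\<close>

locale swindle = matrix_complex H M cmp act obj hom
  for H :: "'h::complex_algebra_1 hopf" and M :: "('m::complex_vector, 'h) hopf_mod"
    and cmp :: "'o \<Rightarrow> 'o \<Rightarrow> 'o \<Rightarrow> 'f::complex_vector \<Rightarrow> 'f \<Rightarrow> 'f"
    and act :: "'o \<Rightarrow> 'o \<Rightarrow> 'h \<Rightarrow> 'f \<Rightarrow> 'f"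
    and obj :: "'o set" and hom :: "'o \<Rightarrow> 'o \<Rightarrow> 'f set" +
  fixes \<upsilon> :: "'o \<Rightarrow> 'o \<Rightarrow> 'f \<Rightarrow> 'f" and p1 p2 q1 q2 :: "'o \<Rightarrow> 'f"
  assumes act_one: "\<lbrakk>X \<in> obj; Y \<in> obj; f \<in> hom X Y\<rbrakk> \<Longrightarrow> act X Y 1 f = f"
    and u_linear: "clinear (\<upsilon> X Y)"
    and u_cmp: "\<upsilon> X Z (cmp X Y Z f' f) = cmp X Y Z (\<upsilon> Y Z f') (\<upsilon> X Y f)"
    and u_act: "\<upsilon> X Y (act X Y h f) = act X Y h (\<upsilon> X Y f)"
    and u_hom: "\<lbrakk>X \<in> obj; Y \<in> obj; f \<in> hom X Y\<rbrakk> \<Longrightarrow> \<upsilon> X Y f \<in> hom X Y"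
    and p_hom: "X \<in> obj \<Longrightarrow> p1 X \<in> hom X X" "X \<in> obj \<Longrightarrow> p2 X \<in> hom X X"
    and q_hom: "X \<in> obj \<Longrightarrow> q1 X \<in> hom X X" "X \<in> obj \<Longrightarrow> q2 X \<in> hom X X"
    and p_inv: "act X X h (p1 X) = counit H h *\<^sub>C p1 X" "act X X h (p2 X) = counit H h *\<^sub>C p2 X"
    and q_inv: "act X X h (q1 X) = counit H h *\<^sub>C q1 X" "act X X h (q2 X) = counit H h *\<^sub>C q2 X"
    and qp: "cmp X Y Y (q1 Y) (cmp X Y Y (p1 Y) (act X Y 1 f)) = act X Y 1 f"
      "cmp X Y Y (q1 Y) (cmp X Y Y (p2 Y) (\<upsilon> X Y f)) = 0"
      "cmp X Y Y (q2 Y) (cmp X Y Y (p1 Y) (act X Y 1 f)) = 0"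
      "cmp X Y Y (q2 Y) (cmp X Y Y (p2 Y) (\<upsilon> X Y f)) = \<upsilon> X Y f"
    and pq: "cmp X Y Y (p1 Y) (cmp X X Y (act X Y 1 f) (q1 X)) +
        cmp X Y Y (p2 Y) (cmp X X Y (\<upsilon> X Y f) (q2 X))
      = \<upsilon> X Y f"
    and q_u: "cmp X Y Y (q1 Y) (\<upsilon> X Y f) = cmp X X Y (act X Y 1 f) (q1 X)"
      "cmp X Y Y (q2 Y) (\<upsilon> X Y f) = cmp X X Y (\<upsilon> X Y f) (q2 X)"
    and u_p: "cmp X X Y (\<upsilon> X Y f) (p1 X) = cmp X Y Y (p1 Y) (act X Y 1 f)"
      "cmp X X Y (\<upsilon> X Y f) (p2 X) = cmp X Y Y (p2 Y) (\<upsilon> X Y f)"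
begin

lemma u_p': "cmp W X Y (\<upsilon> X Y f) (cmp W X X (p1 X) e) =
    cmp W Y Y (p1 Y) (cmp W X Y (act X Y 1 f) e)"
  "cmp W X Y (\<upsilon> X Y f) (cmp W X X (p2 X) e) = cmp W Y Y (p2 Y) (cmp W X Y (\<upsilon> X Y f) e)"
  by (metis cmp_assoc u_p(1)) (metis cmp_assoc u_p(2))

lemma act_one_cmp: "act X Z 1 (cmp X Y Z f' f) = cmp X Y Z (act Y Z 1 f') (act X Y 1 f)"
  unfolding act_cmp comul_one by (rule sweedler_tensor) (intro lin_rules)

lemma act_one_act: "act X Y 1 (act X Y h f) = act X Y h (act X Y 1 f)"
  by (simp flip: act_mult)

lemma cmp_scale [simp]: "cmp X Y Z (c *\<^sub>C f') f = c *\<^sub>C cmp X Y Z f' f"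
    "cmp X Y Z f' (c *\<^sub>C f) = c *\<^sub>C cmp X Y Z f' f"
  using clinear_scale[OF bilin_left[OF bilin_cmp clinear_id]]
    clinear_scale[OF bilin_right[OF bilin_cmp clinear_id]] by auto

lemma cmp_minus [simp]: "cmp X Y Z (- f') f = - cmp X Y Z f' f"
    "cmp X Y Z f' (- f) = - cmp X Y Z f' f"
  using clinear_minus[OF bilin_left[OF bilin_cmp clinear_id]]
    clinear_minus[OF bilin_right[OF bilin_cmp clinear_id]] by auto

lemma act_scale [simp]: "act X Y h (c *\<^sub>C f) = c *\<^sub>C act X Y h f"
    and act_zero [simp]: "act X Y h 0 = 0"
    and act_minus [simp]: "act X Y h (- f) = - act X Y h f"
  using clinear_scale[OF bilin_right[OF bilin_act clinear_id]] clinear_0[OF bilin_right[OF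
      bilin_act clinear_id]]
    clinear_minus[OF bilin_right[OF bilin_act clinear_id]]
  by auto

text \<open>Invariance of p and q leaves a counit in one Sweedler factor, so the whole of h acts on
  the other morphism.\<close>

lemma act_pq: "act X Y h (cmp X Y Y (p1 Y) f) = cmp X Y Y (p1 Y) (act X Y h f)"
  "act X Y h (cmp X Y Y (p2 Y) f) = cmp X Y Y (p2 Y) (act X Y h f)"
  "act X Y h (cmp X X Y f (q1 X)) = cmp X X Y (act X Y h f) (q1 X)"
  "act X Y h (cmp X X Y f (q2 X)) = cmp X X Y (act X Y h f) (q2 X)"
proof -
  have l: "clinear (\<lambda>k. cmp X Y Y v (act X Y k f))" and r: "clinear (\<lambda>k. cmp X X Y (act X Y k f)
      v)" for v
    by (intro clin_cmp clin_act clinear_id)+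
  show "act X Y h (cmp X Y Y (p1 Y) f) = cmp X Y Y (p1 Y) (act X Y h f)"
    "act X Y h (cmp X Y Y (p2 Y) f) = cmp X Y Y (p2 Y) (act X Y h f)"
    by (simp_all add: act_cmp p_inv sweedler_counit_left[OF l])
  show "act X Y h (cmp X X Y f (q1 X)) = cmp X X Y (act X Y h f) (q1 X)"
    "act X Y h (cmp X X Y f (q2 X)) = cmp X X Y (act X Y h f) (q2 X)"
    by (simp_all add: act_cmp q_inv sweedler_counit_right[OF r])
qed

text \<open>With \<open>\<alpha> f = diag (f, \<upsilon> f)\<close>, \<open>p = (p1, p2)\<close> a row and \<open>q\<close> the column of \<open>q1, q2\<close>, this is the
  block matrix \<open>R (\<alpha> f) L\<close> for the column \<open>R = (1 - s, p)\<close> and the row \<open>L = (1, s q)\<close>. It is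
  multiplicative in \<open>f\<close> because \<open>L R = (1 - s) + s q p = 1\<close>.\<close>

definition path_mat :: "complex \<Rightarrow> 'o \<Rightarrow> 'o \<Rightarrow> 'f \<Rightarrow> 'f^3^3" where
  "path_mat s X Y f = mat3
    ((1 - s) *\<^sub>C act X Y 1 f) 0 ((s - s\<^sup>2) *\<^sub>C cmp X X Y (act X Y 1 f) (q1 X))
    0 ((1 - s) *\<^sub>C \<upsilon> X Y f) ((s - s\<^sup>2) *\<^sub>C cmp X X Y (\<upsilon> X Y f) (q2 X))
    (cmp X Y Y (p1 Y) (act X Y 1 f)) (cmp X Y Y (p2 Y) (\<upsilon> X Y f)) (s *\<^sub>C \<upsilon> X Y f)"

definition gen :: "'o \<Rightarrow> 'f^3^3" where
  "gen X = mat3 0 0 (- q1 X) 0 0 (- q2 X) 0 0 0"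

lemma cmp_diff: "cmp X Y Z (f' - g') f = cmp X Y Z f' f - cmp X Y Z g' f"
    "cmp X Y Z f' (f - g) = cmp X Y Z f' f - cmp X Y Z f' g"
  using clinear_diff[OF bilin_left[OF bilin_cmp clinear_id]]
    clinear_diff[OF bilin_right[OF bilin_cmp clinear_id]] by auto

lemma path_mat_cmp:
  "path_mat s X Z (cmp X Y Z f' f) = mat_cmp cmp X Y Z (path_mat s Y Z f') (path_mat s X Y f)"
proof -
  \<comment> \<open>For the entry (3, 3): by \<open>pq\<close> for the composite, the two
    off-diagonal products contribute s - s^2 times \<upsilon> (f' f), which together with s^2 from
    the diagonal gives s.\<close>
  have "cmp X Z Z (p1 Z) (cmp X Y Z (act Y Z 1 f') (cmp X X Y (act X Y 1 f) (q1 X))) +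
    cmp X Z Z (p2 Z) (cmp X Y Z (\<upsilon> Y Z f') (cmp X X Y (\<upsilon> X Y f) (q2 X))) =
        cmp X Y Z (\<upsilon> Y Z f') (\<upsilon> X Y f)"
    using pq[of X Z "cmp X Y Z f' f"] by (simp add: act_one_cmp u_cmp cmp_assoc)
  then have e: "cmp X Z Z (p1 Z) (cmp X Y Z (act Y Z 1 f') (cmp X X Y (act X Y 1 f) (q1 X))) =
     cmp X Y Z (\<upsilon> Y Z f') (\<upsilon> X Y f) - cmp X Z Z (p2 Z) (cmp X Y Z (\<upsilon> Y Z f') (cmp X X Y (\<upsilon> X Y f)
         (q2 X)))"
    by (simp add: eq_diff_eq)
  show ?thesis
    unfolding path_mat_def
    by (simp add: mat3_eq_iff forall_3 mat_cmp_def sum_3 act_one_cmp u_cmp cmp_assoc qp q_u u_p' e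
        power2_eq_square algebra_simps cmp_diff scaleC_scaleC scaleC_one)
qed

lemma path_mat_semifunctor: "mat_semifunctor H M cmp act obj hom (path_mat s) gen"
proof (intro mat_semifunctor.intro mat_semifunctor_axioms.intro)
  show "matrix_complex H M cmp act obj hom" by (rule matrix_complex_axioms)
  show "clinear (path_mat s X Y)" for X Y
    unfolding path_mat_def[abs_def]
    by (intro clinear_mat3 clin clin_cmp clin_act clinear_comp[OF u_linear])
  show "path_mat s X Z (cmp X Y Z f' f) = mat_cmp cmp X Y Z (path_mat s Y Z f') (path_mat s X Y
      f)" for X Y Z f' f
    by (rule path_mat_cmp)
  show "path_mat s X Y (act X Y h f) = mat_act act X Y h (path_mat s X Y f)" for X Y h f
    by (simp add: path_mat_def mat3_eq_iff forall_3 mat_act_def u_act act_one_act act_pq)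
  show "path_mat s X Y f \<in> mat_hom hom X Y" if "X \<in> obj" "Y \<in> obj" "f \<in> hom X Y" for X Y f
    using that p_hom q_hom u_hom
    by (auto simp: mat_hom_def forall_3 path_mat_def act_one cvec.subspace_0[OF hom_subspace]
        intro!: cvec.subspace_scale[OF hom_subspace] cmp_closed)
  show "mat_act act X X h (gen X) = counit H h *\<^sub>C gen X" for X h
    by (simp add: gen_def mat3_eq_iff forall_3 mat_act_def q_inv)
  show "gen X \<in> mat_hom hom X X" if "X \<in> obj" for X
    using that q_hom
    by (auto simp: mat_hom_def forall_3 gen_def cvec.subspace_0[OF hom_subspace] intro!:
        cvec.subspace_neg[OF hom_subspace])
qed

definition path_B :: "'o \<Rightarrow> 'o \<Rightarrow> 'f \<Rightarrow> 'f^3^3" where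
  "path_B X Y f = mat3 (- act X Y 1 f) 0 0 0 (- \<upsilon> X Y f) 0 0 0 (\<upsilon> X Y f)"

definition path_C :: "'o \<Rightarrow> 'o \<Rightarrow> 'f \<Rightarrow> 'f^3^3" where
  "path_C X Y f = mat3 0 0 (cmp X X Y (act X Y 1 f) (q1 X)) 0 0 (cmp X X Y (\<upsilon> X Y f) (q2 X)) 0 0 0"

lemma path_mat_poly: "path_mat s X Y f = path_mat 0 X Y f + s *\<^sub>C path_B X Y f +
    (s - s\<^sup>2) *\<^sub>C path_C X Y f"
  by (simp add: path_mat_def path_B_def path_C_def mat3_eq_iff forall_3
      cvec.scale_left_diff_distrib scaleC_one)

lemma path_mat_deriv: "mat_cmp cmp X Y Y (gen Y) (path_mat s X Y f) - mat_cmp cmp X X Y (path_mat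
    s X Y f) (gen X) =
  path_B X Y f + (1 - 2 * s) *\<^sub>C path_C X Y f"
proof -
  \<comment> \<open>The entry (3, 3) of the commutator: the last row of \<open>gen\<close> is 0, so
    only the product p \<alpha> q remains.\<close>
  have "cmp X X Y (cmp X Y Y (p1 Y) (act X Y 1 f)) (q1 X) +
      cmp X X Y (cmp X Y Y (p2 Y) (\<upsilon> X Y f)) (q2 X) = \<upsilon> X Y f"
    by (simp add: cmp_assoc pq)
  \<comment> \<open>The entries (1, 3) and (2, 3): \<open>path_mat\<close> times \<open>gen\<close>
    supplies 1 - s and the reverse product -s.\<close>
  moreover have "(1 - s) *\<^sub>C v - s *\<^sub>C v = (1 - 2 * s) *\<^sub>C v" for v :: 'f
    by (simp add: cvec.scale_left_diff_distrib[symmetric])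
  ultimately show ?thesis
    by (simp add: path_mat_def path_B_def path_C_def gen_def mat3_eq_iff forall_3 mat_cmp_def
        sum_3 qp q_u add.commute)
qed

text \<open>At s = 0 the third column vanishes and the first two rows are diagonal. The empty list
  is excluded at (3, 3), since the empty product has entry 1 there.\<close>

lemma mat_prod_path_0:
  fixes as :: "('o, 'f) arrow list"
  defines "r \<equiv> map (\<lambda>(X, Y, f). (X, Y, path_mat 0 X Y f))"
  shows "mat_prod_list (r as) 1 j = (if j = 1 then pure (map (\<lambda>(X, Y, f). (X, Y,
      act X Y 1 f)) as) else 0)"
    and "mat_prod_list (r as) 2 j = (if j = 2 then pure (map (\<lambda>(X, Y, f). (X, Y,
        \<upsilon> X Y f)) as) else 0)"
    and "as \<noteq> [] \<Longrightarrow> mat_prod_list (r as) 3 3 = 0"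
proof -
  note s = sum_3 r_def entry_def path_mat_def scaleC_one chain_cons_zero_left lin_simps
      chain_cons_pure
  show 1: "mat_prod_list (r as) 1 j = (if j = 1 then pure (map (\<lambda>(X, Y, f). (X, Y,
      act X Y 1 f)) as) else 0)" for as j
    by (induction as) (auto simp: s)
  show 2: "mat_prod_list (r as) 2 j = (if j = 2 then pure (map (\<lambda>(X, Y, f). (X, Y,
      \<upsilon> X Y f)) as) else 0)" for as j
    by (induction as) (auto simp: s)
  show "as \<noteq> [] \<Longrightarrow> mat_prod_list (r as) 3 3 = 0"
    using 1[of _ 3] 2[of _ 3] by (cases as) (auto simp: s)
qed

text \<open>At s = 1 the first two rows vanish, so only the corner (3, 3) contributes to the
  trace.\<close>

lemma mat_prod_path_1:
  fixes as :: "('o, 'f) arrow list"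
  defines "r \<equiv> map (\<lambda>(X, Y, f). (X, Y, path_mat 1 X Y f))"
  shows "as \<noteq> [] \<Longrightarrow> mat_prod_list (r as) 1 j = 0"
    and "as \<noteq> [] \<Longrightarrow> mat_prod_list (r as) 2 j = 0"
    and "mat_prod_list (r as) 3 3 = pure (map (\<lambda>(X, Y, f). (X, Y, \<upsilon> X Y f)) as)"
proof -
  note s = sum_3 r_def entry_def path_mat_def scaleC_one chain_cons_zero_left lin_simps
      chain_cons_pure
  show 1: "as \<noteq> [] \<Longrightarrow> mat_prod_list (r as) 1 j = 0" for as j
    by (cases as) (auto simp: s)
  show 2: "as \<noteq> [] \<Longrightarrow> mat_prod_list (r as) 2 j = 0" for as j
    by (cases as) (auto simp: s)
  have 3: "mat_prod_list (r as) 1 3 = 0" "mat_prod_list (r as) 2 3 = 0" for as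
    using 1[of as 3] 2[of as 3] by (cases as; simp add: r_def)+
  show "mat_prod_list (r as) 3 3 = pure (map (\<lambda>(X, Y, f). (X, Y, \<upsilon> X Y f)) as)"
    using 3 by (induction as) (auto simp: s)
qed

text \<open>The image of the string under \<upsilon> sits at (2, 2) for s = 0 and at (3, 3) for s =
  1, so it occurs on both sides; \<open>pure as\<close> comes from (1, 1), the projection being the
  identity on strings.\<close>

lemma path_endpoints:
  assumes "as \<in> cyc n"
  shows "chain_trace (pure (map (\<lambda>(X, Y, f). (X, Y, path_mat 0 X Y f)) as)) =
    pure as + chain_trace (pure (map (\<lambda>(X, Y, f). (X, Y, path_mat 1 X Y f)) as))"
proof -
  have ne: "as \<noteq> []" using assms by (auto simp: cyc_def)
  have "is_path Y as X \<Longrightarrow> map (\<lambda>(X, Y, f). (X, Y, act X Y 1 f)) as = as" for X Y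
    by (induction as arbitrary: Y) (auto simp: act_one)
  then have "map (\<lambda>(X, Y, f). (X, Y, act X Y 1 f)) as = as" using assms by (auto simp: cyc_def)
  then show ?thesis
    by (simp add: chain_trace_def sum_3 mat_prod_pure mat_prod_path_0 mat_prod_path_1 ne)
qed

sublocale semifunctor_path H M cmp act obj hom "path_mat 0" path_B path_C gen "\<lambda>t. path_mat
    (of_real t)"
proof (intro semifunctor_path.intro semifunctor_path_axioms.intro)
  show "matrix_complex H M cmp act obj hom" by (rule matrix_complex_axioms)
  show "path_mat (of_real t) X Y f = path_mat 0 X Y f + of_real t *\<^sub>C path_B X Y f
      + of_real (t - t\<^sup>2) *\<^sub>C path_C X Y f" for t X Y f
    using path_mat_poly[of "of_real t"] by simp
qed (simp_all add: path_mat_semifunctor path_mat_deriv path_endpoints)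

end

section \<open>Single faces\<close>

context bilinear_ops
begin

fun face_list :: "nat \<Rightarrow> ('o, 'f) arrow list \<Rightarrow> ('o, 'f) chain" where
  "face_list 0 as = face0_list as"
| "face_list (Suc i) (x # as) = chain_cons x (face_list i as)"
| "face_list (Suc i) [] = 0"

lemma multilin_face_list: "multilin (face_list i)"
proof (rule multilinI)
  fix as X Y bs
  show "clinear (\<lambda>f. face_list i (as @ (X, Y, f) # bs))"
  proof (induction as arbitrary: i)
    case Nil
    show ?case
    proof (cases i)
      case 0
      show ?thesis
        using multilinD[OF multilin_face0_list alinI[OF clinear_id], of "[]"] by (simp add: 0)
    qed (simp, intro clin_ops)
  next
    case (Cons x as)
    show ?case
    proof (cases i)
      case 0
      show ?thesis
        using multilinD[OF multilin_face0_list alinI[OF clinear_id], of "x # as"] by (simp add: 0)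
    qed (simp, intro clin_ops Cons)
  qed
qed

definition face :: "nat \<Rightarrow> ('o, 'f) chain \<Rightarrow> ('o, 'f) chain" where
  "face i = chain_lift (face_list i)"

lemma clinear_face: "clinear (face i)"
  unfolding face_def by (rule clinear_chain_lift[OF multilin_face_list])

lemma face_pure: "face i (pure as) = face_list i as"
  unfolding face_def by (rule chain_lift_pure[OF multilin_face_list])

lemma face_list_eq:
  "Suc i < length as \<Longrightarrow> face_list i as = pure (take i as @ [cm (as ! i) (as ! Suc i)] @ drop (i +
      2) as)"
proof (induction i as rule: face_list.induct)
  case (1 as)
  then show ?case by (cases as rule: remdups_adj.cases) (auto simp: chain_cons_pure)
next
  case (2 i x as)
  then show ?case by (simp add: chain_cons_pure)
qed simp

lemma faces_eq_sum: "length as = Suc (Suc n) \<Longrightarrow> faces (pure as) =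
    (\<Sum>i\<le>n. (-1) ^ i *\<^sub>C face i (pure as))"
proof (induction n arbitrary: as)
  case 0
  then obtain x y where "as = [x, y]" by (auto simp: length_Suc_conv)
  then show ?case by (simp add: faces_Cons2 face_pure lin_simps scaleC_one)
next
  case (Suc n)
  then obtain x y bs where as: "as = x # y # bs" by (auto simp: length_Suc_conv)
  then have "faces (pure (y # bs)) = (\<Sum>i\<le>n. (-1) ^ i *\<^sub>C face i (pure (y # bs)))"
    using Suc by simp
  then show ?case
    unfolding as sum.atMost_Suc_shift
    by (simp add: faces_Cons2 face_pure scaleC_one clinear_sum[OF clinear_chain_cons] lin_simps
        sum_negf[symmetric])
qed

end

section \<open>The complex of a left H-category\<close>

locale hcategory_sayd = hopf_sayd H M + left_hcategory H D
  for H :: "'h::complex_algebra_1 hopf" and M :: "('m::complex_vector, 'h) hopf_mod"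
    and D :: "('o, 'f::complex_vector, 'h) hcat"
begin

abbreviation proj :: "'o \<Rightarrow> 'o \<Rightarrow> 'f \<Rightarrow> 'f" where
  "proj X Y \<equiv> subspace_proj (Hom D X Y)"

lemma
  assumes "X \<in> Ob D" "Y \<in> Ob D"
  shows clinear_proj: "clinear (proj X Y)" and proj_in: "proj X Y f \<in> Hom D X Y"
    and proj_id: "f \<in> Hom D X Y \<Longrightarrow> proj X Y f = f"
  using clinear_subspace_proj subspace_proj_in subspace_proj_id Hom_subspace assms by blast+

text \<open>Composition and action are extended from the Hom spaces to the ambient space along linear
  projections (and by 0 for pairs outside \<open>Ob D\<close>), so that they become bilinear everywhere and
  induce operators on the whole space of chains.\<close>

definition gcmp :: "'o \<Rightarrow> 'o \<Rightarrow> 'o \<Rightarrow> 'f \<Rightarrow> 'f \<Rightarrow> 'f" where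
  "gcmp X Y Z f' f = (if X \<in> Ob D \<and> Y \<in> Ob D \<and> Z \<in> Ob D then Comp D X Y Z (proj Y Z f') (proj X Y
      f) else 0)"

definition gact :: "'o \<Rightarrow> 'o \<Rightarrow> 'h \<Rightarrow> 'f \<Rightarrow> 'f" where
  "gact X Y h f = (if X \<in> Ob D \<and> Y \<in> Ob D then Act D X Y h (proj X Y f) else 0)"

lemma gcmp_eq: "\<lbrakk>X \<in> Ob D; Y \<in> Ob D; Z \<in> Ob D; f \<in> Hom D X Y; f' \<in> Hom D Y Z\<rbrakk>
  \<Longrightarrow> gcmp X Y Z f' f = Comp D X Y Z f' f"
  by (simp add: gcmp_def proj_id)

lemma gact_eq: "\<lbrakk>X \<in> Ob D; Y \<in> Ob D; f \<in> Hom D X Y\<rbrakk> \<Longrightarrow> gact X Y h f = Act D X Y h f"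
  by (simp add: gact_def proj_id)

lemma bilin_gcmp: "bilin (gcmp X Y Z)"
proof (cases "X \<in> Ob D \<and> Y \<in> Ob D \<and> Z \<in> Ob D")
  case True
  then have "clinear (\<lambda>a. Comp D X Y Z (proj Y Z a) (proj X Y b))"
    "clinear (\<lambda>a. Comp D X Y Z (proj Y Z b) (proj X Y a))" for b
    by (auto intro!: clinear_linear_on_comp[OF Comp_linear_left] clinear_linear_on_comp[OF
        Comp_linear_right]
        clinear_proj proj_in)
  with True show ?thesis by (simp add: gcmp_def[abs_def] bilin_def)
qed (auto simp: gcmp_def[abs_def] bilin_def clinear_zero)

lemma bilin_gact: "bilin (gact X Y)"
proof (cases "X \<in> Ob D \<and> Y \<in> Ob D")
  case True
  then have "clinear (\<lambda>h. Act D X Y h (proj X Y b))" "clinear (\<lambda>a. Act D X Y h (proj X Y a))"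
    for b h
    by (auto intro!: clinear_linear_on_comp[OF Act_linear_right] Act_linear_left clinear_proj
        proj_in)
  with True show ?thesis by (simp add: gact_def[abs_def] bilin_def)
qed (auto simp: gact_def[abs_def] bilin_def clinear_zero)

sublocale matrix_complex H M gcmp gact "Ob D" "Hom D"
proof (intro matrix_complex.intro cyclic_complex.intro cochain_ops.intro hcat_ops.intro
    hopf_ops.intro
    hom_ops.intro bilinear_ops.intro hom_ops_axioms.intro hcat_ops_axioms.intro
        matrix_complex_axioms.intro)
  show "hopf_sayd H M" "hopf_algebra H" by (rule hopf_sayd_axioms hopf_algebra_axioms)+
  show "bilin (gcmp X Y Z)" "bilin (gact X Y)" for X Y Z by (rule bilin_gcmp bilin_gact)+
  show "gact X Y (g * h) f = gact X Y g (gact X Y h f)" for X Y g h f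
    by (simp add: gact_def proj_id Act_closed proj_in Act_mult)
  have a0: "gact X Y h 0 = 0" for X Y h
    using clinear_0[OF bilin_right[OF bilin_gact clinear_id]] .
  have c0: "gcmp X Y Z 0 f = 0" "gcmp X Y Z f 0 = 0" for X Y Z f
    using clinear_0[OF bilin_left[OF bilin_gcmp clinear_id]] clinear_0[OF bilin_right[OF
        bilin_gcmp clinear_id]] by auto
  \<comment> \<open>Off the objects all operations are 0; on them the projections land in the Hom
    spaces, so every law reduces to an axiom of the category.\<close>
  have no: "gcmp X Y Z f' f = 0" if "\<not> (X \<in> Ob D \<and> Y \<in> Ob D \<and> Z \<in> Ob D)" for X Y Z f' f
    using that by (auto simp: gcmp_def)
  show "gact X Z h (gcmp X Y Z f' f) = (\<Sum>\<langle>h1 \<otimes> h2 \<leftarrow> comul H h\<rangle>.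
      gcmp X Y Z (gact Y Z h1 f') (gact X Y h2 f))"
    for X Y Z h f' f
  proof (cases "X \<in> Ob D \<and> Y \<in> Ob D \<and> Z \<in> Ob D")
    case True
    then show ?thesis
      by (simp add: gact_def gcmp_def proj_id Act_closed Comp_closed proj_in Act_Comp)
  next
    case False
    then show ?thesis by (simp add: no a0 sweedler_zero)
  qed
  show "gcmp W X Z (gcmp X Y Z f' f) e = gcmp W Y Z f' (gcmp W X Y f e)" for W X Y Z f' f e
  proof (cases "W \<in> Ob D \<and> X \<in> Ob D \<and> Y \<in> Ob D \<and> Z \<in> Ob D")
    case True
    then show ?thesis by (simp add: gcmp_def proj_id Comp_closed proj_in Comp_assoc)
  next
    case False
    then show ?thesis
      by (cases "X \<in> Ob D \<and> Y \<in> Ob D \<and> Z \<in> Ob D"; cases "W \<in> Ob D \<and> X \<in> Ob D \<and> Y \<in> Ob D")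
        (auto simp: no c0)
  qed
qed (simp_all add: gcmp_eq gact_eq Comp_closed Act_closed Hom_subspace bilin_gcmp bilin_gact)

text \<open>Translates the recursive notion into the indexed objects of
  \<open>cyclic_strings\<close>.\<close>

lemma is_path_iff: "is_path Y as Z \<longleftrightarrow> (\<exists>X. X 0 = Y \<and> X (length as) = Z \<and>
  (\<forall>i<length as. src (as ! i) = X (Suc i) \<and> tgt (as ! i) = X i \<and> is_arrow (as ! i)))"
proof (induction as arbitrary: Y)
  case (Cons x as)
  show ?case
  proof
    assume p: "is_path Y (x # as) Z"
    then obtain X where X: "X 0 = src x" "X (length as) = Z"
      "\<forall>i<length as. src (as ! i) = X (Suc i) \<and> tgt (as ! i) = X i \<and> is_arrow (as ! i)"
      using Cons by auto
    show "\<exists>X. X 0 = Y \<and> X (length (x # as)) = Z \<and>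
      (\<forall>i<length (x # as). src ((x # as) ! i) = X (Suc i) \<and> tgt ((x # as) ! i) = X i \<and>
          is_arrow ((x # as) ! i))"
      \<comment> \<open>The new target is put in front of the sequence of objects of the
        tail.\<close>
      by (rule exI[of _ "case_nat Y X"]) (use p X in \<open>auto simp: nth_Cons split: nat.split\<close>)
  next
    assume "\<exists>X. X 0 = Y \<and> X (length (x # as)) = Z \<and>
      (\<forall>i<length (x # as). src ((x # as) ! i) = X (Suc i) \<and> tgt ((x # as) ! i) = X i \<and>
          is_arrow ((x # as) ! i))"
    then obtain X where X: "X 0 = Y" "X (length (x # as)) = Z"
      "\<And>i. i < length (x # as) \<Longrightarrow> src ((x # as) ! i) = X (Suc i) \<and> tgt ((x # as) ! i) = X i \<and>
          is_arrow ((x # as) ! i)"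
      by auto
    have a: "is_arrow ((x # as) ! i)" and e: "src ((x # as) ! i) =
        X (Suc i)" "tgt ((x # as) ! i) = X i"
      if "i < length (x # as)" for i using X(3)[OF that] by blast+
    have X0: "src x = X (Suc 0) \<and> tgt x = X 0 \<and> is_arrow x"
    proof -
      have "0 < length (x # as)" by simp
      from a[OF this] e[OF this] show ?thesis unfolding nth_Cons_0 by blast
    qed
    have XS: "src (as ! i) = X (Suc (Suc i)) \<and> tgt (as ! i) = X (Suc i) \<and> is_arrow (as ! i)"
      if "i < length as" for i
    proof -
      have "Suc i < length (x # as)" using that by simp
      from a[OF this] e[OF this] show ?thesis unfolding nth_Cons_Suc by blast
    qed
    have "is_path (src x) as Z"
      unfolding Cons
    proof (intro exI[of _ "\<lambda>i. X (Suc i)"] conjI[of "_ = _"] allI impI)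
      show "X (Suc 0) = src x" "X (Suc (length as)) = Z" using X0 X(2) by simp_all
    qed (use XS in blast)+
    then show "is_path Y (x # as) Z" unfolding X(1)[symmetric] is_path.simps using X0 by blast
  qed
qed auto

lemma cyclic_strings_eq: "cyclic_strings D n = cyc n"
proof (intro set_eqI iffI)
  fix as assume "as \<in> cyclic_strings D n"
  then obtain X f where as: "as = map (\<lambda>i. (X (Suc i), X i, f i)) [0..<Suc n]" and
    X: "X (Suc n) = X 0" "\<And>i. i \<le> n \<Longrightarrow> X i \<in> Ob D \<and> f i \<in> Hom D (X (Suc i)) (X i)"
    by (auto simp: cyclic_strings_def)
  have l: "length as = Suc n" by (simp add: as)
  \<comment> \<open>Membership is given for indices up to n only; the index n + 1 is covered by the
    wrap-around to \<open>X 0\<close>.\<close>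
  have ob: "X (Suc i) \<in> Ob D" if "i \<le> n" for i
    using X(2)[of "Suc i"] X(2)[of 0] X(1) that by (cases "i = n") auto
  have nt: "as ! i = (X (Suc i), X i, f i)" if "i < Suc n" for i
    unfolding as using that by (simp del: upt_Suc)
  have "is_path (X 0) as (X 0)"
    unfolding is_path_iff l by (rule exI[of _ X]) (use X ob nt in auto)
  then show "as \<in> cyc n" using l by (auto simp: cyc_def)
next
  fix as assume "as \<in> cyc n"
  then obtain Y where l: "length as = Suc n" and "is_path Y as Y" by (auto simp: cyc_def)
  then obtain X where X: "X 0 = Y" "X (Suc n) = Y"
    "\<And>i. i < Suc n \<Longrightarrow> src (as ! i) = X (Suc i) \<and> tgt (as ! i) = X i \<and> is_arrow (as ! i)"
    unfolding is_path_iff by auto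
  have "as ! i = (X (Suc i), X i, snd (snd (as ! i)))" if "i < Suc n" for i
    using X(3)[OF that] by (cases "as ! i") auto
  then have "as = map (\<lambda>i. (X (Suc i), X i, snd (snd (as ! i)))) [0..<Suc n]"
    by (intro nth_equalityI) (simp_all add: l del: upt_Suc)
  moreover have "X i \<in> Ob D \<and> snd (snd (as ! i)) \<in> Hom D (X (Suc i)) (X i)" if "i \<le> n" for i
    using X(3)[of i] that by auto
  ultimately show "as \<in> cyclic_strings D n"
    unfolding cyclic_strings_def using X(1,2)
    by (intro CollectI exI[of _ X] exI[of _ "\<lambda>i. snd (snd (as ! i))"] conjI) simp_all
qed

lemma CN_eq: "CN D n = cyc_span n"
  by (simp add: CN_def cyc_span_def cyclic_strings_eq)

lemma is_arrow_comp: "is_arrow x \<Longrightarrow> is_arrow y \<Longrightarrow> src x = tgt y \<Longrightarrow> comp_arrow D x y = cm x y"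
  by (cases x; cases y) (simp add: gcmp_eq)

lemma is_arrow_act: "is_arrow x \<Longrightarrow> act_arrow D h x = ac h x"
  by (cases x) (simp add: gact_eq)

lemma diag_act_eq: "is_path Y as X \<Longrightarrow> diag_act H D h as = dact h (pure as)"
proof (induction as arbitrary: Y h)
  case (Cons x as)
  have "diag_act H D k as = dact k (pure as)" for k using Cons by auto
  moreover have "act_arrow D k x = ac k x" for k using Cons(2) by (intro is_arrow_act) auto
  ultimately show ?case by (simp add: pure_Cons dact_cons)
qed (simp add: dact_Nil)

text \<open>Restricted to strings because elsewhere the unit of H acts by the projections.\<close>

lemma dact_one: "as \<in> cyc n \<Longrightarrow> dact 1 (pure as) = pure as"
proof -
  have "is_path Y as X \<Longrightarrow> dact 1 (pure as) = pure as" for X Y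
  proof (induction as arbitrary: Y)
    case (Cons x as)
    have "ac 1 x = x" using Cons(2) by (cases x) (simp add: gact_eq Act_one)
    moreover have "dact 1 (pure (x # as)) = chain_cons (ac 1 x) (dact 1 (pure as))"
      unfolding pure_Cons dact_cons comul_one by (rule sweedler_tensor) (intro lin_rules)
    ultimately show ?case using Cons by (auto simp: pure_Cons)
  qed (simp add: dact_Nil counit_one scaleC_one)
  then show "as \<in> cyc n \<Longrightarrow> dact 1 (pure as) = pure as" by (auto simp: cyc_def)
qed

lemma dact_one_cyc: "c \<in> cyc_span n \<Longrightarrow> dact 1 c = c"
  by (rule cyc_span_eq[OF clinear_dact clinear_id dact_one])

section \<open>Cochains of the statement as bilinear maps\<close>

abbreviation MC :: "nat \<Rightarrow> ('m \<otimes> ('o, 'f) chain) set" where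
  "MC n \<equiv> subspace_tensor UNIV (CN D n)"

lemma subspace_MC: "cvec.subspace (MC n)"
  by (simp add: subspace_tensor_def cvec.subspace_span)

lemma MC_in: "c \<in> cyc_span n \<Longrightarrow> m \<otimes> c \<in> MC n"
  unfolding subspace_tensor_def CN_eq by (rule cvec.span_base) auto

lemma MC_eq: "MC n = cvec.span ((\<lambda>(m, as). m \<otimes> pure as) ` (UNIV \<times> cyc n))"
proof
  show "MC n \<subseteq> cvec.span ((\<lambda>(m, as). m \<otimes> pure as) ` (UNIV \<times> cyc n))"
    unfolding subspace_tensor_def CN_eq
  proof (rule cvec.span_minimal[OF _ cvec.subspace_span], rule subsetI)
    fix x :: "'m \<otimes> ('o, 'f) chain" assume "x \<in> {v \<otimes> w |v w. v \<in> UNIV \<and> w \<in> cyc_span n}"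
    then obtain m c where x: "x = m \<otimes> c" and c: "c \<in> cyc_span n" by auto
    show "x \<in> cvec.span ((\<lambda>(m, as). m \<otimes> pure as) ` (UNIV \<times> cyc n))"
      unfolding x
    proof (rule cyc_span_image[OF _ _ cvec.subspace_span c])
      show "clinear (\<lambda>c. m \<otimes> c)" by (intro clin_tensor clin)
      show "m \<otimes> pure as \<in> cvec.span ((\<lambda>(m, as). m \<otimes> pure as) ` (UNIV \<times> cyc n))" if "as \<in> cyc n"
        for as
        by (rule cvec.span_base, rule image_eqI[where x="(m, as)"]) (use that in auto)
    qed
  qed
  show "cvec.span ((\<lambda>(m, as). m \<otimes> pure as) ` (UNIV \<times> cyc n)) \<subseteq> MC n"
    by (rule cvec.span_minimal[OF _ subspace_MC]) (auto intro: MC_in cyc_span_pure)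
qed

text \<open>\<open>cut n\<close> and \<open>curried n\<close> translate between the cochains of the statement, which are 0 outside of
  \<open>M \<otimes> CN\<^sub>n\<close>, and bilinear maps, of which only the values on \<open>CN\<^sub>n\<close> matter.\<close>

definition cut :: "nat \<Rightarrow> ('m \<Rightarrow> ('o, 'f) chain \<Rightarrow> complex) \<Rightarrow> 'm \<otimes> ('o, 'f) chain \<Rightarrow> complex" where
  "cut n \<Phi> x = (if x \<in> MC n then sweedler x \<Phi> else 0)"

definition curried :: "nat \<Rightarrow> ('m \<otimes> ('o, 'f) chain \<Rightarrow> complex) \<Rightarrow> 'm \<Rightarrow> ('o, 'f) chain \<Rightarrow> complex" where
  "curried n \<phi> m c = \<phi> (subspace_proj (MC n) (m \<otimes> c))"

lemma linear_on_cut: "bilin \<Phi> \<Longrightarrow> linear_on (MC n) (cut n \<Phi>)"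
  using sweedler_clinear[of \<Phi>]
  by (auto simp: linear_on_def cut_def cvec.subspace_add[OF subspace_MC] cvec.subspace_scale[OF
      subspace_MC]
      clinear_iff)

lemma cut_outside: "x \<notin> MC n \<Longrightarrow> cut n \<Phi> x = 0"
  by (simp add: cut_def)

lemma cut_tensor: "bilin \<Phi> \<Longrightarrow> c \<in> cyc_span n \<Longrightarrow> cut n \<Phi> (m \<otimes> c) = \<Phi> m c"
  by (simp add: cut_def MC_in sweedler_tensor)

lemma cut_sweedler:
  assumes "bilin \<Phi>" "bilin \<beta>" "\<And>a b. \<beta> a b \<in> MC n"
  shows "cut n \<Phi> (sweedler t \<beta>) = sweedler t (\<lambda>a b. cut n \<Phi> (\<beta> a b))"
  using sweedler_in_subspace[OF assms(2) subspace_MC assms(3)] assms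
  by (simp add: cut_def sweedler_sweedler)

lemma eq_cutI:
  assumes "linear_on (MC n) f" "\<And>x. x \<notin> MC n \<Longrightarrow> f x = 0" "bilin \<Phi>"
    "\<And>m as. as \<in> cyc n \<Longrightarrow> f (m \<otimes> pure as) = \<Phi> m (pure as)"
  shows "f = cut n \<Phi>"
proof
  fix x
  show "f x = cut n \<Phi> x"
  proof (cases "x \<in> MC n")
    case True
    show ?thesis
      by (rule linear_on_eq_on_span[OF assms(1)[unfolded MC_eq] linear_on_cut[OF assms(3), of n,
          unfolded MC_eq] _ True[unfolded MC_eq]])
        (use assms in \<open>auto simp: cut_tensor cyc_span_pure\<close>)
  qed (simp add: assms cut_def)
qed

lemma functional_eq:
  assumes "bilin \<Phi>" "\<And>m as. as \<in> cyc n \<Longrightarrow> \<Phi> m (pure as) = F m as"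
  shows "functional D n F = cut n \<Phi>"
proof -
  have "functional D n F = (\<lambda>x. if x \<in> cvec.span ((\<lambda>(m,
      as). m \<otimes> pure as) ` (UNIV \<times> cyclic_strings D n)) then sweedler x \<Phi> else 0)"
    unfolding functional_def
    by (rule lin_ext_eq[OF linear_on_clinear[OF sweedler_clinear[OF assms(1)]]])
      (use assms in \<open>auto simp: cyclic_strings_eq sweedler_tensor\<close>)
  then show ?thesis by (simp add: cut_def MC_eq cyclic_strings_eq fun_eq_iff)
qed

lemma cut_eq_iff:
  assumes "bilin \<Phi>" "bilin \<Psi>"
  shows "cut n \<Phi> = cut n \<Psi> \<longleftrightarrow> (\<forall>m. \<forall>c\<in>cyc_span n. \<Phi> m c = \<Psi> m c)"
proof
  assume "cut n \<Phi> = cut n \<Psi>"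
  then show "\<forall>m. \<forall>c\<in>cyc_span n. \<Phi> m c = \<Psi> m c" using cut_tensor assms by metis
next
  assume "\<forall>m. \<forall>c\<in>cyc_span n. \<Phi> m c = \<Psi> m c"
  then show "cut n \<Phi> = cut n \<Psi>"
    by (intro eq_cutI linear_on_cut assms) (auto simp: cut_def[of n \<Phi>] MC_in cyc_span_pure
        sweedler_tensor assms)
qed

lemma cut_zero: "cut n (\<lambda>m c. 0) = (\<lambda>x. 0)"
  by (auto simp: cut_def sweedler_zero)

lemma bilin_zero: "bilin (\<lambda>m c. 0)"
  by (simp add: bilin_def clinear_zero)

lemma bilin_curried: "linear_on (MC n) \<phi> \<Longrightarrow> bilin (curried n \<phi>)"
  unfolding curried_def[abs_def]
  by (intro bilinI clinear_comp[OF clinear_linear_on_comp[OF _ clinear_subspace_proj[OF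
      subspace_MC] subspace_proj_in[OF subspace_MC]]]
      clin_tensor clin)

lemma cut_curried:
  assumes "linear_on (MC n) \<phi>" "\<And>x. x \<notin> MC n \<Longrightarrow> \<phi> x = 0"
  shows "\<phi> = cut n (curried n \<phi>)"
  by (rule eq_cutI[OF assms bilin_curried[OF assms(1)]])
    (simp_all add: curried_def subspace_proj_id[OF subspace_MC] MC_in cyc_span_pure)

text \<open>One direction expands \<epsilon>(h_2) as S(h_2) h_3 so that the cochain condition
  applies to h_1 and h_2; the other moves h_1 to the chain, where h_1 S(h_2) collapses.\<close>

lemma cut_in_cochains:
  assumes b: "bilin \<Phi>"
  shows "cut n \<Phi> \<in> cochains H D M n \<longleftrightarrow> invariant n \<Phi>"
proof -
  note L = lin_rules_M bilin_left[OF b] bilin_right[OF b]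
  have sw: "cut n \<Phi> (\<Sum>\<langle>h1 \<otimes> h2 \<leftarrow> comul H h\<rangle>. ract M m h1 \<otimes> diag_act H D (antipode H h2) as) =
    (\<Sum>\<langle>h1 \<otimes> h2 \<leftarrow> comul H h\<rangle>. \<Phi> (ract M m h1) (dact (antipode H h2) (pure as)))" if as: "as \<in> cyc
        n" for m h as
  proof -
    have d: "diag_act H D k as = dact k (pure as)" for k
      using as diag_act_eq by (auto simp: cyc_def)
    show ?thesis
      unfolding d
      by (subst cut_sweedler[OF b]) (intro L, intro MC_in dact_cyc cyc_span_pure as,
          simp add: cut_tensor[OF b] dact_cyc cyc_span_pure as)
  qed
  have iff: "cut n \<Phi> \<in> cochains H D M n \<longleftrightarrow> (\<forall>m h. \<forall>as\<in>cyc n.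
    (\<Sum>\<langle>h1 \<otimes> h2 \<leftarrow> comul H h\<rangle>. \<Phi> (ract M m h1) (dact (antipode H h2) (pure as))) =
        counit H h * \<Phi> m (pure as))"
    unfolding cochains_def cyclic_strings_eq
    using linear_on_cut[OF b] cut_outside by (auto simp: sw cut_tensor[OF b] cyc_span_pure)
  show ?thesis
    unfolding iff
  proof
    assume *: "\<forall>m h. \<forall>as\<in>cyc n.
      (\<Sum>\<langle>h1 \<otimes> h2 \<leftarrow> comul H h\<rangle>. \<Phi> (ract M m h1) (dact (antipode H h2) (pure as))) =
          counit H h * \<Phi> m (pure as)"
    have *: "(\<Sum>\<langle>h1 \<otimes> h2 \<leftarrow> comul H h\<rangle>. \<Phi> (ract M m h1) (dact (antipode H h2) c)) =
        counit H h * \<Phi> m c"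
      if c: "c \<in> cyc_span n" for m h c
      by (rule cyc_span_eq[OF _ _ _ c]) (use * in \<open>auto intro!: L\<close>)
    show "invariant n \<Phi>"
      unfolding invariant_def
    proof (intro allI ballI)
      fix m h c assume c: "c \<in> cyc_span n"
      have "\<Phi> (ract M m h) c = (\<Sum>\<langle>h1 \<otimes> h' \<leftarrow> comul H h\<rangle>. counit H h' *\<^sub>C \<Phi> (ract M m h1) (dact 1 c))"
        by (subst sweedler_counit_right) (intro L, simp add: dact_one_cyc[OF c])
      also have "\<dots> = (\<Sum>\<langle>h1 \<otimes> h' \<leftarrow> comul H h\<rangle>. \<Sum>\<langle>h2 \<otimes> h3 \<leftarrow> comul H h'\<rangle>.
          \<Phi> (ract M m h1) (dact (antipode H h2 * h3) c))"
        by (subst sweedler_antipode_left) (intro L, simp)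
      also have "\<dots> = (\<Sum>\<langle>h1 \<otimes> h' \<leftarrow> comul H h\<rangle>. \<Sum>\<langle>h2 \<otimes> h3 \<leftarrow> comul H h'\<rangle>.
          \<Phi> (ract M m h1) (dact (antipode H h2) (dact h3 c)))"
        by (simp add: dact_mult)
      also have "\<dots> = (\<Sum>\<langle>k \<otimes> h3 \<leftarrow> comul H h\<rangle>. \<Sum>\<langle>h1 \<otimes> h2 \<leftarrow> comul H k\<rangle>.
          \<Phi> (ract M m h1) (dact (antipode H h2) (dact h3 c)))"
        by (rule sweedler_coassoc[symmetric]) (intro L)+
      also have "\<dots> = (\<Sum>\<langle>k \<otimes> h3 \<leftarrow> comul H h\<rangle>. counit H k *\<^sub>C \<Phi> m (dact h3 c))"
        by (simp add: * dact_cyc[OF c] scaleC_complex_def)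
      also have "\<dots> = \<Phi> m (dact h c)"
        by (rule sweedler_counit_left) (intro L)
      finally show "\<Phi> (ract M m h) c = \<Phi> m (dact h c)" .
    qed
  next
    assume inv: "invariant n \<Phi>"
    show "\<forall>m h. \<forall>as\<in>cyc n.
      (\<Sum>\<langle>h1 \<otimes> h2 \<leftarrow> comul H h\<rangle>. \<Phi> (ract M m h1) (dact (antipode H h2) (pure as))) =
          counit H h * \<Phi> m (pure as)"
    proof (intro allI ballI)
      fix m h as assume as: "as \<in> cyc n"
      have "(\<Sum>\<langle>h1 \<otimes> h2 \<leftarrow> comul H h\<rangle>. \<Phi> (ract M m h1) (dact (antipode H h2) (pure as))) =
        (\<Sum>\<langle>h1 \<otimes> h2 \<leftarrow> comul H h\<rangle>. \<Phi> m (dact (h1 * antipode H h2) (pure as)))"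
        using inv as by (simp add: invariant_def dact_cyc cyc_span_pure dact_mult)
      also have "\<dots> = counit H h *\<^sub>C \<Phi> m (dact 1 (pure as))"
        by (rule sweedler_antipode_right) (intro L)
      finally show "(\<Sum>\<langle>h1 \<otimes> h2 \<leftarrow> comul H h\<rangle>. \<Phi> (ract M m h1) (dact (antipode H h2) (pure as))) =
          counit H h * \<Phi> m (pure as)"
        by (simp add: dact_one[OF as] scaleC_complex_def)
    qed
  qed
qed

lemma coface_cut:
  assumes b: "bilin \<Phi>"
  shows "i \<le> n \<Longrightarrow> coface H D M n i (cut n \<Phi>) = cut (Suc n) (\<lambda>m c. \<Phi> m (face i c))"
    and "coface H D M n (Suc n) (cut n \<Phi>) = cut (Suc n) (last_face \<Phi>)"
proof -
  note L = lin_rules_M bilin_left[OF b] bilin_right[OF b] clinear_comp[OF clinear_face]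
  assume i: "i \<le> n"
  show "coface H D M n i (cut n \<Phi>) = cut (Suc n) (\<lambda>m c. \<Phi> m (face i c))"
    unfolding coface_def
  proof (rule functional_eq)
    show "bilin (\<lambda>m c. \<Phi> m (face i c))" by (intro L)
    fix m as assume as: "as \<in> cyc (Suc n)"
    then obtain X where X: "is_path X as X" and len: "length as = Suc (Suc n)"
      by (auto simp: cyc_def)
    let ?as = "take i as @ [cm (as ! i) (as ! Suc i)] @ drop (i + 2) as"
    \<comment> \<open>Exposes positions i and i + 1, so that the path condition yields that the two
      arrows can be composed and that the shorter list is again a cyclic string.\<close>
    have split: "as = take i as @ as ! i # as ! Suc i # drop (i + 2) as"
      using i len by (simp add: Cons_nth_drop_Suc id_take_nth_drop[symmetric])
    then have p: "is_path X (take i as @ as ! i # as ! Suc i # drop (i + 2) as) X" using X by simp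
    then have ar: "is_arrow (as ! i)" "is_arrow (as ! Suc i)" "src (as ! i) = tgt (as ! Suc i)"
      by (auto simp: path_append)
    have "is_path X ?as X"
      using p is_arrow_cm[OF ar] by (auto simp: path_append)
    then have "?as \<in> cyc n" using len i by (auto simp: cyc_def)
    then show "\<Phi> m (face i (pure as)) = (if i \<le> n then cut n \<Phi> (m \<otimes> pure (take i as @ [comp_arrow
        D (as ! i) (as ! Suc i)] @ drop (i + 2) as))
      else cut n \<Phi> (\<Sum>\<langle>a \<otimes> m' \<leftarrow> coact M m\<rangle>. m' \<otimes> pure
         (comp_arrow D (act_arrow D (S_inv H a) (as ! Suc n)) (as ! 0) # take n (drop 1 as))))"
      using i len by (simp add: face_pure face_list_eq is_arrow_comp[OF ar] cut_tensor[OF b]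
          cyc_span_pure)
  qed
next
  note L = lin_rules_M bilin_left[OF b] bilin_right[OF b]
  show "coface H D M n (Suc n) (cut n \<Phi>) = cut (Suc n) (last_face \<Phi>)"
    unfolding coface_def
  proof (rule functional_eq)
    show "bilin (last_face \<Phi>)" by (rule bilin_last_face[OF b])
    fix m as assume as: "as \<in> cyc (Suc n)"
    then obtain x bs z where xz: "as = x # bs @ [z]" and *: "length bs =
        n" "is_path (tgt x) as (tgt x)"
      "is_arrow x" "is_arrow z" "src z = tgt x" "is_path (src x) bs (tgt z)" by (rule cyc_Suc_cases)
    have e: "pure (comp_arrow D (act_arrow D k (as ! Suc n)) (as ! 0) # take n (drop 1 as)) =
        wrap k (pure as)" for k
    proof -
      have "as ! Suc n = z" "as ! 0 = x" "take n (drop 1 as) = bs" using *(1)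
        by (auto simp: xz nth_append)
      moreover have "comp_arrow D (ac k z) x = cm (ac k z) x"
        by (rule is_arrow_comp[OF is_arrow_ac[OF *(4)] *(3)]) (simp add: *)
      ultimately show ?thesis
        by (simp add: is_arrow_act[OF *(4)]) (simp add: xz wrap_pure)
    qed
    have "cut n \<Phi> (\<Sum>\<langle>a \<otimes> m' \<leftarrow> coact M m\<rangle>. m' \<otimes> wrap (S_inv H a) (pure as)) =
        last_face \<Phi> m (pure as)"
      by (subst cut_sweedler[OF b], intro L, intro MC_in wrap_cyc cyc_span_pure as)
        (simp add: last_face_def cut_tensor[OF b] wrap_cyc cyc_span_pure as)
    then show "last_face \<Phi> m (pure as) = (if Suc n \<le> n then cut n \<Phi> (m \<otimes> pure (take (Suc n) as @
        [comp_arrow D (as ! Suc n) (as ! Suc (Suc n))] @ drop (Suc n + 2) as))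
      else cut n \<Phi> (\<Sum>\<langle>a \<otimes> m' \<leftarrow> coact M m\<rangle>. m' \<otimes> pure
         (comp_arrow D (act_arrow D (S_inv H a) (as ! Suc n)) (as ! 0) # take n (drop 1 as))))"
      unfolding e by simp
  qed
qed

lemma coboundary_cut:
  assumes b: "bilin \<Phi>"
  shows "coboundary_op H D M n (cut n \<Phi>) = cut (Suc n) (cob n \<Phi>)"
proof (rule eq_cutI)
  note L = lin_rules_M bilin_left[OF b] bilin_right[OF b] clinear_comp[OF clinear_face]
  have bf: "bilin (\<lambda>m c. \<Phi> m (face i c))" for i by (intro L)
  have cf: "coboundary_op H D M n (cut n \<Phi>) x =
      (\<Sum>i\<le>n. (-1) ^ i * cut (Suc n) (\<lambda>m c. \<Phi> m (face i c)) x)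
     + (-1) ^ Suc n * cut (Suc n) (last_face \<Phi>) x" for x
    by (simp add: coboundary_op_def coface_cut[OF b])
  have la: "linear_on V (\<lambda>x. f x + g x)" if "linear_on V f" "linear_on V g"
    for V and f g :: "'x::complex_vector \<Rightarrow> complex"
    using that by (simp add: linear_on_def scaleC_complex_def algebra_simps)
  have lm: "linear_on V (\<lambda>x. k * f x)" if "linear_on V f" for V k and f :: "'x::complex_vector \<Rightarrow>
      complex"
    using that by (simp add: linear_on_def scaleC_complex_def algebra_simps)
  have ls: "linear_on V (\<lambda>x. \<Sum>i\<in>A. f i x)" if "\<And>i. linear_on V (f i)" for V A and f :: "_ \<Rightarrow>
      'x::complex_vector \<Rightarrow> complex"
    using that by (simp add: linear_on_def sum.distrib scaleC_complex_def sum_distrib_left)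
  show "linear_on (MC (Suc n)) (coboundary_op H D M n (cut n \<Phi>))"
    unfolding cf[abs_def] by (intro la lm ls linear_on_cut bf bilin_last_face[OF b])
  show "coboundary_op H D M n (cut n \<Phi>) x = 0" if "x \<notin> MC (Suc n)" for x
    using that by (simp add: cf cut_def)
  show "bilin (cob n \<Phi>)" by (rule bilin_cob[OF b])
  fix m as assume as: "as \<in> cyc (Suc n)"
  have l: "clinear (\<Phi> m)" by (rule bilin_right[OF b clinear_id])
  have "length as = Suc (Suc n)" using as by (simp add: cyc_def)
  then have "\<Phi> m (faces (pure as)) = (\<Sum>i\<le>n. (-1) ^ i * \<Phi> m (face i (pure as)))"
    by (simp add: faces_eq_sum clinear_sum[OF l] clinear_scale[OF l] scaleC_complex_def)
  then show "coboundary_op H D M n (cut n \<Phi>) (m \<otimes> pure as) = cob n \<Phi> m (pure as)"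
    by (simp add: cf cob_def cut_tensor bf bilin_last_face[OF b] cyc_span_pure as)
qed

lemma cyclic_cut:
  assumes b: "bilin \<Phi>"
  shows "cyclic_op H D M n (cut n \<Phi>) = cut n (rot \<Phi>)"
  unfolding cyclic_op_def
proof (rule functional_eq)
  note L = lin_rules_M bilin_left[OF b] bilin_right[OF b]
  show "bilin (rot \<Phi>)" by (rule bilin_rot[OF b])
  fix m as assume as: "as \<in> cyc n"
  then obtain X bs z where bs: "as = bs @ [z]" "length bs = n" "is_path X as X" "src z =
      X" "is_arrow z"
    "is_path X bs (tgt z)" by (rule cyc_cases)
  have e: "pure (act_arrow D k (as ! n) # take n as) = rotate k (pure as)" for k
    using bs(2) by (simp add: bs(1) nth_append is_arrow_act[OF bs(5)] rotate_pure_snoc)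
  have "cut n \<Phi> (\<Sum>\<langle>a \<otimes> m' \<leftarrow> coact M m\<rangle>. m' \<otimes> rotate (S_inv H a) (pure as)) = rot \<Phi> m (pure as)"
    by (subst cut_sweedler[OF b], intro L, intro MC_in rotate_cyc cyc_span_pure as)
      (simp add: rot_def cut_tensor[OF b] rotate_cyc cyc_span_pure as)
  then show "rot \<Phi> m (pure as) = cut n \<Phi> (\<Sum>\<langle>a \<otimes> m' \<leftarrow> coact M m\<rangle>.
      m' \<otimes> pure (act_arrow D (S_inv H a) (as ! n) # take n as))"
    unfolding e by simp
qed

section \<open>Cyclic cochains, cocycles and the quotient\<close>

definition cyclic_cochain :: "nat \<Rightarrow> ('m \<Rightarrow> ('o, 'f) chain \<Rightarrow> complex) \<Rightarrow> bool" where
  "cyclic_cochain n \<Phi> \<longleftrightarrow> bilin \<Phi> \<and> invariant n \<Phi> \<and> is_cyclic n \<Phi>"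

lemma cyclic_cochain_zero: "cyclic_cochain n (\<lambda>m c. 0)"
  by (simp add: cyclic_cochain_def bilin_zero invariant_def is_cyclic_def rot_def sweedler_zero)

lemma cut_in_cyclic_cochains:
  assumes b: "bilin \<Phi>"
  shows "cut n \<Phi> \<in> cyclic_cochains H D M n \<longleftrightarrow> invariant n \<Phi> \<and> is_cyclic n \<Phi>"
proof -
  have b': "bilin (\<lambda>m c. (-1) ^ n * \<Phi> m c)"
    by (intro bilinI clinear_cmult bilin_left[OF b] bilin_right[OF b] clinear_id)
  have sw: "sweedler x (\<lambda>m c. (-1) ^ n * \<Phi> m c) = (-1) ^ n * sweedler x \<Phi>" for x
    by (rule sweedler_lift[OF b']) (intro clinear_cmult sweedler_clinear[OF b],
        simp add: sweedler_tensor b)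
  have "(\<forall>x. cut n \<Phi> x - (-1) ^ n * cut n (rot \<Phi>) x = 0) \<longleftrightarrow> cut n (rot \<Phi>) =
      cut n (\<lambda>m c. (-1) ^ n * \<Phi> m c)"
  proof -
    have "y - (-1) ^ n * z = 0 \<longleftrightarrow> z = (-1) ^ n * y" for y z :: complex
      by (cases "even n") (auto simp: add_eq_0_iff minus_equation_iff)
    then show ?thesis by (auto simp: fun_eq_iff cut_def sw)
  qed
  also have "\<dots> \<longleftrightarrow> is_cyclic n \<Phi>"
    by (simp add: cut_eq_iff bilin_rot[OF b] b' is_cyclic_def)
  finally show ?thesis
    by (simp add: cyclic_cochains_def cut_in_cochains[OF b] cyclic_cut[OF b])
qed

lemma cyclic_cochains_eq: "cyclic_cochains H D M n = cut n ` {\<Phi>. cyclic_cochain n \<Phi>}"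
proof (intro set_eqI iffI)
  fix \<phi> assume \<phi>: "\<phi> \<in> cyclic_cochains H D M n"
  then have l: "linear_on (MC n) \<phi>" "\<And>x. x \<notin> MC n \<Longrightarrow> \<phi> x = 0"
    by (auto simp: cyclic_cochains_def cochains_def)
  have e: "cut n (curried n \<phi>) = \<phi>" by (rule cut_curried[OF l, symmetric])
  have "cyclic_cochain n (curried n \<phi>)"
    using cut_in_cyclic_cochains[OF bilin_curried[OF l(1)], of n] \<phi> bilin_curried[OF l(1)]
    unfolding e by (simp add: cyclic_cochain_def)
  then show "\<phi> \<in> cut n ` {\<Phi>. cyclic_cochain n \<Phi>}" using e
    by (intro image_eqI[of _ _ "curried n \<phi>"]) auto
qed (auto simp: cyclic_cochain_def cut_in_cyclic_cochains)

lemma cocycles_eq: "cocycles H D M n =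
  cut n ` {\<Phi>. cyclic_cochain n \<Phi> \<and> (\<forall>m. \<forall>c\<in>cyc_span (Suc n). cob n \<Phi> m c = 0)}"
proof -
  have "(\<forall>x. coboundary_op H D M n (cut n \<Phi>) x = 0) \<longleftrightarrow> (\<forall>m. \<forall>c\<in>cyc_span (Suc n). cob n \<Phi> m c = 0)"
    if "bilin \<Phi>" for \<Phi>
    using cut_eq_iff[OF bilin_cob[OF that] bilin_zero, of "Suc n" n]
    by (simp add: coboundary_cut[OF that] cut_zero fun_eq_iff)
  then show ?thesis
    unfolding cocycles_def cyclic_cochains_eq by (auto simp: cyclic_cochain_def)
qed

text \<open>Needed because the zero class is identified with the set of all coboundaries, which must
  therefore lie within the cocycles.\<close>

lemma coboundaries_subset_cocycles: "coboundaries H D M n \<subseteq> cocycles H D M n"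
proof (cases n)
  case 0
  have "cob 0 (\<lambda>m c. 0) m c = 0" for m c by (simp add: cob_def last_face_def sweedler_zero)
  then show ?thesis using cut_zero[of 0] cyclic_cochain_zero[of 0] unfolding 0 cocycles_eq
    by (auto simp: image_iff intro!: exI[of _ "\<lambda>m c. 0"])
next
  case (Suc k)
  have "cyclic_cochain n (cob k \<Phi>) \<and> (\<forall>m. \<forall>c\<in>cyc_span (Suc n). cob n (cob k \<Phi>) m c = 0)"
    if "cyclic_cochain k \<Phi>" for \<Phi>
    using that by (auto simp: cyclic_cochain_def Suc bilin_cob cob_invariant cob_is_cyclic cob_cob)
  moreover have "coboundary_op H D M k (cut k \<Phi>) = cut n (cob k \<Phi>)" if "cyclic_cochain k \<Phi>" for \<Phi>
    using that by (simp add: coboundary_cut cyclic_cochain_def Suc)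
  ultimately show ?thesis
    unfolding cocycles_eq by (auto simp: Suc cyclic_cochains_eq)
qed

text \<open>Makes the relation that defines \<open>HC\<close> total on cocycles, once all cocycles
  are coboundaries.\<close>

lemma cocycles_diff:
  assumes "\<phi> \<in> cocycles H D M n" "\<psi> \<in> cocycles H D M n"
  shows "(\<lambda>x. \<phi> x - \<psi> x) \<in> cocycles H D M n"
proof -
  obtain \<Phi> \<Psi> where 1: "\<phi> = cut n \<Phi>" "cyclic_cochain n \<Phi>" "\<forall>m. \<forall>c\<in>cyc_span (Suc n). cob n \<Phi> m c = 0"
    and 2: "\<psi> = cut n \<Psi>" "cyclic_cochain n \<Psi>" "\<forall>m. \<forall>c\<in>cyc_span (Suc n). cob n \<Psi> m c = 0"
    using assms unfolding cocycles_eq by auto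
  have b: "bilin \<Phi>" "bilin \<Psi>" using 1 2 by (auto simp: cyclic_cochain_def)
  define \<Delta> where "\<Delta> m c = \<Phi> m c - \<Psi> m c" for m c
  have bd: "bilin \<Delta>" unfolding \<Delta>_def
    by (intro bilinI clin bilin_left[OF b(1)] bilin_right[OF b(1)] bilin_left[OF b(2)]
        bilin_right[OF b(2)])
  have N: "bilin (\<lambda>a m'. \<Phi> m' (rotate (S_inv H a) c))" "bilin (\<lambda>a m'. \<Psi> m' (rotate (S_inv H a) c))"
    "bilin (\<lambda>a m'. \<Phi> m' (wrap (S_inv H a) c))" "bilin (\<lambda>a m'. \<Psi> m' (wrap (S_inv H a) c))" for c
    by (intro lin_rules_M bilin_left[OF b(1)] bilin_right[OF b(1)] bilin_left[OF b(2)]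
        bilin_right[OF b(2)])+
  have r: "rot \<Delta> m c = rot \<Phi> m c - rot \<Psi> m c" for m c
    unfolding rot_def \<Delta>_def by (rule sweedler_diff[OF N(1,2)])
  have lf: "last_face \<Delta> m c = last_face \<Phi> m c - last_face \<Psi> m c" for m c
    unfolding last_face_def \<Delta>_def by (rule sweedler_diff[OF N(3,4)])
  have "cob n \<Delta> m c = cob n \<Phi> m c - cob n \<Psi> m c" for m c
    by (simp add: cob_def lf \<Delta>_def algebra_simps)
  moreover have "invariant n \<Delta>" "is_cyclic n \<Delta>"
    using 1 2 by (auto simp: cyclic_cochain_def invariant_def is_cyclic_def r \<Delta>_def algebra_simps)
  moreover have "cut n \<Delta> = (\<lambda>x. \<phi> x - \<psi> x)"
    by (auto simp: cut_def 1 2 \<Delta>_def[abs_def] sweedler_diff[OF b] fun_eq_iff)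
  ultimately show ?thesis
    using 1 2 bd unfolding cocycles_eq
      by (auto simp: cyclic_cochain_def image_iff intro!: exI[of _ \<Delta>])
qed

lemma HC_trivialI:
  assumes "cocycles H D M n \<subseteq> coboundaries H D M n"
  shows "HC H D M n = {coboundaries H D M n}"
proof -
  have e: "coboundaries H D M n = cocycles H D M n"
    using assms coboundaries_subset_cocycles by blast
  let ?Z = "cocycles H D M n"
  let ?R = "{(\<phi>, \<psi>). \<phi> \<in> ?Z \<and> \<psi> \<in> ?Z \<and> (\<lambda>x. \<phi> x - \<psi> x) \<in> ?Z}"
  \<comment> \<open>An empty set would have an empty quotient, not a one-element one.\<close>
  have ne: "?Z \<noteq> {}"
    unfolding e[symmetric] using cyclic_cochain_zero by (cases n) (auto simp: cyclic_cochains_eq)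
  have "?R `` {\<phi>} = ?Z" if "\<phi> \<in> ?Z" for \<phi>
    using that cocycles_diff by auto
  then have "?Z // ?R = {?Z}"
    using ne by (auto simp: quotient_def)
  then show ?thesis by (simp add: HC_def e)
qed

end

section \<open>Arrows of \<open>D \<otimes> M\<^sub>2\<close> as 2x2 matrices\<close>

text \<open>Coordinates in the basis of elementary matrices; \<open>from_coefs\<close> is the
  inverse, and a tensor is handled as a 2x2 matrix of morphisms.\<close>

definition coef :: "2 \<Rightarrow> 2 \<Rightarrow> 'f::complex_vector \<otimes> (complex^2^2) \<Rightarrow> 'f" where
  "coef i j t = (\<Sum>\<langle>f \<otimes> B \<leftarrow> t\<rangle>. (B $ i $ j) *\<^sub>C f)"

lemma bilin_coef: "bilin (\<lambda>f (B :: complex^2^2). (B $ i $ j) *\<^sub>C f)"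
  by (intro bilinI clin clinear_scaleC_left)

lemma clinear_coef: "clinear (coef i j)"
  unfolding coef_def[abs_def] by (rule sweedler_clinear[OF bilin_coef])

lemma coef_tensor: "coef i j (f \<otimes> B) = (B $ i $ j) *\<^sub>C f"
  unfolding coef_def by (rule sweedler_tensor[OF bilin_coef])

definition from_coefs :: "(2 \<Rightarrow> 2 \<Rightarrow> 'f::complex_vector) \<Rightarrow> 'f \<otimes> (complex^2^2)" where
  "from_coefs x = (\<Sum>i\<in>UNIV. \<Sum>j\<in>UNIV. x i j \<otimes> elem_mat i j)"

lemma mat_eq_sum_elem: "B = (\<Sum>i\<in>UNIV. \<Sum>j\<in>UNIV. (B $ i $ j) *\<^sub>C elem_mat i j)"
  by (simp add: vec_eq_iff forall_2 sum_2 elem_mat_def scaleC_vec_def scaleC_complex_def)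

lemma from_coefs_scale: "from_coefs (\<lambda>i j. (B $ i $ j) *\<^sub>C f) = f \<otimes> B"
proof -
  have l: "clinear (\<lambda>B. f \<otimes> B)" by (intro clin_tensor clin)
  have "f \<otimes> B = f \<otimes> (\<Sum>i\<in>UNIV. \<Sum>j\<in>UNIV. (B $ i $ j) *\<^sub>C elem_mat i j)"
    by (subst mat_eq_sum_elem) (rule refl)
  also have "\<dots> = (\<Sum>i\<in>UNIV. \<Sum>j\<in>UNIV. (B $ i $ j) *\<^sub>C (f \<otimes> elem_mat i j))"
    by (simp add: clinear_sum[OF l] clinear_scale[OF l])
  finally show ?thesis by (simp add: from_coefs_def tensor_scale_left)
qed

lemma from_coefs_coef: "from_coefs (\<lambda>i j. coef i j t) = t"
proof (rule tensor_ext[where t=t])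
  show "clinear (\<lambda>t. from_coefs (\<lambda>i j. coef i j t))"
    unfolding from_coefs_def by (intro clin clin_tensor clinear_coef)
qed (simp_all add: coef_tensor from_coefs_scale clinear_id)

lemma coef_elem_mat: "coef i j (f \<otimes> elem_mat k l) = (if i = k \<and> j = l then f else 0)"
  by (simp add: coef_tensor elem_mat_def scaleC_one)

lemma coef_from_coefs [simp]: "coef i j (from_coefs x) = x i j"
proof -
  have "coef i j (from_coefs x) = (\<Sum>k\<in>UNIV. \<Sum>l\<in>UNIV. if i = k \<and> j = l then x k l else 0)"
    by (simp add: from_coefs_def clinear_sum[OF clinear_coef] coef_elem_mat)
  also have "\<dots> = x i j" using exhaust_2[of i] exhaust_2[of j] by (auto simp: sum_2)
  finally show ?thesis .
qed

lemma coef_eqI: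
  assumes "\<And>i j. coef i j t = coef i j t'"
  shows "t = t'"
proof -
  have "from_coefs (\<lambda>i j. coef i j t) = from_coefs (\<lambda>i j. coef i j t')" by (simp only: assms)
  then show ?thesis by (simp only: from_coefs_coef)
qed

lemma subspace_tensor_image: "subspace_tensor V UNIV = cvec.span ((\<lambda>(f, B). f \<otimes> B) ` (V \<times> UNIV))"
  unfolding subspace_tensor_def by (rule arg_cong[where f=cvec.span]) force

lemma coef_in:
  assumes V: "cvec.subspace V" and t: "t \<in> subspace_tensor V UNIV"
  shows "coef i j t \<in> V"
proof -
  have "coef i j t \<in> cvec.span V"
    by (rule clinear_span_image[OF clinear_coef _ t[unfolded subspace_tensor_image]])
      (auto simp: coef_tensor intro!: cvec.span_scale intro: cvec.span_base)
  then show ?thesis using cvec.span_minimal[OF order_refl V] by blast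
qed

lemma from_coefs_in: "(\<And>i j. x i j \<in> V) \<Longrightarrow> from_coefs x \<in> subspace_tensor V UNIV"
  unfolding from_coefs_def subspace_tensor_def
  by (intro cvec.span_sum cvec.span_base) auto

section \<open>Matrix formulas for composition and action\<close>

context hcategory_sayd
begin

abbreviation "E \<equiv> tensor_M2 D"

lemma Hom_E: "Hom E X Y = subspace_tensor (Hom D X Y) UNIV"
  and Ob_E: "Ob E = Ob D" and Ident_E: "Ident E X = Ident D X \<otimes> mat 1"
  by (simp_all add: tensor_M2_def)

lemma coef_Hom: "X \<in> Ob D \<Longrightarrow> Y \<in> Ob D \<Longrightarrow> t \<in> Hom E X Y \<Longrightarrow> coef i j t \<in> Hom D X Y"
  unfolding Hom_E by (rule coef_in[OF Hom_subspace])

lemma from_coefs_Hom: "(\<And>i j. x i j \<in> Hom D X Y) \<Longrightarrow> from_coefs x \<in> Hom E X Y"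
  unfolding Hom_E by (rule from_coefs_in)

lemma Comp_E:
  assumes ob: "X \<in> Ob D" "Y \<in> Ob D" "Z \<in> Ob D" and t: "t \<in> Hom E Y Z" and s: "s \<in> Hom E X Y"
  shows "Comp E X Y Z t s = from_coefs (\<lambda>i j. \<Sum>k\<in>UNIV. gcmp X Y Z (coef i k t) (coef k j s))"
proof -
  \<comment> \<open>Matrix multiplication is a globally bilinear candidate that agrees with both
    nested \<open>lin_ext\<close> on pure tensors, and so evaluates them.\<close>
  define L where "L t s = from_coefs (\<lambda>i j. \<Sum>k\<in>UNIV. gcmp X Y Z (coef i k t) (coef k j s))" for t s
  have L: "clinear (\<lambda>t. L t s)" "clinear (L t)" for t s
    unfolding L_def[abs_def] from_coefs_def
    by (intro clin clin_tensor clin_cmp clinear_coef)+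
  have Lp: "L (g \<otimes> B') (f \<otimes> B) = Comp D X Y Z g f \<otimes> (B' ** B)"
    if "g \<in> Hom D Y Z" "f \<in> Hom D X Y" for g B' f B
  proof -
    have "L (g \<otimes> B') (f \<otimes> B) = from_coefs (\<lambda>i j. ((B' ** B) $ i $ j) *\<^sub>C gcmp X Y Z g f)"
      unfolding L_def
      by (rule arg_cong[where f=from_coefs])
        (simp add: coef_tensor fun_eq_iff matrix_matrix_mult_def clinear_scale[OF bilin_left[OF
            bilin_cmp clinear_id]]
          clinear_scale[OF bilin_right[OF bilin_cmp clinear_id]] scaleC_scaleC cvec.scale_sum_left
              mult.commute)
    then show ?thesis using that ob by (simp add: from_coefs_scale gcmp_eq)
  qed
  have inner: "lin_ext (\<lambda>(f, B). f \<otimes> B) (Hom D X Y \<times> UNIV) (\<lambda>(f,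
      B). Comp D X Y Z g f \<otimes> (B' ** B)) s = L (g \<otimes> B') s"
    if g: "g \<in> Hom D Y Z" for g B'
    by (subst lin_ext_eq[OF linear_on_clinear[OF L(2)[of "g \<otimes> B'"]]])
      (use s Lp[OF g] in \<open>auto simp: Hom_E subspace_tensor_image\<close>)
  have "Comp E X Y Z t s = lin_ext (\<lambda>(g, B'). g \<otimes> B') (Hom D Y Z \<times> UNIV) (\<lambda>(g, B').
         lin_ext (\<lambda>(f, B). f \<otimes> B) (Hom D X Y \<times> UNIV) (\<lambda>(f, B). Comp D X Y Z g f \<otimes> (B' ** B)) s) t"
    by (simp add: tensor_M2_def)
  also have "\<dots> = L t s"
    by (subst lin_ext_eq[OF linear_on_clinear[OF L(1)[of s]]])
      (use t inner in \<open>auto simp: Hom_E subspace_tensor_image\<close>)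
  finally show ?thesis by (simp add: L_def)
qed

lemma coef_Comp:
  assumes "X \<in> Ob D" "Y \<in> Ob D" "Z \<in> Ob D" "t \<in> Hom E Y Z" "s \<in> Hom E X Y"
  shows "coef i j (Comp E X Y Z t s) = (\<Sum>k\<in>UNIV. gcmp X Y Z (coef i k t) (coef k j s))"
  by (simp add: Comp_E[OF assms])

lemma Comp_E_in:
  assumes "X \<in> Ob D" "Y \<in> Ob D" "Z \<in> Ob D" "t \<in> Hom E Y Z" "s \<in> Hom E X Y"
  shows "Comp E X Y Z t s \<in> Hom E X Z"
  unfolding Comp_E[OF assms]
  by (intro from_coefs_Hom cvec.subspace_sum[OF Hom_subspace]) (auto intro!: cmp_closed coef_Hom
      assms)

lemma gcmp_sum: "gcmp X Y Z (sum g A) f = (\<Sum>k\<in>A. gcmp X Y Z (g k) f)"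
  "gcmp X Y Z f (sum g A) = (\<Sum>k\<in>A. gcmp X Y Z f (g k))"
  using clinear_sum[OF bilin_left[OF bilin_cmp clinear_id]] clinear_sum[OF bilin_right[OF
      bilin_cmp clinear_id]]
  by auto

lemma Comp_E_assoc:
  assumes "W \<in> Ob D" "X \<in> Ob D" "Y \<in> Ob D" "Z \<in> Ob D"
    and "u \<in> Hom E Y Z" "t \<in> Hom E X Y" "s \<in> Hom E W X"
  shows "Comp E W X Z (Comp E X Y Z u t) s = Comp E W Y Z u (Comp E W X Y t s)"
proof (rule coef_eqI)
  show "coef i j (Comp E W X Z (Comp E X Y Z u t) s) =
      coef i j (Comp E W Y Z u (Comp E W X Y t s))" for i j
    by (simp add: coef_Comp Comp_E_in assms gcmp_sum cmp_assoc) (rule sum.swap)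
qed

lemma Ident_E_in: "X \<in> Ob D \<Longrightarrow> Ident E X \<in> Hom E X X"
  unfolding Ident_E Hom_E subspace_tensor_def by (rule cvec.span_base) (auto intro: Id_closed)

lemma coef_Ident: "coef i j (Ident E X) = (if i = j then Ident D X else 0)"
  by (simp add: coef_tensor Ident_E mat_def scaleC_one)

lemma gcmp_Id: "X \<in> Ob D \<Longrightarrow> Y \<in> Ob D \<Longrightarrow> f \<in> Hom D X Y \<Longrightarrow> gcmp X X Y f (Ident D X) = f"
  "X \<in> Ob D \<Longrightarrow> Y \<in> Ob D \<Longrightarrow> f \<in> Hom D X Y \<Longrightarrow> gcmp X Y Y (Ident D Y) f = f"
  by (simp_all add: gcmp_eq Id_closed Comp_Id_left Comp_Id_right)

lemma Comp_E_Id: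
  assumes "X \<in> Ob D" "Y \<in> Ob D" "t \<in> Hom E X Y"
  shows "Comp E X X Y t (Ident E X) = t" "Comp E X Y Y (Ident E Y) t = t"
  by (rule coef_eqI, simp add: coef_Comp assms Ident_E_in coef_Ident coef_Hom gcmp_Id
      if_distrib[of "gcmp _ _ _ _"] if_distrib[of "\<lambda>x. gcmp _ _ _ x _"] cong: if_cong)+

lemma coef_Act:
  assumes ob: "X \<in> Ob D" "Y \<in> Ob D" and t: "t \<in> Hom E X Y"
  shows "coef i j (Act E X Y h t) = gact X Y h (coef i j t)"
proof -
  define L where "L t = from_coefs (\<lambda>i j. gact X Y h (coef i j t))" for t
  have L: "clinear L"
    unfolding L_def[abs_def] from_coefs_def by (intro clin clin_tensor clin_act clinear_coef)
  have "Act E X Y h t = L t"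
    unfolding tensor_M2_def hcat.simps
    by (subst lin_ext_eq[OF linear_on_clinear[OF L]])
      (use t ob in \<open>auto simp: coef_tensor Hom_E subspace_tensor_image L_def gact_eq
          from_coefs_scale
        clinear_scale[OF bilin_right[OF bilin_act clinear_id]]\<close>)
  then show ?thesis by (simp add: L_def)
qed

end

section \<open>The intertwiners determined by a unit of \<open>D \<otimes> M\<^sub>2\<close>\<close>

locale hcategory_unit = hcategory_sayd H M D + hlinear_semifunctor D D \<upsilon>\<^sub>0 \<upsilon>
  for H :: "'h::complex_algebra_1 hopf" and M :: "('m::complex_vector, 'h) hopf_mod"
    and D :: "('o, 'f::complex_vector, 'h) hcat" and \<upsilon>\<^sub>0 and \<upsilon> +
  fixes \<eta> :: "'o \<Rightarrow> 'f \<otimes> (complex^2^2)"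
  assumes unit: "\<eta> \<in> U_H H (tensor_M2 D)"
    and u_ob: "X \<in> Ob D \<Longrightarrow> \<upsilon>\<^sub>0 X = X"
    and conj: "\<lbrakk>X \<in> Ob D; Y \<in> Ob D; f \<in> Hom D X Y\<rbrakk> \<Longrightarrow>
      inner_aut (tensor_M2 D) \<eta> X Y (f \<otimes> elem_mat 1 1 + \<upsilon> X Y f \<otimes> elem_mat 2 2)
        = \<upsilon> X Y f \<otimes> elem_mat 2 2"
begin

abbreviation "\<eta>' X \<equiv> aut_inv E X (\<eta> X)"

text \<open>\<open>aut_inv\<close> is a definite description, so uniqueness is required: two
  inverses agree by associativity and the unit laws of the matrix category.\<close>

lemma eta_inverse:
  assumes X: "X \<in> Ob D"
  shows "is_inverse E X X (\<eta> X) (\<eta>' X)"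
proof -
  obtain g where g: "is_inverse E X X (\<eta> X) g"
    using unit X by (auto simp: U_H_def Ob_E Aut_def)
  have "g' = g" if g': "is_inverse E X X (\<eta> X) g'" for g'
  proof -
    have in_hom: "\<eta> X \<in> Hom E X X" "g \<in> Hom E X X" "g' \<in> Hom E X X"
      using g g' by (auto simp: is_inverse_def)
    have "g' = Comp E X X X g' (Comp E X X X (\<eta> X) g)"
      using g in_hom X by (simp add: is_inverse_def Comp_E_Id)
    also have "\<dots> = Comp E X X X (Comp E X X X g' (\<eta> X)) g"
      using in_hom X by (simp add: Comp_E_assoc)
    also have "\<dots> = g" using g' in_hom X by (simp add: is_inverse_def Comp_E_Id)
    finally show ?thesis .
  qed
  with g show ?thesis unfolding aut_inv_def by (rule theI)
qed

lemma eta_Hom: "X \<in> Ob D \<Longrightarrow> \<eta> X \<in> Hom E X X" "X \<in> Ob D \<Longrightarrow> \<eta>' X \<in> Hom E X X"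
  using eta_inverse by (auto simp: is_inverse_def)

lemma eta_coef_Hom: "X \<in> Ob D \<Longrightarrow> coef i j (\<eta> X) \<in> Hom D X X" "X \<in> Ob D \<Longrightarrow> coef i j (\<eta>' X) \<in> Hom D X X"
  using coef_Hom eta_Hom by blast+

lemma eta_inv_eqs:
  assumes "X \<in> Ob D"
  shows "(\<Sum>k\<in>UNIV. gcmp X X X (coef i k (\<eta>' X)) (coef k j (\<eta> X))) = (if i =
      j then Ident D X else 0)"
    and "(\<Sum>k\<in>UNIV. gcmp X X X (coef i k (\<eta> X)) (coef k j (\<eta>' X))) = (if i =
        j then Ident D X else 0)"
  using eta_inverse[OF assms] eta_Hom[OF assms]
  by (simp_all add: is_inverse_def coef_Ident[symmetric] coef_Comp[symmetric] assms)

lemma eta_invariant: "X \<in> Ob D \<Longrightarrow> gact X X h (coef i j (\<eta> X)) = counit H h *\<^sub>C coef i j (\<eta> X)"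
  using unit coef_Act[of X X "\<eta> X" i j h] eta_Hom[of X]
  by (simp add: U_H_def Ob_E clinear_scale[OF clinear_coef])

lemma gact_sum: "gact X Y h (sum g A) = (\<Sum>k\<in>A. gact X Y h (g k))"
  by (rule clinear_sum[OF bilin_right[OF bilin_act clinear_id]])

text \<open>Invariance of \<eta> gives (h \<eta>') \<eta> = h (\<eta>' \<eta>) = \<epsilon>(h) 1;
  multiply by \<eta>' from the right.\<close>

lemma eta'_invariant:
  assumes X: "X \<in> Ob D"
  shows "gact X X h (coef i j (\<eta>' X)) = counit H h *\<^sub>C coef i j (\<eta>' X)"
proof -
  have s: "gcmp X X X (c *\<^sub>C f) g = c *\<^sub>C gcmp X X X f g" "gcmp X X X f (c *\<^sub>C g) =
      c *\<^sub>C gcmp X X X f g" for c f g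
    using clinear_scale[OF bilin_left[OF bilin_cmp clinear_id]] clinear_scale[OF bilin_right[OF
        bilin_cmp clinear_id]]
    by auto
  have r: "gact X X h (gcmp X X X f (coef k j (\<eta> X))) =
      gcmp X X X (gact X X h f) (coef k j (\<eta> X))" for f k j
  proof -
    have l: "clinear (\<lambda>k'. gcmp X X X (gact X X k' f) (coef k j (\<eta> X)))"
      by (intro clin_cmp clin_act clinear_id)
    show ?thesis by (simp add: act_cmp eta_invariant[OF X] s sweedler_counit_right[OF l])
  qed
  have 1: "(\<Sum>k\<in>UNIV. gcmp X X X (gact X X h (coef i k (\<eta>' X))) (coef k l (\<eta> X))) =
    (if i = l then counit H h *\<^sub>C Ident D X else 0)" for l
  proof -
    have "(\<Sum>k\<in>UNIV. gcmp X X X (gact X X h (coef i k (\<eta>' X))) (coef k l (\<eta> X))) =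
      gact X X h (\<Sum>k\<in>UNIV. gcmp X X X (coef i k (\<eta>' X)) (coef k l (\<eta> X)))"
      by (simp add: gact_sum r)
    also have "\<dots> = (if i = l then counit H h *\<^sub>C Ident D X else 0)"
      unfolding eta_inv_eqs(1)[OF X]
      by (simp add: gact_eq X Id_closed Act_Id clinear_0[OF bilin_right[OF bilin_act clinear_id]])
    finally show ?thesis .
  qed
  have in': "gact X X h (coef i k (\<eta>' X)) \<in> Hom D X X" for k
    by (intro act_closed X eta_coef_Hom)
  have "gact X X h (coef i j (\<eta>' X)) =
      (\<Sum>k\<in>UNIV. gcmp X X X (gact X X h (coef i k (\<eta>' X))) (if k = j then Ident D X else 0))"
    by (simp add: if_distrib[of "gcmp _ _ _ _"] gcmp_Id X in' cong: if_cong)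
  also have "\<dots> = (\<Sum>k\<in>UNIV. gcmp X X X (gact X X h (coef i k (\<eta>' X)))
      (\<Sum>l\<in>UNIV. gcmp X X X (coef k l (\<eta> X)) (coef l j (\<eta>' X))))"
    by (simp add: eta_inv_eqs(2)[OF X])
  also have "\<dots> = (\<Sum>l\<in>UNIV. gcmp X X X (\<Sum>k\<in>UNIV. gcmp X X X (gact X X h (coef i k (\<eta>' X))) (coef k
      l (\<eta> X))) (coef l j (\<eta>' X)))"
    by (simp add: gcmp_sum cmp_assoc) (rule sum.swap)
  also have "\<dots> = (\<Sum>l\<in>UNIV. gcmp X X X (if i =
      l then counit H h *\<^sub>C Ident D X else 0) (coef l j (\<eta>' X)))"
    unfolding 1 ..
  also have "\<dots> = counit H h *\<^sub>C coef i j (\<eta>' X)"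
    by (simp add: if_distrib[of "\<lambda>x. gcmp _ _ _ x _"] gcmp_Id X eta_coef_Hom s cong: if_cong)
  finally show ?thesis .
qed

lemma u_closed: "\<lbrakk>X \<in> Ob D; Y \<in> Ob D; f \<in> Hom D X Y\<rbrakk> \<Longrightarrow> \<upsilon> X Y f \<in> Hom D X Y"
  using hom_closed[of X Y f] by (simp add: u_ob)

text \<open>The hypothesis reads \<eta> \<alpha> \<eta>' = \<beta>; multiplying by \<eta> on the
  right or by \<eta>' on the left removes one of the two units.\<close>

lemma intertwine:
  assumes ob: "X \<in> Ob D" "Y \<in> Ob D" and f: "f \<in> Hom D X Y"
  defines "\<alpha> \<equiv> f \<otimes> elem_mat 1 1 + \<upsilon> X Y f \<otimes> elem_mat 2 2" and "\<beta> \<equiv> \<upsilon> X Y f \<otimes> elem_mat 2 2"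
  shows "Comp E X Y Y (\<eta> Y) \<alpha> = Comp E X X Y \<beta> (\<eta> X)" and "Comp E X X Y \<alpha> (\<eta>' X) =
      Comp E X Y Y (\<eta>' Y) \<beta>"
proof -
  have b: "\<beta> \<in> Hom E X Y" unfolding \<beta>_def Hom_E subspace_tensor_def
    by (rule cvec.span_base) (use u_closed[OF ob f] in auto)
  have a: "\<alpha> \<in> Hom E X Y" unfolding \<alpha>_def Hom_E subspace_tensor_def
    by (intro cvec.span_add cvec.span_base) (use u_closed[OF ob f] f in auto)
  note [simp] = a b ob eta_Hom Comp_E_in
  have c: "Comp E X X Y (Comp E X Y Y (\<eta> Y) \<alpha>) (\<eta>' X) = \<beta>"
    using conj[OF ob f] by (simp add: inner_aut_def \<alpha>_def \<beta>_def)
  have i: "Comp E Z Z Z (\<eta>' Z) (\<eta> Z) = Ident E Z" "Comp E Z Z Z (\<eta> Z) (\<eta>' Z) = Ident E Z"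
    if "Z \<in> Ob D" for Z
    using eta_inverse[OF that] by (auto simp: is_inverse_def)
  have "Comp E X X Y \<beta> (\<eta> X) = Comp E X X Y (Comp E X Y Y (\<eta> Y) \<alpha>) (Comp E X X X (\<eta>' X) (\<eta> X))"
    unfolding c[symmetric] by (rule Comp_E_assoc) simp_all
  then show "Comp E X Y Y (\<eta> Y) \<alpha> = Comp E X X Y \<beta> (\<eta> X)" by (simp add: i Comp_E_Id)
  have "Comp E X Y Y (\<eta>' Y) \<beta> = Comp E X Y Y (\<eta>' Y) (Comp E X Y Y (\<eta> Y) (Comp E X X Y \<alpha> (\<eta>' X)))"
    unfolding c[symmetric] by (simp add: Comp_E_assoc)
  also have "\<dots> = Comp E X Y Y (Comp E Y Y Y (\<eta>' Y) (\<eta> Y)) (Comp E X X Y \<alpha> (\<eta>' X))"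
    by (rule Comp_E_assoc[symmetric]) simp_all
  finally show "Comp E X X Y \<alpha> (\<eta>' X) = Comp E X Y Y (\<eta>' Y) \<beta>" by (simp add: i Comp_E_Id)
qed

text \<open>Entries of the two intertwining equations. As \<beta> is concentrated at (2, 2), the
  first row of \<beta> \<eta> and the first column of \<eta>' \<beta> vanish.\<close>

lemma intertwine_coefs:
  assumes ob: "X \<in> Ob D" "Y \<in> Ob D" and f: "f \<in> Hom D X Y"
  shows "gcmp X Y Y (coef 1 1 (\<eta> Y)) f = 0"
    and "gcmp X Y Y (coef 1 2 (\<eta> Y)) (\<upsilon> X Y f) = 0"
    and "gcmp X Y Y (coef 2 1 (\<eta> Y)) f = gcmp X X Y (\<upsilon> X Y f) (coef 2 1 (\<eta> X))"
    and "gcmp X Y Y (coef 2 2 (\<eta> Y)) (\<upsilon> X Y f) = gcmp X X Y (\<upsilon> X Y f) (coef 2 2 (\<eta> X))"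
    and "gcmp X X Y f (coef 1 1 (\<eta>' X)) = 0"
    and "gcmp X X Y f (coef 1 2 (\<eta>' X)) = gcmp X Y Y (coef 1 2 (\<eta>' Y)) (\<upsilon> X Y f)"
    and "gcmp X X Y (\<upsilon> X Y f) (coef 2 2 (\<eta>' X)) = gcmp X Y Y (coef 2 2 (\<eta>' Y)) (\<upsilon> X Y f)"
proof -
  let ?a = "f \<otimes> elem_mat 1 1 + \<upsilon> X Y f \<otimes> elem_mat 2 2" and ?b = "\<upsilon> X Y f \<otimes> elem_mat 2 2"
  have b: "?b \<in> Hom E X Y" unfolding Hom_E subspace_tensor_def
    by (rule cvec.span_base) (use u_closed[OF ob f] in auto)
  have a: "?a \<in> Hom E X Y" unfolding Hom_E subspace_tensor_def
    by (intro cvec.span_add cvec.span_base) (use u_closed[OF ob f] f in auto)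
  note s = coef_Comp ob a b eta_Hom sum_2 clinear_add[OF clinear_coef] coef_elem_mat
  note 1 = arg_cong[OF intertwine(1)[OF ob f], of "coef i j" for i j]
  note 2 = arg_cong[OF intertwine(2)[OF ob f], of "coef i j" for i j]
  show "gcmp X Y Y (coef 1 1 (\<eta> Y)) f = 0" using 1[of 1 1] by (simp add: s)
  show "gcmp X Y Y (coef 1 2 (\<eta> Y)) (\<upsilon> X Y f) = 0" using 1[of 1 2] by (simp add: s)
  show "gcmp X Y Y (coef 2 1 (\<eta> Y)) f = gcmp X X Y (\<upsilon> X Y f) (coef 2 1 (\<eta> X))" using 1[of 2 1]
    by (simp add: s)
  show "gcmp X Y Y (coef 2 2 (\<eta> Y)) (\<upsilon> X Y f) = gcmp X X Y (\<upsilon> X Y f) (coef 2 2 (\<eta> X))"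
    using 1[of 2 2] by (simp add: s)
  show "gcmp X X Y f (coef 1 1 (\<eta>' X)) = 0" using 2[of 1 1] by (simp add: s)
  show "gcmp X X Y f (coef 1 2 (\<eta>' X)) = gcmp X Y Y (coef 1 2 (\<eta>' Y)) (\<upsilon> X Y f)" using 2[of 1 2]
    by (simp add: s)
  show "gcmp X X Y (\<upsilon> X Y f) (coef 2 2 (\<eta>' X)) = gcmp X Y Y (coef 2 2 (\<eta>' Y)) (\<upsilon> X Y f)"
    using 2[of 2 2] by (simp add: s)
qed

lemma corner_zero:
  assumes X: "X \<in> Ob D"
  shows "coef 1 1 (\<eta> X) = 0" "coef 1 1 (\<eta>' X) = 0"
  using intertwine_coefs(1,5)[OF X X Id_closed[OF X]] gcmp_Id X eta_coef_Hom by metis+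

definition gu :: "'o \<Rightarrow> 'o \<Rightarrow> 'f \<Rightarrow> 'f" where
  "gu X Y f = (if X \<in> Ob D \<and> Y \<in> Ob D then \<upsilon> X Y (proj X Y f) else 0)"

text \<open>Set to 0 off the objects, so that the relations of \<open>swindle\<close> hold for all
  \<open>X\<close>.\<close>

definition entry_at :: "('o \<Rightarrow> 'f \<otimes> (complex^2^2)) \<Rightarrow> 2 \<Rightarrow> 2 \<Rightarrow> 'o \<Rightarrow> 'f" where
  "entry_at \<xi> i j X = (if X \<in> Ob D then coef i j (\<xi> X) else 0)"

lemma gu_eq: "\<lbrakk>X \<in> Ob D; Y \<in> Ob D\<rbrakk> \<Longrightarrow> gu X Y f = \<upsilon> X Y (proj X Y f)"
  by (simp add: gu_def)

lemma unit_relations: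
  assumes ob: "X \<in> Ob D" "Y \<in> Ob D" and f: "f \<in> Hom D X Y"
  defines "u \<equiv> \<upsilon> X Y f"
  shows "gcmp X Y Y (coef 1 2 (\<eta>' Y)) (gcmp X Y Y (coef 2 1 (\<eta> Y)) f) = f"
    and "gcmp X Y Y (coef 1 2 (\<eta>' Y)) (gcmp X Y Y (coef 2 2 (\<eta> Y)) u) = 0"
    and "gcmp X Y Y (coef 2 2 (\<eta>' Y)) (gcmp X Y Y (coef 2 1 (\<eta> Y)) f) = 0"
    and "gcmp X Y Y (coef 2 2 (\<eta>' Y)) (gcmp X Y Y (coef 2 2 (\<eta> Y)) u) = u"
    and "gcmp X Y Y (coef 2 1 (\<eta> Y)) (gcmp X X Y f (coef 1 2 (\<eta>' X)))
      + gcmp X Y Y (coef 2 2 (\<eta> Y)) (gcmp X X Y u (coef 2 2 (\<eta>' X))) = u"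
proof -
  have u: "u \<in> Hom D X Y" unfolding u_def by (rule u_closed[OF ob f])
  note I = intertwine_coefs[OF ob f, folded u_def]
  have e: "gcmp Y Y Y (coef i 1 (\<eta>' Y)) (coef 1 j (\<eta> Y)) +
      gcmp Y Y Y (coef i 2 (\<eta>' Y)) (coef 2 j (\<eta> Y)) =
      (if i = j then Ident D Y else 0)" for i j
    using eta_inv_eqs(1)[OF ob(2), of i j] by (simp add: sum_2)
  have e': "gcmp Y Y Y (coef 2 1 (\<eta> Y)) (coef 1 2 (\<eta>' Y)) +
      gcmp Y Y Y (coef 2 2 (\<eta> Y)) (coef 2 2 (\<eta>' Y)) = Ident D Y"
    using eta_inv_eqs(2)[OF ob(2), of 2 2] by (simp add: sum_2)
  have add: "gcmp X Y Y (a + b) g = gcmp X Y Y a g + gcmp X Y Y b g" for a b g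
    by (rule clinear_add[OF bilin_left[OF bilin_cmp clinear_id]])
  note s = cmp_assoc[symmetric] corner_zero[OF ob(2)] gcmp_Id ob f u
  have "gcmp Y Y Y (coef 1 2 (\<eta>' Y)) (coef 2 1 (\<eta> Y)) = Ident D Y" using e[of 1 1] by (simp add: s)
  then show "gcmp X Y Y (coef 1 2 (\<eta>' Y)) (gcmp X Y Y (coef 2 1 (\<eta> Y)) f) = f" by (simp add: s)
  have "gcmp Y Y Y (coef 1 2 (\<eta>' Y)) (coef 2 2 (\<eta> Y)) = 0" using e[of 1 2] by (simp add: s)
  then show "gcmp X Y Y (coef 1 2 (\<eta>' Y)) (gcmp X Y Y (coef 2 2 (\<eta> Y)) u) = 0" by (simp add: s)
  have "gcmp Y Y Y (coef 2 2 (\<eta>' Y)) (coef 2 1 (\<eta> Y)) = 0" using e[of 2 1] by (simp add: s)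
  then show "gcmp X Y Y (coef 2 2 (\<eta>' Y)) (gcmp X Y Y (coef 2 1 (\<eta> Y)) f) = 0" by (simp add: s)
  \<comment> \<open>Here no corner of \<eta> or \<eta>' occurs; the unwanted summand is killed by
    the relation that the entry (1, 2) of \<eta> annihilates \<upsilon> f.\<close>
  have "gcmp X Y Y (gcmp Y Y Y (coef 2 1 (\<eta>' Y)) (coef 1 2 (\<eta> Y))) u
      + gcmp X Y Y (gcmp Y Y Y (coef 2 2 (\<eta>' Y)) (coef 2 2 (\<eta> Y))) u = u"
    using e[of 2 2] by (simp add: add[symmetric] gcmp_Id ob u)
  then show "gcmp X Y Y (coef 2 2 (\<eta>' Y)) (gcmp X Y Y (coef 2 2 (\<eta> Y)) u) = u"
    by (simp add: cmp_assoc I)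
  show "gcmp X Y Y (coef 2 1 (\<eta> Y)) (gcmp X X Y f (coef 1 2 (\<eta>' X)))
      + gcmp X Y Y (coef 2 2 (\<eta> Y)) (gcmp X X Y u (coef 2 2 (\<eta>' X))) = u"
    unfolding I(6,7) cmp_assoc[symmetric] add[symmetric] e' by (rule gcmp_Id(2)[OF ob u])
qed

sublocale swindle H M gcmp gact "Ob D" "Hom D" gu
  "entry_at \<eta> 2 1" "entry_at \<eta> 2 2" "entry_at \<eta>' 1 2" "entry_at \<eta>' 2 2"
proof (intro swindle.intro swindle_axioms.intro)
  show "matrix_complex H M gcmp gact (Ob D) (Hom D)" by (rule matrix_complex_axioms)
  show "gact X Y 1 f = f" if "X \<in> Ob D" "Y \<in> Ob D" "f \<in> Hom D X Y" for X Y f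
    using that by (simp add: gact_eq Act_one)
  have ul: "linear_on (Hom D X Y) (\<upsilon> X Y)" if "X \<in> Ob D" "Y \<in> Ob D" for X Y
    by (rule hom_linear[OF that])
  show gul: "clinear (gu X Y)" for X Y
    using clinear_linear_on_comp[OF ul clinear_proj proj_in]
    by (cases "X \<in> Ob D \<and> Y \<in> Ob D") (auto simp: gu_def[abs_def] clinear_zero)
  have no: "gcmp X Y Z f' f = 0" if "\<not> (X \<in> Ob D \<and> Y \<in> Ob D \<and> Z \<in> Ob D)" for X Y Z f' f
    using that by (auto simp: gcmp_def)
  have no': "gact X Y h f = 0" "gu X Y f = 0" if "\<not> (X \<in> Ob D \<and> Y \<in> Ob D)" for X Y h f
    using that by (auto simp: gact_def gu_def)
  have a0: "gact X Y h 0 = 0" for X Y h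
    using clinear_0[OF bilin_right[OF bilin_gact clinear_id]] .
  show "gu X Z (gcmp X Y Z f' f) = gcmp X Y Z (gu Y Z f') (gu X Y f)" for X Y Z f' f
  proof (cases "X \<in> Ob D \<and> Y \<in> Ob D \<and> Z \<in> Ob D")
    case True
    then show ?thesis
      using hom_Comp[of X Y Z "proj X Y f" "proj Y Z f'"]
      by (simp add: gu_def gcmp_def proj_id proj_in Comp_closed u_closed u_ob)
  next
    case False
    then show ?thesis by (simp add: no clinear_0[OF gul])
  qed
  show "gu X Y (gact X Y h f) = gact X Y h (gu X Y f)" for X Y h f
  proof (cases "X \<in> Ob D \<and> Y \<in> Ob D")
    case True
    then show ?thesis
      using hom_Act[of X Y "proj X Y f" h]
      by (simp add: gu_def gact_def proj_id proj_in Act_closed u_closed u_ob)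
  qed (simp add: no')
  show "gu X Y f \<in> Hom D X Y" if "X \<in> Ob D" "Y \<in> Ob D" "f \<in> Hom D X Y" for X Y f
    using that by (simp add: gu_def proj_id u_closed)
  fix X Y Z :: 'o and h :: 'h and f :: 'f
  show "X \<in> Ob D \<Longrightarrow> entry_at \<eta> 2 1 X \<in> Hom D X X" "X \<in> Ob D \<Longrightarrow> entry_at \<eta> 2 2 X \<in> Hom D X X"
    "X \<in> Ob D \<Longrightarrow> entry_at \<eta>' 1 2 X \<in> Hom D X X" "X \<in> Ob D \<Longrightarrow> entry_at \<eta>' 2 2 X \<in> Hom D X X"
    by (simp_all add: entry_at_def eta_coef_Hom)
  show "gact X X h (entry_at \<eta> 2 1 X) = counit H h *\<^sub>C entry_at \<eta> 2 1 X"
    "gact X X h (entry_at \<eta> 2 2 X) = counit H h *\<^sub>C entry_at \<eta> 2 2 X"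
    "gact X X h (entry_at \<eta>' 1 2 X) = counit H h *\<^sub>C entry_at \<eta>' 1 2 X"
    "gact X X h (entry_at \<eta>' 2 2 X) = counit H h *\<^sub>C entry_at \<eta>' 2 2 X"
    by (simp_all add: entry_at_def eta_invariant eta'_invariant a0)
  have g1: "gact X Y 1 f = proj X Y f" if "X \<in> Ob D" "Y \<in> Ob D"
    using that by (simp add: gact_def Act_one proj_in)
  \<comment> \<open>The relations are proved as one conjunction, so that the case distinction on the
    objects is made once.\<close>
  have "(gcmp X Y Y (entry_at \<eta>' 1 2 Y) (gcmp X Y Y (entry_at \<eta> 2 1 Y) (gact X Y 1 f)) =
      gact X Y 1 f \<and>
    gcmp X Y Y (entry_at \<eta>' 1 2 Y) (gcmp X Y Y (entry_at \<eta> 2 2 Y) (gu X Y f)) = 0 \<and>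
    gcmp X Y Y (entry_at \<eta>' 2 2 Y) (gcmp X Y Y (entry_at \<eta> 2 1 Y) (gact X Y 1 f)) = 0 \<and>
    gcmp X Y Y (entry_at \<eta>' 2 2 Y) (gcmp X Y Y (entry_at \<eta> 2 2 Y) (gu X Y f)) = gu X Y f) \<and>
    gcmp X Y Y (entry_at \<eta> 2 1 Y) (gcmp X X Y (gact X Y 1 f) (entry_at \<eta>' 1 2 X)) +
      gcmp X Y Y (entry_at \<eta> 2 2 Y) (gcmp X X Y (gu X Y f) (entry_at \<eta>' 2 2 X)) = gu X Y f \<and>
    (gcmp X Y Y (entry_at \<eta>' 1 2 Y) (gu X Y f) = gcmp X X Y (gact X Y 1 f) (entry_at \<eta>' 1 2 X) \<and>
    gcmp X Y Y (entry_at \<eta>' 2 2 Y) (gu X Y f) = gcmp X X Y (gu X Y f) (entry_at \<eta>' 2 2 X)) \<and>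
    (gcmp X X Y (gu X Y f) (entry_at \<eta> 2 1 X) = gcmp X Y Y (entry_at \<eta> 2 1 Y) (gact X Y 1 f) \<and>
    gcmp X X Y (gu X Y f) (entry_at \<eta> 2 2 X) = gcmp X Y Y (entry_at \<eta> 2 2 Y) (gu X Y f))"
  proof (cases "X \<in> Ob D \<and> Y \<in> Ob D")
    case True
    then have ob: "X \<in> Ob D" "Y \<in> Ob D" by auto
    show ?thesis
      using unit_relations[OF ob proj_in[OF ob], of f] intertwine_coefs[OF ob proj_in[OF ob], of f]
      by (simp add: ob g1 gu_eq entry_at_def)
  next
    case False
    then show ?thesis by (simp add: no no')
  qed
  then show "gcmp X Y Y (entry_at \<eta>' 1 2 Y) (gcmp X Y Y (entry_at \<eta> 2 1 Y) (gact X Y 1 f)) =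
      gact X Y 1 f"
    "gcmp X Y Y (entry_at \<eta>' 1 2 Y) (gcmp X Y Y (entry_at \<eta> 2 2 Y) (gu X Y f)) = 0"
    "gcmp X Y Y (entry_at \<eta>' 2 2 Y) (gcmp X Y Y (entry_at \<eta> 2 1 Y) (gact X Y 1 f)) = 0"
    "gcmp X Y Y (entry_at \<eta>' 2 2 Y) (gcmp X Y Y (entry_at \<eta> 2 2 Y) (gu X Y f)) = gu X Y f"
    "gcmp X Y Y (entry_at \<eta> 2 1 Y) (gcmp X X Y (gact X Y 1 f) (entry_at \<eta>' 1 2 X)) +
      gcmp X Y Y (entry_at \<eta> 2 2 Y) (gcmp X X Y (gu X Y f) (entry_at \<eta>' 2 2 X)) = gu X Y f"
    "gcmp X Y Y (entry_at \<eta>' 1 2 Y) (gu X Y f) = gcmp X X Y (gact X Y 1 f) (entry_at \<eta>' 1 2 X)"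
    "gcmp X Y Y (entry_at \<eta>' 2 2 Y) (gu X Y f) = gcmp X X Y (gu X Y f) (entry_at \<eta>' 2 2 X)"
    "gcmp X X Y (gu X Y f) (entry_at \<eta> 2 1 X) = gcmp X Y Y (entry_at \<eta> 2 1 Y) (gact X Y 1 f)"
    "gcmp X X Y (gu X Y f) (entry_at \<eta> 2 2 X) = gcmp X Y Y (entry_at \<eta> 2 2 Y) (gu X Y f)"
    by blast+
qed

lemma cocycles_subset_coboundaries: "cocycles H D M n \<subseteq> coboundaries H D M n"
proof
  fix \<phi> assume "\<phi> \<in> cocycles H D M n"
  then obtain \<Phi> where \<phi>: "\<phi> = cut n \<Phi>" and g: "cyclic_cochain n \<Phi>" and c: "\<And>m c. c \<in> cyc_span (Suc
      n) \<Longrightarrow> cob n \<Phi> m c = 0"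
    unfolding cocycles_eq by auto
  then have b: "bilin \<Phi>" "invariant n \<Phi>" "is_cyclic n \<Phi>" by (auto simp: cyclic_cochain_def)
  show "\<phi> \<in> coboundaries H D M n"
  proof (cases n)
    case 0
    have "cut n \<Phi> = cut n (\<lambda>m c. 0)"
      using cocycle_trivial(1)[OF b c 0] by (simp add: cut_eq_iff b bilin_zero 0)
    then show ?thesis by (simp add: \<phi> 0 cut_zero)
  next
    case (Suc k)
    obtain \<Psi> where \<Psi>: "bilin \<Psi>" "invariant k \<Psi>" "is_cyclic k \<Psi>" "\<forall>m. \<forall>c\<in>cyc_span n. cob k \<Psi> m c =
        \<Phi> m c"
      using cocycle_trivial(2)[OF b c Suc] by blast
    have "coboundary_op H D M k (cut k \<Psi>) = \<phi>"
      using \<Psi> by (simp add: coboundary_cut \<phi> Suc[symmetric] cut_eq_iff bilin_cob b)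
    moreover have "cut k \<Psi> \<in> cyclic_cochains H D M k" using \<Psi> by (simp add: cut_in_cyclic_cochains)
    ultimately show ?thesis unfolding Suc by auto
  qed
qed

end

theorem proposition5p5:
  fixes H :: "'h::complex_algebra_1 hopf"
    and D :: "('o, 'f::complex_vector, 'h) hcat"
    and M :: "('m::complex_vector, 'h) hopf_mod"
    and \<upsilon>\<^sub>0 :: "'o \<Rightarrow> 'o" and \<upsilon> :: "'o \<Rightarrow> 'o \<Rightarrow> 'f \<Rightarrow> 'f"
    and \<eta> :: "'o \<Rightarrow> 'f \<otimes> (complex^2^2)"
  assumes "hopf_algebra H"
    and "left_hcategory H D"
    and "sayd_module H M"
    and "hlinear_semifunctor D D \<upsilon>\<^sub>0 \<upsilon>"
    and "\<eta> \<in> U_H H (tensor_M2 D)"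
    and "\<And>X. X \<in> Ob D \<Longrightarrow> \<upsilon>\<^sub>0 X = X"
    and "\<And>X Y f. \<lbrakk>X \<in> Ob D; Y \<in> Ob D; f \<in> Hom D X Y\<rbrakk> \<Longrightarrow>
      inner_aut (tensor_M2 D) \<eta> X Y (f \<otimes> elem_mat 1 1 + \<upsilon> X Y f \<otimes> elem_mat 2 2)
        = \<upsilon> X Y f \<otimes> elem_mat 2 2"
  shows "\<forall>n. HC H D M n = {coboundaries H D M n}"
proof -
  interpret hcategory_unit H M D \<upsilon>\<^sub>0 \<upsilon> \<eta>
    by (intro hcategory_unit.intro hcategory_sayd.intro hopf_sayd.intro
        hcategory_unit_axioms.intro assms)
  show ?thesis using HC_trivialI[OF cocycles_subset_coboundaries] by blast
qed

end
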